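(* Let $\mathcal X_n$ be the point process of eigenvalues of $G_n$ and let $U\subseteq\mathbb D$ be an open set satisfying the exterior ball condition: there exists $\epsilon>0$ such that for every $z\in\partial U$ there is $\eta\in U^c$ with $B(\eta,\epsilon)\subset U^c$ and $|z-\eta|=\epsilon$. Then $$\lim_{n\to\infty}\frac1{n^2}\log\mathbf P\big[\mathcal X_n(\sqrt n\,U)=0\big]=R_\emptyset-R_U.$$
   Context: $\mathbb D$ is the open unit disk, $B(\eta,\epsilon)$ the open disk of radius $\epsilon$ centered at $\eta$, $U^c=\mathbb C\setminus U$. $G_n$ is an $n\times n$ random matrix with i.i.d. standard complex Gaussian entries (density $\frac1\pi e^{-|z|^2}$ w.r.t. Lebesgue measure); $\mathcal X(A)$ is the number of points of $\mathcal X$ in $A$; $\sqrt nU=\{\sqrt nz:z\in U\}$. For $E\subseteq\mathbb C$, $\mathcal P(E)$ is the set of compactly supported Borel probability measures supported in $E$; $R_\mu=\iint\log\frac1{|z-w|}d\mu(z)d\mu(w)+\int|z|^2d\mu(z)$, $R_U=\inf_{\mu\in\mathcal P(U^c)}R_\mu$, $R_\emptyset=\inf_{\mu\in\mathcal P(\mathbb C)}R_\mu$ $(=3/4)$. *)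

theory Defs
  imports "HOL-Probability.Probability" "Jordan_Normal_Form.Char_Poly"
begin

definition std_complex_gaussian :: "complex measure" where
  "std_complex_gaussian = density lborel (\<lambda>z. ennreal (exp (- (cmod z)\<^sup>2) / pi))"

definition ginibre :: "nat \<Rightarrow> (nat \<times> nat \<Rightarrow> complex) measure" where
  "ginibre n = PiM ({0..<n} \<times> {0..<n}) (\<lambda>_. std_complex_gaussian)"

definition to_mat :: "nat \<Rightarrow> (nat \<times> nat \<Rightarrow> complex) \<Rightarrow> complex mat" where
  "to_mat n G = mat n n (\<lambda>(i, j). G (i, j))"

definition hole_prob :: "nat \<Rightarrow> complex set \<Rightarrow> real" where
  "hole_prob n U = measure (ginibre n)
     {G \<in> space (ginibre n). \<forall>z \<in> (\<lambda>w. complex_of_real (sqrt (real n)) * w) ` U.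
        \<not> eigenvalue (to_mat n G) z}"

definition cprob_measures :: "complex set \<Rightarrow> complex measure set" where
  "cprob_measures E = {\<mu>. sets \<mu> = sets borel \<and> prob_space \<mu> \<and>
     (\<exists>K. compact K \<and> K \<subseteq> E \<and> emeasure \<mu> (UNIV - K) = 0)}"

definition logker_pos :: "complex \<Rightarrow> complex \<Rightarrow> ennreal" where
  "logker_pos z w = (if z = w then \<infinity> else ennreal (max 0 (- ln (cmod (z - w)))))"

definition logker_neg :: "complex \<Rightarrow> complex \<Rightarrow> ennreal" where
  "logker_neg z w = (if z = w then 0 else ennreal (max 0 (ln (cmod (z - w)))))"

text \<open>Weighted logarithmic energy R_mu (for compactly supported mu the negative part is finite).\<close>
definition energy :: "complex measure \<Rightarrow> ereal" where
  "energy \<mu> =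
     enn2ereal (\<integral>\<^sup>+ z. (\<integral>\<^sup>+ w. logker_pos z w \<partial>\<mu>) \<partial>\<mu>)
   - enn2ereal (\<integral>\<^sup>+ z. (\<integral>\<^sup>+ w. logker_neg z w \<partial>\<mu>) \<partial>\<mu>)
   + enn2ereal (\<integral>\<^sup>+ z. ennreal ((cmod z)\<^sup>2) \<partial>\<mu>)"

definition R_U :: "complex set \<Rightarrow> ereal" where
  "R_U U = (INF \<mu> \<in> cprob_measures (- U). energy \<mu>)"

definition R_empty :: ereal where
  "R_empty = (INF \<mu> \<in> cprob_measures UNIV. energy \<mu>)"

end

theory Submission
  imports Defs "HOL-Complex_Analysis.Complex_Analysis" "HOL-Real_Asymp.Real_Asymp"
begin

text \<open>The proof compares \<open>hole_prob n U\<close> with the Coulomb gas partition function over configurations avoiding \<open>U\<close>.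

  Splitting off an eigenvalue \<open>\<lambda>\<close> with eigenvector \<open>(v, 1)\<close> of an \<open>(n + 1) \<times> (n + 1)\<close> matrix leaves an \<open>n \<times> n\<close>
  matrix, and the Jacobian of this parametrisation is the squared modulus of the characteristic polynomial of the
  smaller matrix at \<open>\<lambda>\<close>. A matrix is hit at least once and at most \<open>n + 1\<close> times, so iterating expresses the
  probability of a hole through the Vandermonde density up to a factor between \<open>1\<close> and \<open>n!\<close> and a constant
  independent of \<open>U\<close>. The constant cancels against \<open>U = {}\<close>, and \<open>ln (n!) = o(n\<^sup>2)\<close>.

  After scaling by \<open>\<surd>n\<close>, the integrand is \<open>exp\<close> of minus the off-diagonal weighted energy of the points.
  For the upper bound, every point of a configuration outside \<open>U\<close> is replaced by the uniform distribution on a disc of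
  radius \<open>r\<close> outside \<open>U\<close> at distance at most \<open>4 r\<close>, which exists by the exterior ball condition; this produces a
  competitor for \<open>R_U\<close> whose energy exceeds that of the points by little. For the lower bound, a near-minimiser
  is smeared in the same way so as to have a bounded density, and Jensen's inequality is applied to its \<open>n\<close>-fold product.\<close>

section \<open>The area formula for holomorphic functions\<close>

text \<open>The classical route to the eigenvalue density, the Schur decomposition, needs the
  invariant measure of the unitary group and an exact count of multiplicities. Here every change of
  variables is linear, a translation, or holomorphic in one variable: the eigenvector is normalised
  by its last entry, and the area formula tolerates countably many missed values and boundedly many
  preimages. Of the unitary group only one explicit rotation survives, taking the direction of
  \<open>(v, 1)\<close> to a coordinate axis, so that the Gaussian weight factorises. The recursion
  does not close on hole probabilities alone: each step leaves a squared characteristic polynomial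
  as a weight on the smaller matrix, hence the lists of eigenvalues already removed. On the energy
  side, measures with atoms have infinite energy, so a configuration cannot be compared with
  \<open>R_U U\<close> directly. Smearing at a scale \<open>r\<close> fixed before \<open>n\<close>
  costs \<open>O(n)\<close> on the diagonal and a relative error \<open>\<delta>\<close> off it;
  \<open>n\<close> goes to infinity first, then \<open>\<delta>\<close> to 0.\<close>

definition cplx_of_vec :: "real^2 \<Rightarrow> complex" where
  "cplx_of_vec x = Complex (vec_nth x 1) (vec_nth x 2)"

definition vec_of_cplx :: "complex \<Rightarrow> real^2" where
  "vec_of_cplx z = vector [Re z, Im z]"

lemma cplx_of_vec_of_cplx [simp]: "cplx_of_vec (vec_of_cplx z) = z"
  by (simp add: cplx_of_vec_def vec_of_cplx_def)

lemma vec_of_cplx_of_vec [simp]: "vec_of_cplx (cplx_of_vec x) = x"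
  by (simp add: cplx_of_vec_def vec_of_cplx_def Finite_Cartesian_Product.vec_eq_iff forall_2)

lemma bounded_linear_cplx_of_vec: "bounded_linear cplx_of_vec"
  by (intro linear_conv_bounded_linear[THEN iffD1] linearI)
     (auto simp: cplx_of_vec_def complex_eq_iff)

lemma bounded_linear_vec_of_cplx: "bounded_linear vec_of_cplx"
  by (intro linear_conv_bounded_linear[THEN iffD1] linearI)
     (auto simp: vec_of_cplx_def Finite_Cartesian_Product.vec_eq_iff forall_2)

lemma measurable_cplx_of_vec [measurable]: "cplx_of_vec \<in> borel_measurable borel"
  using bounded_linear_cplx_of_vec by (intro borel_measurable_continuous_onI linear_continuous_on)

lemma Basis_real2: "(Basis :: (real^2) set) = {axis 1 1, axis 2 1}"
  by (auto simp: Basis_vec_def UNIV_2)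

text \<open>The Jacobian theorem used below lives on \<open>real^2\<close>; this carries Lebesgue
  measure over to the plane. Equality of the measures is tested on boxes.\<close>

lemma distr_cplx_of_vec: "distr lborel borel cplx_of_vec = lborel"
proof (rule lborel_eqI[symmetric])
  fix l u :: complex
  assume le: "\<And>b. b \<in> Basis \<Longrightarrow> inner l b \<le> inner u b"
  have "cplx_of_vec -` box l u = box (vec_of_cplx l) (vec_of_cplx u)"
    by (auto simp: box_def Basis_real2 Basis_complex_def cplx_of_vec_def vec_of_cplx_def inner_axis)
  moreover have "axis 1 1 \<noteq> (axis 2 1 :: real^2)"
    by (simp add: axis_eq_axis)
  ultimately show "emeasure (distr lborel borel cplx_of_vec) (box l u) = ennreal (\<Prod>b\<in>Basis. inner (u - l) b)"
    using le[of 1] le[of \<i>] by (simp add: emeasure_distr emeasure_lborel_box_eq Basis_real2 Basis_complex_def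
        vec_of_cplx_def inner_axis inner_complex_def)
qed simp

text \<open>Multiplication by \<open>d\<close> has the real matrix with rows
  \<open>(Re d, - Im d)\<close> and \<open>(Im d, Re d)\<close>. This is the source of the squared
  moduli in all Jacobians below.\<close>

lemma det_cplx_mult: "Determinants.det (matrix (\<lambda>v. vec_of_cplx (d * cplx_of_vec v))) = (cmod d)\<^sup>2"
proof -
  have "vec_nth (vec_nth (matrix (\<lambda>v. vec_of_cplx (d * cplx_of_vec v))) 1) 1 = Re d"
       "vec_nth (vec_nth (matrix (\<lambda>v. vec_of_cplx (d * cplx_of_vec v))) 1) 2 = - Im d"
       "vec_nth (vec_nth (matrix (\<lambda>v. vec_of_cplx (d * cplx_of_vec v))) 2) 1 = Im d"
       "vec_nth (vec_nth (matrix (\<lambda>v. vec_of_cplx (d * cplx_of_vec v))) 2) 2 = Re d"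
    by (auto simp: matrix_def vec_of_cplx_def cplx_of_vec_def axis_def)
  then show ?thesis
    by (simp add: det_2 cmod_power2) (simp add: power2_eq_square)
qed

text \<open>The image is the preimage of \<open>S\<close> under the holomorphic inverse, extended by
  0 outside the open set of values.\<close>

lemma borel_image_holomorphic:
  assumes W: "open W" "h holomorphic_on W" "inj_on h W" and S: "S \<in> sets borel" "S \<subseteq> W"
  shows "h ` S \<in> sets borel"
proof -
  obtain g where g: "g holomorphic_on (h ` W)" "\<And>z. z \<in> W \<Longrightarrow> g (h z) = z"
    using holomorphic_has_inverse[OF W(2,1,3)] by metis
  have op: "open (h ` W)"
    by (rule open_mapping_thm3[OF W(2,1,3)])
  define g' where "g' a = (if a \<in> h ` W then g a else 0)" for a
  have [measurable]: "g' \<in> borel_measurable borel"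
    unfolding g'_def using op g(1)
    by (intro borel_measurable_continuous_on_if) (auto simp: holomorphic_on_imp_continuous_on)
  have "h ` S = h ` W \<inter> (g' -` S \<inter> space borel)"
  proof (intro equalityI subsetI)
    fix a assume "a \<in> h ` W \<inter> (g' -` S \<inter> space borel)"
    then obtain z where "z \<in> W" "a = h z" "g' a \<in> S" by auto
    then show "a \<in> h ` S" using g(2) by (auto simp: g'_def)
  next
    fix a assume "a \<in> h ` S"
    then obtain z where "z \<in> S" "a = h z" by auto
    then show "a \<in> h ` W \<inter> (g' -` S \<inter> space borel)" using g(2)[of z] S(2) by (auto simp: g'_def)
  qed
  also have "\<dots> \<in> sets borel"
    using op S(1) by measurable
  finally show ?thesis .
qed

lemma emeasure_image_holomorphic:
  assumes W: "open W" "h holomorphic_on W" "inj_on h W" and S: "S \<in> sets borel" "S \<subseteq> W"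
    and bd: "bounded (h ` S)"
  shows "emeasure lborel (h ` S) = (\<integral>\<^sup>+z. ennreal (indicator S z * (cmod (deriv h z))\<^sup>2) \<partial>lborel)"
proof -
  define S' where "S' = cplx_of_vec -` S"
  define f where "f x = vec_of_cplx (h (cplx_of_vec x))" for x
  define f' where "f' x = (\<lambda>v. vec_of_cplx (deriv h (cplx_of_vec x) * cplx_of_vec v))" for x
  have hS: "h ` S \<in> sets borel"
    by (rule borel_image_holomorphic[OF W S])
  have S': "S' \<in> sets borel"
    unfolding S'_def using measurable_sets_borel[OF measurable_cplx_of_vec S(1)] by simp
  have fS: "f ` S' = cplx_of_vec -` (h ` S)"
  proof (intro equalityI subsetI)
    fix x assume "x \<in> cplx_of_vec -` (h ` S)"
    then obtain z where z: "z \<in> S" "cplx_of_vec x = h z" by auto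
    then have "x = f (vec_of_cplx z)" "vec_of_cplx z \<in> S'"
      unfolding f_def S'_def by (auto simp flip: z(2))
    then show "x \<in> f ` S'" by blast
  qed (auto simp: f_def S'_def)
  have fS_borel: "f ` S' \<in> sets borel"
    unfolding fS using measurable_sets_borel[OF measurable_cplx_of_vec hS] by simp
  have "f ` S' = vec_of_cplx ` (h ` S)"
    unfolding fS by (auto simp: image_iff) (metis vec_of_cplx_of_vec)
  then have "bounded (f ` S')"
    using bounded_linear_image[OF bd bounded_linear_vec_of_cplx] by simp
  then have lm: "f ` S' \<in> lmeasurable"
    using fS_borel by (intro bounded_set_imp_lmeasurable) auto
  have der: "(f has_derivative f' x) (at x within S')" if "x \<in> S'" for x
  proof -
    have "cplx_of_vec x \<in> W"
      using that S(2) by (auto simp: S'_def)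
    then have "(h has_field_derivative deriv h (cplx_of_vec x)) (at (cplx_of_vec x))"
      using W(1,2) holomorphic_derivI by blast
    then have "(h has_derivative (\<lambda>v. deriv h (cplx_of_vec x) * v)) (at (cplx_of_vec x))"
      by (simp add: has_field_derivative_def)
    then have "((\<lambda>x. h (cplx_of_vec x)) has_derivative (\<lambda>v. deriv h (cplx_of_vec x) * cplx_of_vec v)) (at x within S')"
      by (rule has_derivative_compose[OF bounded_linear_imp_has_derivative[OF bounded_linear_cplx_of_vec]])
    then show ?thesis
      unfolding f_def[abs_def] f'_def
      by (rule bounded_linear.has_derivative[OF bounded_linear_vec_of_cplx])
  qed
  have inj: "inj_on f S'"
    using W(3) S(2) unfolding inj_on_def f_def S'_def
    by (metis subsetD vimageE cplx_of_vec_of_cplx vec_of_cplx_of_vec)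
  have "((\<lambda>x. \<bar>Determinants.det (matrix (f' x))\<bar>) has_integral measure lebesgue (f ` S')) S'"
    using has_measure_differentiable_image[of S' f f', OF _ der inj] lm S' by auto
  then have hi: "((\<lambda>x. (cmod (deriv h (cplx_of_vec x)))\<^sup>2) has_integral measure lebesgue (f ` S')) S'"
    by (simp add: f'_def det_cplx_mult)
  \<comment> \<open>Outside \<open>W\<close> nothing is known about \<open>deriv h\<close>, so it is
    replaced by 0 there before measurability is claimed.\<close>
  have *: "(\<lambda>z. indicator S z * (cmod (deriv h z))\<^sup>2) = (\<lambda>z. indicator S z * (if z \<in> W then (cmod (deriv h z))\<^sup>2 else 0))"
    using S(2) by (auto simp: indicator_def fun_eq_iff)
  have "continuous_on W (deriv h)"
    using W holomorphic_deriv holomorphic_on_imp_continuous_on by blast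
  then have "(\<lambda>z. if z \<in> W then (cmod (deriv h z))\<^sup>2 else 0) \<in> borel_measurable borel"
    using W(1) by (intro borel_measurable_continuous_on_if continuous_intros) auto
  then have m[measurable]: "(\<lambda>z. indicator S z * (cmod (deriv h z))\<^sup>2) \<in> borel_measurable borel"
    unfolding * using S(1) by measurable
  have "(\<integral>\<^sup>+z. ennreal (indicator S z * (cmod (deriv h z))\<^sup>2) \<partial>lborel)
      = (\<integral>\<^sup>+z. ennreal (indicator S z * (cmod (deriv h z))\<^sup>2) \<partial>distr lborel borel cplx_of_vec)"
    by (simp add: distr_cplx_of_vec)
  also have "\<dots> = (\<integral>\<^sup>+x. ennreal (indicator S (cplx_of_vec x) * (cmod (deriv h (cplx_of_vec x)))\<^sup>2) \<partial>lborel)"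
    by (subst nn_integral_distr) measurable
  also have "\<dots> = (\<integral>\<^sup>+x. ennreal (indicator S' x * (cmod (deriv h (cplx_of_vec x)))\<^sup>2) \<partial>lborel)"
    by (simp add: S'_def indicator_def)
  also have "\<dots> = ennreal (measure lebesgue (f ` S'))"
    by (rule nn_integral_has_integral_lebesgue[OF _ hi]) simp
  also have "\<dots> = emeasure lebesgue (f ` S')"
    by (rule emeasure_eq_measure2[OF lm, symmetric])
  also have "\<dots> = emeasure lborel (f ` S')"
    using fS_borel by simp
  also have "\<dots> = emeasure (distr lborel borel cplx_of_vec) (h ` S)"
    using hS by (simp add: emeasure_distr fS)
  also have "\<dots> = emeasure lborel (h ` S)"
    by (simp add: distr_cplx_of_vec)
  finally show ?thesis ..
qed

text \<open>Applied to the parts of \<open>S\<close> that \<open>h\<close> maps into a given set,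
  the previous formula says that the measure with density \<open>|h'|^2\<close> on \<open>S\<close>
  is pushed forward to Lebesgue measure on the image. Integrating \<open>g\<close> against both
  gives the claim.\<close>

lemma nn_integral_image_holomorphic:
  fixes g :: "complex \<Rightarrow> ennreal"
  assumes W: "open W" "h holomorphic_on W" "inj_on h W" "bounded (h ` W)"
    and S: "S \<in> sets borel" "S \<subseteq> W" and g[measurable]: "g \<in> borel_measurable borel"
  shows "(\<integral>\<^sup>+z. indicator S z * ennreal ((cmod (deriv h z))\<^sup>2) * g (h z) \<partial>lborel)
    = (\<integral>\<^sup>+a. indicator (h ` S) a * g a \<partial>lborel)"
proof -
  define h' where "h' z = (if z \<in> W then h z else 0)" for z
  define d where "d z = (if z \<in> W then (cmod (deriv h z))\<^sup>2 else 0)" for z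
  have [measurable]: "h' \<in> borel_measurable borel"
    unfolding h'_def using W holomorphic_on_imp_continuous_on
    by (intro borel_measurable_continuous_on_if) auto
  have "continuous_on W (deriv h)"
    using W holomorphic_deriv holomorphic_on_imp_continuous_on by blast
  then have d[measurable]: "d \<in> borel_measurable borel"
    unfolding d_def using W(1) by (intro borel_measurable_continuous_on_if continuous_intros) auto
  note S(1)[measurable]
  have hS[measurable]: "h ` S \<in> sets borel"
    by (rule borel_image_holomorphic[OF W(1-3) S])
  define M1 where "M1 = distr (density lborel (\<lambda>z. indicator S z * ennreal (d z))) borel h'"
  define M2 where "M2 = density lborel (indicator (h ` S) :: complex \<Rightarrow> ennreal)"
  have "M1 = M2"
  proof (rule measure_eqI)
    show "sets M1 = sets M2" by (simp add: M1_def M2_def)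
    fix A assume "A \<in> sets M1"
    then have [measurable]: "A \<in> sets borel" by (simp add: M1_def)
    define T where "T = S \<inter> (h' -` A)"
    have [measurable]: "T \<in> sets borel" unfolding T_def by measurable
    have "T \<subseteq> W" using S(2) by (auto simp: T_def)
    have hT: "h ` T = A \<inter> h ` S"
      using S(2) by (auto simp: T_def h'_def)
    have "bounded (h ` T)"
      using W(4) by (rule bounded_subset) (use \<open>T \<subseteq> W\<close> in auto)
    have hA: "h' -` A \<in> sets lborel"
      using measurable_sets_borel[of h' borel A] by simp
    have "emeasure M1 A = (\<integral>\<^sup>+z. indicator S z * ennreal (d z) * indicator (h' -` A) z \<partial>lborel)"
      unfolding M1_def by (subst emeasure_distr) (auto intro!: emeasure_density hA)
    also have "\<dots> = (\<integral>\<^sup>+z. ennreal (indicator T z * (cmod (deriv h z))\<^sup>2) \<partial>lborel)"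
      using \<open>S \<subseteq> W\<close> by (intro nn_integral_cong) (auto simp: T_def indicator_def d_def)
    also have "\<dots> = emeasure lborel (h ` T)"
      by (rule emeasure_image_holomorphic[symmetric]) (use W \<open>T \<subseteq> W\<close> \<open>bounded (h ` T)\<close> in auto)
    also have "\<dots> = emeasure M2 A"
      unfolding M2_def hT
      by (subst emeasure_density) (auto simp: nn_integral_indicator[symmetric] indicator_inter_arith mult.commute simp del: nn_integral_indicator intro!: nn_integral_cong)
    finally show "emeasure M1 A = emeasure M2 A" .
  qed
  then have "integral\<^sup>N M1 g = integral\<^sup>N M2 g" by simp
  moreover have "integral\<^sup>N M1 g = (\<integral>\<^sup>+z. indicator S z * ennreal (d z) * g (h' z) \<partial>lborel)"
    unfolding M1_def by (subst nn_integral_distr) (auto simp: nn_integral_density)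
  moreover have "\<dots> = (\<integral>\<^sup>+z. indicator S z * ennreal ((cmod (deriv h z))\<^sup>2) * g (h z) \<partial>lborel)"
    using \<open>S \<subseteq> W\<close> by (intro nn_integral_cong) (auto simp: indicator_def d_def h'_def)
  moreover have "integral\<^sup>N M2 g = (\<integral>\<^sup>+a. indicator (h ` S) a * g a \<partial>lborel)"
    unfolding M2_def by (subst nn_integral_density) auto
  ultimately show ?thesis by simp
qed

lemma countable_injectivity_partition:
  assumes "open \<Omega>" and h: "h holomorphic_on \<Omega>" and nz: "\<And>z. z \<in> \<Omega> \<Longrightarrow> deriv h z \<noteq> 0"
  obtains W S :: "nat \<Rightarrow> complex set" where "\<And>k. open (W k)" "\<And>k. W k \<subseteq> \<Omega>" "\<And>k. inj_on h (W k)"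
    "\<And>k. bounded (h ` W k)" "\<And>k. S k \<in> sets borel" "\<And>k. S k \<subseteq> W k" "disjoint_family S" "(\<Union>k. S k) = \<Omega>"
proof -
  have "\<exists>r>0. ball z r \<subseteq> \<Omega> \<and> inj_on h (ball z r) \<and> bounded (h ` ball z r)" if z: "z \<in> \<Omega>" for z
  proof -
    obtain r where r: "r > 0" "ball z r \<subseteq> \<Omega>" "inj_on h (ball z r)"
      using has_complex_derivative_locally_injective[OF h z \<open>open \<Omega>\<close> nz[OF z]] .
    \<comment> \<open>Halving the radius gives a compact closure inside \<open>\<Omega>\<close>,
      hence a bounded image.\<close>
    have "cball z (r/2) \<subseteq> \<Omega>"
      using r by (intro subset_trans[OF _ r(2)]) auto
    then have "compact (h ` cball z (r/2))"
      using h by (intro compact_continuous_image) (auto intro: holomorphic_on_imp_continuous_on holomorphic_on_subset)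
    then have "bounded (h ` ball z (r/2))"
      by (intro bounded_subset[OF compact_imp_bounded]) auto
    moreover have "ball z (r/2) \<subseteq> ball z r" using r by auto
    ultimately show ?thesis
      using r by (intro exI[of _ "r/2"]) (auto intro: inj_on_subset)
  qed
  then obtain r where r: "\<And>z. z \<in> \<Omega> \<Longrightarrow> r z > 0" "\<And>z. z \<in> \<Omega> \<Longrightarrow> ball z (r z) \<subseteq> \<Omega>"
      "\<And>z. z \<in> \<Omega> \<Longrightarrow> inj_on h (ball z (r z))" "\<And>z. z \<in> \<Omega> \<Longrightarrow> bounded (h ` ball z (r z))"
    by metis
  define F where "F = insert {} ((\<lambda>z. ball z (r z)) ` \<Omega>)"
  have "\<And>X. X \<in> F \<Longrightarrow> open X" by (auto simp: F_def)
  then obtain F' where F': "F' \<subseteq> F" "countable F'" "\<Union>F' = \<Union>F"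
    using Lindelof[of F] by auto
  \<comment> \<open>The empty set keeps the countable family nonempty, so that
    \<open>from_nat_into\<close> enumerates it; \<open>F\<close> contains the empty set as well, so
    that \<open>F''\<close> stays inside \<open>F\<close>.\<close>
  define F'' where "F'' = insert {} F'"
  have F'': "F'' \<subseteq> F" "countable F''" "\<Union>F'' = \<Union>F" "F'' \<noteq> {}"
    using F' by (auto simp: F''_def F_def)
  define W where "W = from_nat_into F''"
  have WF: "W k \<in> F" for k
    using F'' from_nat_into[of F'' k] by (auto simp: W_def)
  have "range W = F''"
    using F'' by (simp add: W_def range_from_nat_into)
  have "(\<Union>k. W k) = \<Omega>"
    unfolding \<open>range W = F''\<close> F''(3) using r(1,2) by (force simp: F_def)
  show ?thesis
  proof (rule that[of W "disjointed W"])
    fix k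
    show "W k \<subseteq> \<Omega>" using \<open>(\<Union>k. W k) = \<Omega>\<close> by auto
    show "open (W k)" "inj_on h (W k)" "bounded (h ` W k)"
      using WF[of k] r unfolding F_def by auto
    have "W k \<in> sets borel" for k
      using WF[of k] by (auto simp: F_def)
    then have "range W \<subseteq> sets borel" by auto
    then show "disjointed W k \<in> sets borel"
      using sets.range_disjointed_sets[of W borel] by auto
    show "disjointed W k \<subseteq> W k" by (rule disjointed_subset)
  next
    show "disjoint_family (disjointed W)" by (rule disjoint_family_disjointed)
    show "(\<Union>k. disjointed W k) = \<Omega>"
      using \<open>(\<Union>k. W k) = \<Omega>\<close> by (simp add: UN_disjointed_eq)
  qed
qed

lemma open_imp_fsigma:
  fixes S :: "'a::euclidean_space set"
  assumes "open S" shows "fsigma S"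
proof -
  obtain \<D> where D: "countable \<D>" "\<And>X. X \<in> \<D> \<Longrightarrow> \<exists>a b. X = cbox a b" "\<Union>\<D> = S"
    using open_countable_Union_open_cbox[OF assms] by metis
  have "countable (insert {} \<D>)" "insert {} \<D> \<noteq> {}" using D(1) by auto
  then have "range (from_nat_into (insert {} \<D>)) = insert {} \<D>"
    by (rule range_from_nat_into[rotated])
  moreover from this have "closed (from_nat_into (insert {} \<D>) n)" for n
    using D(2) closed_cbox by (metis closed_empty insertE rangeI)
  ultimately show ?thesis
    using fsigma.intros[of "from_nat_into (insert {} \<D>)"] D(3) by auto
qed

text \<open>Once the critical points are discarded, the weighted integral is the integral of
  \<open>g\<close> against \<open>mult a\<close>, the number of pieces \<open>S k\<close> whose
  image contains \<open>a\<close>. The pieces are disjoint and \<open>h\<close> is injective on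
  each, so this counts noncritical preimages: at most \<open>m\<close>, and at least 1 off a
  countable set. The set \<open>N\<close> leaves room for missed values.\<close>

lemma area_formula:
  fixes g :: "complex \<Rightarrow> ennreal"
  assumes "open \<Omega>" "connected \<Omega>" and h: "h holomorphic_on \<Omega>" and g[measurable]: "g \<in> borel_measurable borel"
    and m: "\<And>a. finite {z\<in>\<Omega>. h z = a} \<and> card {z\<in>\<Omega>. h z = a} \<le> m"
    and N: "countable N" "- N \<subseteq> h ` \<Omega>"
  shows "(\<integral>\<^sup>+a. g a \<partial>lborel) \<le> (\<integral>\<^sup>+z. indicator \<Omega> z * ennreal ((cmod (deriv h z))\<^sup>2) * g (h z) \<partial>lborel)" (is "?G \<le> ?H")
    and "(\<integral>\<^sup>+z. indicator \<Omega> z * ennreal ((cmod (deriv h z))\<^sup>2) * g (h z) \<partial>lborel) \<le> of_nat m * (\<integral>\<^sup>+a. g a \<partial>lborel)"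
proof -
  define \<Omega>' where "\<Omega>' = {z\<in>\<Omega>. deriv h z \<noteq> 0}"
  have h': "deriv h holomorphic_on \<Omega>"
    using h \<open>open \<Omega>\<close> by (rule holomorphic_deriv)
  have "\<Omega>' = \<Omega> \<inter> (deriv h -` (- {0}))" by (auto simp: \<Omega>'_def)
  also have "open \<dots>"
    using continuous_open_preimage[OF holomorphic_on_imp_continuous_on[OF h'] \<open>open \<Omega>\<close>] by auto
  finally have op': "open \<Omega>'" .
  have hol': "h holomorphic_on \<Omega>'"
    by (rule holomorphic_on_subset[OF h]) (auto simp: \<Omega>'_def)
  \<comment> \<open>The zeros of a derivative that does not vanish identically are countable. If it
    vanished identically, \<open>h\<close> would be constant and could cover only one of the
    uncountably many values outside \<open>N\<close>.\<close>
  have cnt: "countable (\<Omega> - \<Omega>')"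
  proof (cases "\<exists>z\<in>\<Omega>. deriv h z \<noteq> 0")
    case True
    then obtain b where b: "b \<in> \<Omega>" "deriv h b \<noteq> 0" by auto
    have "countable {z\<in>\<Omega>. deriv h z = 0}"
    proof (cases "deriv h constant_on \<Omega>")
      case True
      then obtain c where c: "\<And>z. z \<in> \<Omega> \<Longrightarrow> deriv h z = c"
        unfolding constant_on_def by blast
      have "{z\<in>\<Omega>. deriv h z = 0} = {}"
        using b c by fastforce
      then show ?thesis by (simp only: countable_empty)
    next
      case False
      show ?thesis
        by (rule holomorphic_countable_zeros[OF h' \<open>open \<Omega>\<close> \<open>connected \<Omega>\<close> open_imp_fsigma[OF \<open>open \<Omega>\<close>] False])
    qed
    moreover have "\<Omega> - \<Omega>' = {z\<in>\<Omega>. deriv h z = 0}" by (auto simp: \<Omega>'_def)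
    ultimately show ?thesis by simp
  next
    case False
    then have "(h has_field_derivative 0) (at z)" if "z \<in> \<Omega>" for z
      using that h \<open>open \<Omega>\<close> holomorphic_derivI by metis
    then obtain c where c: "\<And>z. z \<in> \<Omega> \<Longrightarrow> h z = c"
      using DERIV_zero_connected_constant[OF \<open>connected \<Omega>\<close> \<open>open \<Omega>\<close> finite.emptyI]
        holomorphic_on_imp_continuous_on[OF h] by (metis Diff_empty)
    then have "- N \<subseteq> {c}" using N(2) by auto
    then have "countable (UNIV :: complex set)"
      using N(1) by (metis Compl_partition countable_Un countable_finite finite.emptyI finite_insert finite_subset)
    then show ?thesis using uncountable_UNIV_complex by blast
  qed
  then have cnt2: "countable (N \<union> h ` (\<Omega> - \<Omega>'))" using N by auto
  obtain W S where WS: "\<And>k. open (W k)" "\<And>k. W k \<subseteq> \<Omega>'" "\<And>k. inj_on h (W k)"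
    "\<And>k. bounded (h ` W k)" "\<And>k::nat. S k \<in> sets borel" "\<And>k. S k \<subseteq> W k" "disjoint_family S" "(\<Union>k. S k) = \<Omega>'"
    using countable_injectivity_partition[OF op' hol'] unfolding \<Omega>'_def by blast
  have W_hol: "h holomorphic_on W k" for k
    using hol' WS(2) by (rule holomorphic_on_subset)
  have [measurable]: "S k \<in> sets borel" "h ` S k \<in> sets borel" for k
    using WS(5) borel_image_holomorphic[OF WS(1) W_hol WS(3) WS(5,6)] by auto
  define d where "d z = (if z \<in> \<Omega> then ennreal ((cmod (deriv h z))\<^sup>2) * g (h z) else 0)" for z
  have "(\<lambda>z. if z \<in> \<Omega> then ((cmod (deriv h z))\<^sup>2) else 0) \<in> borel_measurable borel"
    "(\<lambda>z. if z \<in> \<Omega> then h z else 0) \<in> borel_measurable borel"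
    using \<open>open \<Omega>\<close> holomorphic_on_imp_continuous_on[OF h'] holomorphic_on_imp_continuous_on[OF h]
    by (auto intro!: borel_measurable_continuous_on_if continuous_intros)
  note this[measurable]
  have [measurable]: "\<Omega> \<in> sets borel" using \<open>open \<Omega>\<close> by auto
  have d_eq: "d z = indicator \<Omega> z * ennreal (if z \<in> \<Omega> then ((cmod (deriv h z))\<^sup>2) else 0) * g (if z \<in> \<Omega> then h z else 0)" for z
    by (auto simp: d_def indicator_def)
  have [measurable]: "d \<in> borel_measurable borel"
    unfolding d_eq[abs_def] by measurable
  define mult where "mult a = (\<Sum>k. indicator (h ` S k) a :: ennreal)" for a
  have "?H = (\<integral>\<^sup>+z. d z \<partial>lborel)"
    by (intro nn_integral_cong) (auto simp: d_def indicator_def)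
  also have "\<dots> = (\<integral>\<^sup>+z. (\<Sum>k. indicator (S k) z * d z) \<partial>lborel)"
  proof (rule nn_integral_cong_AE)
    have "AE z in lborel. z \<notin> \<Omega> - \<Omega>'"
      using cnt by (intro AE_not_in countable_imp_null_set_lborel)
    then show "AE z in lborel. d z = (\<Sum>k. indicator (S k) z * d z)"
    proof eventually_elim
      case (elim z)
      show ?case
      proof (cases "z \<in> \<Omega>")
        case True
        then have "z \<in> (\<Union>k. S k)" using elim WS(8) by auto
        then have "(\<Sum>k. indicator (S k) z :: ennreal) = 1"
          using suminf_indicator[OF WS(7), of z] by simp
        then show ?thesis by (simp add: ennreal_suminf_multc)
      qed (simp add: d_def)
    qed
  qed
  also have "\<dots> = (\<Sum>k. \<integral>\<^sup>+z. indicator (S k) z * d z \<partial>lborel)"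
    by (rule nn_integral_suminf) measurable
  also have "\<dots> = (\<Sum>k. \<integral>\<^sup>+a. indicator (h ` S k) a * g a \<partial>lborel)"
  proof (rule suminf_cong)
    fix k
    have "S k \<subseteq> \<Omega>" using WS by (auto simp: \<Omega>'_def)
    then have "(\<integral>\<^sup>+z. indicator (S k) z * d z \<partial>lborel) = (\<integral>\<^sup>+z. indicator (S k) z * ennreal ((cmod (deriv h z))\<^sup>2) * g (h z) \<partial>lborel)"
      by (intro nn_integral_cong) (auto simp: d_def indicator_def)
    also have "\<dots> = (\<integral>\<^sup>+a. indicator (h ` S k) a * g a \<partial>lborel)"
      by (rule nn_integral_image_holomorphic[of "W k"]) (use WS W_hol in auto)
    finally show "(\<integral>\<^sup>+z. indicator (S k) z * d z \<partial>lborel) = (\<integral>\<^sup>+a. indicator (h ` S k) a * g a \<partial>lborel)" .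
  qed
  also have "\<dots> = (\<integral>\<^sup>+a. (\<Sum>k. indicator (h ` S k) a * g a) \<partial>lborel)"
    by (rule nn_integral_suminf[symmetric]) measurable
  also have "\<dots> = (\<integral>\<^sup>+a. mult a * g a \<partial>lborel)"
    by (simp add: mult_def ennreal_suminf_multc)
  finally have H: "?H = (\<integral>\<^sup>+a. mult a * g a \<partial>lborel)" .
  have [measurable]: "mult \<in> borel_measurable borel"
    unfolding mult_def[abs_def] by measurable
  have ge1: "1 \<le> mult a" if "a \<notin> N \<union> h ` (\<Omega> - \<Omega>')" for a
  proof -
    have "a \<in> h ` \<Omega>'" using that N(2) by auto
    then obtain k where "a \<in> h ` S k" using WS(8) by auto
    then have "1 = (\<Sum>j\<in>{k}. indicator (h ` S j) a :: ennreal)" by simp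
    also have "\<dots> \<le> mult a"
      unfolding mult_def by (rule sum_le_suminf) auto
    finally show ?thesis .
  qed
  have le_m: "mult a \<le> of_nat m" for a
    unfolding mult_def
  proof (rule suminf_le_const)
    fix n
    define K where "K = {k. k < n \<and> a \<in> h ` S k}"
    have "\<forall>k\<in>K. \<exists>w. w \<in> S k \<and> h w = a"
      unfolding K_def by auto
    then obtain z where z: "\<forall>k\<in>K. z k \<in> S k \<and> h (z k) = a"
      by (rule bchoice[THEN exE])
    have "inj_on z K"
    proof (rule inj_onI, rule ccontr)
      fix j k assume "j \<in> K" "k \<in> K" "z j = z k" "j \<noteq> k"
      then have "z j \<in> S j \<inter> S k" using z by force
      then show False using disjoint_family_onD[OF WS(7), of j k] \<open>j \<noteq> k\<close> by auto
    qed
    moreover have "z ` K \<subseteq> {z\<in>\<Omega>. h z = a}"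
      using z WS(8) by (auto simp: \<Omega>'_def)
    ultimately have "card K \<le> m"
      using card_mono[of "{z\<in>\<Omega>. h z = a}" "z ` K"] card_image[of z K] m[of a] by linarith
    have "(\<Sum>k<n. indicator (h ` S k) a :: ennreal) = (\<Sum>k\<in>K. 1)"
      by (intro sum.mono_neutral_cong_right) (auto simp: K_def indicator_def)
    also have "\<dots> \<le> of_nat m"
      using \<open>card K \<le> m\<close> by simp
    finally show "(\<Sum>k<n. indicator (h ` S k) a :: ennreal) \<le> of_nat m" .
  qed simp
  have "AE a in lborel. a \<notin> N \<union> h ` (\<Omega> - \<Omega>')"
    using cnt2 by (intro AE_not_in countable_imp_null_set_lborel)
  then have "AE a in lborel. g a \<le> mult a * g a"
    by eventually_elim (metis ge1 mult_1 mult_right_mono zero_le)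
  then show "?G \<le> ?H"
    unfolding H by (rule nn_integral_mono_AE)
  show "?H \<le> of_nat m * ?G"
    unfolding H by (subst nn_integral_cmult[symmetric]) (auto intro!: nn_integral_mono mult_right_mono le_m)
qed

section \<open>Characteristic polynomials of bordered matrices\<close>

text \<open>Matrices are functions on pairs of indices, of which \<open>detf n\<close> reads the
  leading \<open>n\<close> by \<open>n\<close> block. Minors of all orders can thus be taken of one
  function, and the same functions are the points of the product spaces carrying Lebesgue
  measure.\<close>

definition detf :: "nat \<Rightarrow> (nat \<times> nat \<Rightarrow> complex) \<Rightarrow> complex" where
  "detf n T = Determinant.det (mat n n T)"

text \<open>Cramer's rule. For a singular block, division by zero makes this the zero matrix, so
  \<open>resolvent\<close> is a total function and measurable in all its arguments.\<close>

definition invf :: "nat \<Rightarrow> (nat \<times> nat \<Rightarrow> complex) \<Rightarrow> nat \<times> nat \<Rightarrow> complex" where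
  "invf n T = (\<lambda>ij. adj_mat (mat n n T) $$ ij / detf n T)"

definition lam :: "complex \<Rightarrow> (nat \<times> nat \<Rightarrow> complex) \<Rightarrow> nat \<times> nat \<Rightarrow> complex" where
  "lam z D = (\<lambda>(i, j). (if i = j then z else 0) - D (i, j))"

definition chi :: "nat \<Rightarrow> (nat \<times> nat \<Rightarrow> complex) \<Rightarrow> complex \<Rightarrow> complex" where
  "chi n D z = detf n (lam z D)"

lemma detf_expand: "detf n T = (\<Sum>p | p permutes {0..<n}. signof p * (\<Prod>i=0..<n. T (i, p i)))"
  unfolding detf_def
  by (subst det_def'[of _ n]) (auto intro!: sum.cong prod.cong simp: permutes_in_image)

lemma detf_cong: "(\<And>i j. i < n \<Longrightarrow> j < n \<Longrightarrow> T (i, j) = T' (i, j)) \<Longrightarrow> detf n T = detf n T'"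
  unfolding detf_def by (intro arg_cong[where f=Determinant.det] cong_mat) auto

lemma chi_cong: "(\<And>i j. i < n \<Longrightarrow> j < n \<Longrightarrow> D (i, j) = D' (i, j)) \<Longrightarrow> chi n D z = chi n D' z"
  unfolding chi_def by (intro detf_cong) (auto simp: lam_def)

lemma detf_mult: "detf n (\<lambda>(i, j). \<Sum>k<n. S (i, k) * T (k, j)) = detf n S * detf n T"
proof -
  have "mat n n (\<lambda>(i, j). \<Sum>k<n. S (i, k) * T (k, j)) = mat n n S * mat n n T"
    by (rule eq_matI) (auto simp: scalar_prod_def atLeast0LessThan)
  then show ?thesis
    unfolding detf_def using det_mult[of "mat n n S" n "mat n n T"] by simp
qed

lemma detf_upper:
  assumes "\<And>i j. j < i \<Longrightarrow> i < n \<Longrightarrow> T (i, j) = 0"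
  shows "detf n T = (\<Prod>i<n. T (i, i))"
proof -
  have "detf n T = prod_list (diag_mat (mat n n T))"
    unfolding detf_def by (rule det_upper_triangular) (use assms in \<open>auto simp: upper_triangular_def\<close>)
  also have "\<dots> = (\<Prod>i<n. T (i, i))"
    by (auto simp: diag_mat_def prod.distinct_set_conv_list[symmetric] atLeast0LessThan intro!: prod.cong)
  finally show ?thesis .
qed

lemma detf_lower:
  assumes "\<And>i j. i < j \<Longrightarrow> j < n \<Longrightarrow> T (i, j) = 0"
  shows "detf n T = (\<Prod>i<n. T (i, i))"
proof -
  have "detf n T = prod_list (diag_mat (mat n n T))"
    unfolding detf_def by (rule det_lower_triangular[of n]) (use assms in auto)
  also have "\<dots> = (\<Prod>i<n. T (i, i))"
    by (auto simp: diag_mat_def prod.distinct_set_conv_list[symmetric] atLeast0LessThan intro!: prod.cong)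
  finally show ?thesis .
qed

lemma detf_last_col:
  "detf (Suc n) T = (\<Sum>i<Suc n. T (i, n) * cofactor (mat (Suc n) (Suc n) T) i n)"
  unfolding detf_def by (subst laplace_expansion_column[of _ "Suc n" n]) auto

lemma detf_last_row:
  "detf (Suc n) T = (\<Sum>j<Suc n. T (n, j) * cofactor (mat (Suc n) (Suc n) T) n j)"
  unfolding detf_def by (subst laplace_expansion_row[of _ "Suc n" n]) auto

lemma cofactor_last: "cofactor (mat (Suc n) (Suc n) T) n n = detf n T"
proof -
  have "mat_delete (mat (Suc n) (Suc n) T) n n = mat n n T"
    unfolding mat_delete_def by (rule eq_matI) auto
  then show ?thesis by (simp add: cofactor_def detf_def)
qed

lemma detf_last_col_zero:
  assumes "\<And>i. i < n \<Longrightarrow> T (i, n) = 0"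
  shows "detf (Suc n) T = detf n T * T (n, n)"
  unfolding detf_last_col using assms by (simp add: cofactor_last)

lemma detf_last_row_zero:
  assumes "\<And>i. i < n \<Longrightarrow> T (n, i) = 0"
  shows "detf (Suc n) T = detf n T * T (n, n)"
  unfolding detf_last_row using assms by (simp add: cofactor_last)

lemma detf_last_col_smult:
  "detf (Suc n) (\<lambda>(i, j). if j = n then c * T (i, n) else T (i, j)) = c * detf (Suc n) T"
proof -
  have "cofactor (mat (Suc n) (Suc n) (\<lambda>(i, j). if j = n then c * T (i, n) else T (i, j))) i n
      = cofactor (mat (Suc n) (Suc n) T) i n" for i
    unfolding mat_delete_def cofactor_def by (intro arg_cong2[where f="(*)"] arg_cong[where f=Determinant.det] eq_matI) auto
  then show ?thesis
    unfolding detf_last_col by (simp add: sum_distrib_left mult.assoc del: sum.lessThan_Suc)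
qed

text \<open>Column operations are right multiplications by a unitriangular matrix: an upper one
  here, a lower one in \<open>detf_cols_add\<close>.\<close>

lemma detf_col_add_last:
  "detf (Suc n) (\<lambda>(i, j). if j = n then T (i, n) + (\<Sum>k<n. T (i, k) * y k) else T (i, j)) = detf (Suc n) T"
proof -
  define P where "P = (\<lambda>(i, j). if i = j then 1 else if j = n then y i else 0)"
  have "detf (Suc n) T = detf (Suc n) T * detf (Suc n) P"
    by (subst detf_upper[of _ P]) (auto simp: P_def)
  also have "\<dots> = detf (Suc n) (\<lambda>(i, j). \<Sum>k<Suc n. T (i, k) * P (k, j))"
    by (rule detf_mult[symmetric])
  also have "\<dots> = detf (Suc n) (\<lambda>(i, j). if j = n then T (i, n) + (\<Sum>k<n. T (i, k) * y k) else T (i, j))"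
  proof (rule detf_cong, clarsimp simp del: sum.lessThan_Suc, intro conjI impI)
    fix i j
    show "(\<Sum>k<Suc n. T (i, k) * P (k, n)) = T (i, n) + (\<Sum>k<n. T (i, k) * y k)"
      by (simp add: P_def)
    assume "j < Suc n" "j \<noteq> n"
    then have "(\<Sum>k<Suc n. T (i, k) * P (k, j)) = (\<Sum>k<Suc n. if k = j then T (i, k) else 0)"
      by (intro sum.cong) (auto simp: P_def)
    then show "(\<Sum>k<Suc n. T (i, k) * P (k, j)) = T (i, j)"
      using \<open>j < Suc n\<close> by (simp del: sum.lessThan_Suc)
  qed
  finally show ?thesis ..
qed

lemma detf_cols_add:
  "detf (Suc n) (\<lambda>(i, j). if j = n then T (i, n) else T (i, j) + T (i, n) * y j) = detf (Suc n) T"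
proof -
  define P where "P = (\<lambda>(i, j). if i = j then 1 else if i = n then y j else 0)"
  have "detf (Suc n) T = detf (Suc n) T * detf (Suc n) P"
    by (subst detf_lower[of _ P]) (auto simp: P_def)
  also have "\<dots> = detf (Suc n) (\<lambda>(i, j). \<Sum>k<Suc n. T (i, k) * P (k, j))"
    by (rule detf_mult[symmetric])
  also have "\<dots> = detf (Suc n) (\<lambda>(i, j). if j = n then T (i, n) else T (i, j) + T (i, n) * y j)"
  proof (rule detf_cong, clarsimp simp del: sum.lessThan_Suc, intro conjI impI)
    fix i j
    have "(\<Sum>k<Suc n. T (i, k) * P (k, n)) = (\<Sum>k<Suc n. if k = n then T (i, k) else 0)"
      by (intro sum.cong) (auto simp: P_def)
    then show "(\<Sum>k<Suc n. T (i, k) * P (k, n)) = T (i, n)"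
      by (simp del: sum.lessThan_Suc)
    assume "j < Suc n" "j \<noteq> n"
    have "(\<Sum>k<n. T (i, k) * P (k, j)) = (\<Sum>k<n. if k = j then T (i, k) else 0)"
      by (intro sum.cong) (auto simp: P_def)
    then have "(\<Sum>k<Suc n. T (i, k) * P (k, j)) = (\<Sum>k<n. if k = j then T (i, k) else 0) + T (i, n) * y j"
      using \<open>j \<noteq> n\<close> by (simp add: P_def)
    then show "(\<Sum>k<Suc n. T (i, k) * P (k, j)) = T (i, j) + T (i, n) * y j"
      using \<open>j < Suc n\<close> \<open>j \<noteq> n\<close> by (simp del: sum.lessThan_Suc)
  qed
  finally show ?thesis ..
qed

text \<open>Subtracting the combination \<open>x\<close> of the first \<open>n\<close> columns from
  the last one leaves the Schur complement as its only entry. A solution \<open>x\<close> is all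
  that is asked for, not an inverse of the leading block.\<close>

lemma detf_schur:
  assumes "\<And>i. i < n \<Longrightarrow> (\<Sum>k<n. T (i, k) * x k) = T (i, n)"
  shows "detf (Suc n) T = detf n T * (T (n, n) - (\<Sum>k<n. T (n, k) * x k))"
proof -
  have "detf (Suc n) T = detf (Suc n) (\<lambda>(i, j). if j = n then T (i, n) + (\<Sum>k<n. T (i, k) * - x k) else T (i, j))"
    by (rule detf_col_add_last[symmetric])
  also have "\<dots> = detf n (\<lambda>(i, j). if j = n then T (i, n) + (\<Sum>k<n. T (i, k) * - x k) else T (i, j)) *
      (T (n, n) - (\<Sum>k<n. T (n, k) * x k))"
    by (subst detf_last_col_zero) (auto simp: assms sum_negf)
  also have "detf n (\<lambda>(i, j). if j = n then T (i, n) + (\<Sum>k<n. T (i, k) * - x k) else T (i, j)) = detf n T"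
    by (rule detf_cong) auto
  finally show ?thesis .
qed

text \<open>The last row is eliminated with the corner as pivot. Read from right to left, the
  identity expresses the determinant of a rank one perturbation through a bordered matrix.\<close>

lemma detf_rank_one_update:
  assumes "T (n, n) = 1"
  shows "detf (Suc n) T = detf n (\<lambda>(i, j). T (i, j) - T (i, n) * T (n, j))"
proof -
  have "detf (Suc n) T = detf (Suc n) (\<lambda>(i, j). if j = n then T (i, n) else T (i, j) + T (i, n) * - T (n, j))"
    by (rule detf_cols_add[symmetric])
  also have "\<dots> = detf n (\<lambda>(i, j). if j = n then T (i, n) else T (i, j) + T (i, n) * - T (n, j))"
    by (subst detf_last_row_zero) (auto simp: assms)
  also have "\<dots> = detf n (\<lambda>(i, j). T (i, j) - T (i, n) * T (n, j))"
    by (rule detf_cong) auto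
  finally show ?thesis .
qed

section \<open>Inverses and matrix-vector products\<close>

lemma invf_right:
  assumes "detf n T \<noteq> 0" "i < n" "j < n"
  shows "(\<Sum>k<n. T (i, k) * invf n T (k, j)) = (if i = j then 1 else 0)"
proof -
  define A where "A = mat n n T"
  have A: "A \<in> carrier_mat n n" by (simp add: A_def)
  have "(A * adj_mat A) $$ (i, j) = (\<Sum>k<n. T (i, k) * adj_mat A $$ (k, j))"
    using assms adj_mat(1)[OF A] by (auto simp: scalar_prod_def A_def atLeast0LessThan intro!: sum.cong)
  moreover have "(A * adj_mat A) $$ (i, j) = detf n T * (if i = j then 1 else 0)"
    unfolding adj_mat(2)[OF A] using assms by (simp add: A_def detf_def)
  ultimately have "(\<Sum>k<n. T (i, k) * adj_mat A $$ (k, j)) = detf n T * (if i = j then 1 else 0)"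
    by (simp only:)
  then show ?thesis
    using assms(1) by (simp add: invf_def A_def[symmetric] sum_divide_distrib[symmetric])
qed

lemma invf_left:
  assumes "detf n T \<noteq> 0" "i < n" "j < n"
  shows "(\<Sum>k<n. invf n T (i, k) * T (k, j)) = (if i = j then 1 else 0)"
proof -
  define A where "A = mat n n T"
  have A: "A \<in> carrier_mat n n" by (simp add: A_def)
  have "(adj_mat A * A) $$ (i, j) = (\<Sum>k<n. adj_mat A $$ (i, k) * T (k, j))"
    using assms adj_mat(1)[OF A] by (auto simp: scalar_prod_def A_def atLeast0LessThan intro!: sum.cong)
  moreover have "(adj_mat A * A) $$ (i, j) = detf n T * (if i = j then 1 else 0)"
    unfolding adj_mat(3)[OF A] using assms by (simp add: A_def detf_def)
  ultimately have "(\<Sum>k<n. adj_mat A $$ (i, k) * T (k, j)) = detf n T * (if i = j then 1 else 0)"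
    by (simp only:)
  then show ?thesis
    using assms(1) by (simp add: invf_def A_def[symmetric] sum_divide_distrib[symmetric])
qed

definition mvf :: "nat \<Rightarrow> (nat \<times> nat \<Rightarrow> complex) \<Rightarrow> (nat \<Rightarrow> complex) \<Rightarrow> nat \<Rightarrow> complex" where
  "mvf n T x = (\<lambda>i\<in>{..<n}. \<Sum>j<n. T (i, j) * x j)"

lemma mvf_apply: "i < n \<Longrightarrow> mvf n T x i = (\<Sum>j<n. T (i, j) * x j)"
  by (simp add: mvf_def)

lemma mvf_invf_right:
  assumes "detf n T \<noteq> 0" "i < n"
  shows "mvf n T (mvf n (invf n T) x) i = x i"
proof -
  have "mvf n T (mvf n (invf n T) x) i = (\<Sum>k<n. \<Sum>j<n. T (i, k) * (invf n T (k, j) * x j))"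
    using assms by (simp add: mvf_apply sum_distrib_left)
  also have "\<dots> = (\<Sum>j<n. (\<Sum>k<n. T (i, k) * invf n T (k, j)) * x j)"
    by (subst sum.swap) (simp add: sum_distrib_right mult.assoc)
  also have "\<dots> = (\<Sum>j<n. if i = j then x j else 0)"
    using assms by (intro sum.cong) (auto simp: invf_right)
  finally show ?thesis using assms by simp
qed

lemma mvf_invf_left:
  assumes "detf n T \<noteq> 0" "i < n"
  shows "mvf n (invf n T) (mvf n T x) i = x i"
proof -
  have "mvf n (invf n T) (mvf n T x) i = (\<Sum>k<n. \<Sum>j<n. invf n T (i, k) * (T (k, j) * x j))"
    using assms by (simp add: mvf_apply sum_distrib_left)
  also have "\<dots> = (\<Sum>j<n. (\<Sum>k<n. invf n T (i, k) * T (k, j)) * x j)"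
    by (subst sum.swap) (simp add: sum_distrib_right mult.assoc)
  also have "\<dots> = (\<Sum>j<n. if i = j then x j else 0)"
    using assms by (intro sum.cong) (auto simp: invf_left)
  finally show ?thesis using assms by simp
qed

section \<open>Bordered matrices and their characteristic polynomials\<close>

definition asm :: "nat \<Rightarrow> (nat \<times> nat \<Rightarrow> complex) \<Rightarrow> (nat \<Rightarrow> complex) \<Rightarrow> (nat \<Rightarrow> complex) \<Rightarrow> complex \<Rightarrow> nat \<times> nat \<Rightarrow> complex" where
  "asm n D b c a = (\<lambda>ij\<in>{..<Suc n} \<times> {..<Suc n}. if fst ij < n then if snd ij < n then D ij else c (fst ij)
      else if snd ij < n then b (snd ij) else a)"

lemma asm_apply [simp]:
  "i < n \<Longrightarrow> j < n \<Longrightarrow> asm n D b c a (i, j) = D (i, j)"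
  "i < n \<Longrightarrow> asm n D b c a (i, n) = c i"
  "j < n \<Longrightarrow> asm n D b c a (n, j) = b j"
  "asm n D b c a (n, n) = a"
  by (auto simp: asm_def)

definition resolvent :: "nat \<Rightarrow> (nat \<times> nat \<Rightarrow> complex) \<Rightarrow> complex \<Rightarrow> (nat \<Rightarrow> complex) \<Rightarrow> nat \<Rightarrow> complex" where
  "resolvent n D z c = mvf n (invf n (lam z D)) c"

text \<open>Outside the spectrum of \<open>D\<close>, \<open>z\<close> is an eigenvalue of the matrix with blocks \<open>D\<close>, \<open>c\<close>, \<open>b\<close>, \<open>a\<close> iff
  \<open>hfun n D b c z = a\<close>.\<close>
definition hfun :: "nat \<Rightarrow> (nat \<times> nat \<Rightarrow> complex) \<Rightarrow> (nat \<Rightarrow> complex) \<Rightarrow> (nat \<Rightarrow> complex) \<Rightarrow> complex \<Rightarrow> complex" where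
  "hfun n D b c z = z - (\<Sum>j<n. b j * resolvent n D z c j)"

definition deflate :: "(nat \<times> nat \<Rightarrow> complex) \<Rightarrow> (nat \<Rightarrow> complex) \<Rightarrow> (nat \<Rightarrow> complex) \<Rightarrow> nat \<times> nat \<Rightarrow> complex" where
  "deflate D b v = (\<lambda>(i, j). D (i, j) - v i * b j)"

lemma lam_sum: "i < n \<Longrightarrow> (\<Sum>j<n. lam z D (i, j) * x j) = z * x i - (\<Sum>j<n. D (i, j) * x j)"
  by (simp add: lam_def left_diff_distrib sum_subtractf if_distrib[of "\<lambda>t. t * _"] cong: if_cong)

lemma chi_schur:
  assumes "chi n D z \<noteq> 0"
  shows "chi (Suc n) (asm n D b c a) z = chi n D z * (hfun n D b c z - a)"
proof -
  let ?T = "lam z (asm n D b c a)"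
  \<comment> \<open>The sign comes from the border of \<open>z - G\<close>, whose last column is
    \<open>- c\<close>.\<close>
  define x where "x k = - resolvent n D z c k" for k
  have "(\<Sum>k<n. ?T (i, k) * x k) = ?T (i, n)" if "i < n" for i
  proof -
    have "(\<Sum>k<n. ?T (i, k) * x k) = - mvf n (lam z D) (resolvent n D z c) i"
      using that by (simp add: mvf_apply x_def sum_negf[symmetric] lam_def)
    also have "\<dots> = - c i"
      unfolding resolvent_def using that assms by (subst mvf_invf_right) (auto simp: chi_def)
    finally show ?thesis using that by (simp add: lam_def)
  qed
  then have "chi (Suc n) (asm n D b c a) z = detf n ?T * (?T (n, n) - (\<Sum>k<n. ?T (n, k) * x k))"
    unfolding chi_def by (rule detf_schur)
  also have "detf n ?T = chi n D z"
    unfolding chi_def by (rule detf_cong) (auto simp: lam_def)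
  also have "?T (n, n) - (\<Sum>k<n. ?T (n, k) * x k) = hfun n D b c z - a"
    by (simp add: lam_def hfun_def x_def)
  finally show ?thesis .
qed

text \<open>The two hypotheses say that \<open>(v, 1)\<close> is an eigenvector with eigenvalue
  \<open>l\<close>. Adding the combination \<open>v\<close> of the first columns to the last one
  therefore turns it into \<open>(z - l)\<close> times \<open>(v, 1)\<close>; after this factor is
  taken out, the corner is 1 and serves as pivot, which leaves \<open>z - (D - v b)\<close>.\<close>

lemma chi_deflate:
  assumes c: "\<And>i. i < n \<Longrightarrow> c i = l * v i - (\<Sum>j<n. D (i, j) * v j)" and a: "a = l - (\<Sum>j<n. b j * v j)"
  shows "chi (Suc n) (asm n D b c a) z = (z - l) * chi n (deflate D b v) z"
proof -
  let ?T = "lam z (asm n D b c a)"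
  define T' where "T' = (\<lambda>(i, j). if j = n then if i = n then 1 else v i else ?T (i, j))"
  have "chi (Suc n) (asm n D b c a) z
      = detf (Suc n) (\<lambda>(i, j). if j = n then ?T (i, n) + (\<Sum>k<n. ?T (i, k) * v k) else ?T (i, j))"
    unfolding chi_def by (rule detf_col_add_last[symmetric])
  also have "\<dots> = detf (Suc n) (\<lambda>(i, j). if j = n then (z - l) * T' (i, n) else T' (i, j))"
  proof (rule detf_cong)
    fix i j assume ij: "i < Suc n" "j < Suc n"
    have "?T (i, n) + (\<Sum>k<n. ?T (i, k) * v k) = (z - l) * T' (i, n)"
    proof (cases "i = n")
      case True
      then have "(\<Sum>k<n. ?T (i, k) * v k) = - (\<Sum>k<n. b k * v k)"
        by (simp add: lam_def sum_negf[symmetric])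
      then show ?thesis using True by (simp add: T'_def lam_def a)
    next
      case False
      then have "i < n" using ij by simp
      have "(\<Sum>k<n. ?T (i, k) * v k) = (\<Sum>k<n. lam z D (i, k) * v k)"
        using \<open>i < n\<close> by (intro sum.cong) (auto simp: lam_def)
      then have "(\<Sum>k<n. ?T (i, k) * v k) = z * v i - (\<Sum>j<n. D (i, j) * v j)"
        using \<open>i < n\<close> by (simp add: lam_sum)
      moreover have "?T (i, n) = - c i" using \<open>i < n\<close> by (simp add: lam_def)
      ultimately show ?thesis
        using \<open>i < n\<close> c[of i] False by (simp add: T'_def left_diff_distrib)
    qed
    then show "(case (i, j) of (i, j) \<Rightarrow> if j = n then ?T (i, n) + (\<Sum>k<n. ?T (i, k) * v k) else ?T (i, j))
      = (case (i, j) of (i, j) \<Rightarrow> if j = n then (z - l) * T' (i, n) else T' (i, j))"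
      by (simp add: T'_def)
  qed
  also have "\<dots> = (z - l) * detf (Suc n) T'"
    by (rule detf_last_col_smult)
  also have "detf (Suc n) T' = detf n (\<lambda>(i, j). T' (i, j) - T' (i, n) * T' (n, j))"
    by (rule detf_rank_one_update) (simp add: T'_def)
  also have "\<dots> = chi n (deflate D b v) z"
    unfolding chi_def by (rule detf_cong) (auto simp: T'_def lam_def deflate_def)
  finally show ?thesis .
qed

lemma continuous_detf:
  assumes "\<And>i j. i < n \<Longrightarrow> j < n \<Longrightarrow> continuous F (\<lambda>x. T x (i, j))"
  shows "continuous F (\<lambda>x. detf n (T x))"
  unfolding detf_expand
  by (intro continuous_intros assms) (auto simp: permutes_in_image)

lemma isCont_chi: "isCont (chi n D) z"
proof -
  have "isCont (\<lambda>z. lam z D (i, j)) z" for i j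
    by (cases "i = j") (auto simp: lam_def intro!: continuous_intros)
  then show ?thesis
    unfolding chi_def[abs_def] by (intro continuous_detf)
qed

lemma chi_eq_char_poly: "chi n D z = poly (char_poly (mat n n D)) z"
proof -
  have "- char_matrix (mat n n D) z = mat n n (lam z D)"
    by (rule eq_matI) (auto simp: char_matrix_def lam_def)
  then show ?thesis
    by (subst char_poly_matrix[of _ n]) (auto simp: chi_def detf_def)
qed

lemma chi_factorized:
  obtains as where "length as = n" "\<And>z. chi n D z = (\<Prod>a\<leftarrow>as. z - a)"
proof -
  obtain as where as: "char_poly (mat n n D) = (\<Prod>a\<leftarrow>as. [:- a, 1:])" "length as = n"
    using char_poly_factorized[of "mat n n D" n] by auto
  have "chi n D z = (\<Prod>a\<leftarrow>as. z - a)" for z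
    unfolding chi_eq_char_poly as(1) by (simp add: poly_prod_list o_def)
  then show ?thesis using as(2) that by blast
qed

lemma chi_roots: "finite {z. chi n D z = 0}" "card {z. chi n D z = 0} \<le> n"
proof -
  obtain as where as: "length as = n" "\<And>z. chi n D z = (\<Prod>a\<leftarrow>as. z - a)"
    using chi_factorized by blast
  have "{z. chi n D z = 0} \<subseteq> set as"
    unfolding as(2) by (auto simp: prod_list_zero_iff)
  then show "finite {z. chi n D z = 0}" "card {z. chi n D z = 0} \<le> n"
    using as(1) by (auto intro: finite_subset) (meson List.finite_set card_length card_mono le_trans)
qed

lemma resolvent_eq:
  assumes "chi n D l \<noteq> 0" "i < n"
  shows "c i = l * resolvent n D l c i - (\<Sum>j<n. D (i, j) * resolvent n D l c j)"
proof -
  have "c i = mvf n (lam l D) (resolvent n D l c) i"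
    unfolding resolvent_def using assms by (subst mvf_invf_right) (auto simp: chi_def)
  also have "\<dots> = (\<Sum>j<n. lam l D (i, j) * resolvent n D l c j)"
    using assms by (simp add: mvf_apply)
  finally show ?thesis using assms by (simp add: lam_sum)
qed

text \<open>The bordered matrix with corner \<open>hfun n D b c l\<close> has the eigenvector
  \<open>(resolvent n D l c, 1)\<close> for \<open>l\<close>. Its characteristic polynomial is thus
  known in two ways, by the Schur complement and by deflation, and comparing them gives the
  difference quotient exactly. Only continuity of the polynomials is left.\<close>

lemma hfun_has_derivative:
  assumes "chi n D l \<noteq> 0"
  shows "(hfun n D b c has_field_derivative chi n (deflate D b (resolvent n D l c)) l / chi n D l) (at l)"
proof -
  let ?D' = "deflate D b (resolvent n D l c)"
  have eq: "(hfun n D b c z - hfun n D b c l) / (z - l) = chi n ?D' z / chi n D z" if "chi n D z \<noteq> 0" "z \<noteq> l" for z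
  proof -
    have "chi n D z * (hfun n D b c z - hfun n D b c l) = chi (Suc n) (asm n D b c (hfun n D b c l)) z"
      using chi_schur[OF that(1)] by simp
    also have "\<dots> = (z - l) * chi n ?D' z"
      by (rule chi_deflate) (auto intro: resolvent_eq[OF assms] simp: hfun_def)
    finally show ?thesis using that by (simp add: frac_eq_eq mult.commute)
  qed
  have "((\<lambda>z. chi n ?D' z / chi n D z) \<longlongrightarrow> chi n ?D' l / chi n D l) (at l)"
    using isCont_chi[of l n ?D'] isCont_chi[of l n D] assms by (intro tendsto_divide) (auto simp: isCont_def)
  moreover have "eventually (\<lambda>z. chi n D z \<noteq> 0) (at l)"
    using isCont_chi[of l n D] assms by (intro tendsto_imp_eventually_ne) (auto simp: isCont_def)
  then have "eventually (\<lambda>z. chi n ?D' z / chi n D z = (hfun n D b c z - hfun n D b c l) / (z - l)) (at l)"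
    using eventually_neq_at_within[of l l UNIV] by eventually_elim (simp add: eq)
  ultimately show ?thesis
    unfolding has_field_derivative_iff by (rule Lim_transform_eventually)
qed

lemma hfun_fibre_subset:
  "{z. chi n D z \<noteq> 0 \<and> hfun n D b c z = a} \<subseteq> {z. chi (Suc n) (asm n D b c a) z = 0}"
  by (auto simp: chi_schur)

text \<open>If every root of the bordered matrix were an eigenvalue of \<open>D\<close>, its characteristic
  polynomial would be one of finitely many, and this happens for finitely many \<open>a\<close> only.\<close>
lemma hfun_almost_surjective:
  "finite (- (hfun n D b c ` {z. chi n D z \<noteq> 0}))"
proof -
  define Z where "Z = {z. chi n D z = 0}"
  have fin: "finite Z" unfolding Z_def by (rule chi_roots)
  \<comment> \<open>Any point off the spectrum of \<open>D\<close> serves: there the value of the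
    bordered characteristic polynomial determines the corner \<open>a\<close>.\<close>
  then obtain z0 where z0: "z0 \<notin> Z" using ex_new_if_finite infinite_UNIV_char_0 by blast
  define V where "V = (\<lambda>as. \<Prod>a\<leftarrow>as. z0 - a) ` {as. set as \<subseteq> Z \<and> length as = Suc n}"
  have "finite V" unfolding V_def by (intro finite_imageI finite_lists_length_eq fin)
  have "- (hfun n D b c ` {z. chi n D z \<noteq> 0}) \<subseteq> (\<lambda>w. hfun n D b c z0 - w / chi n D z0) ` V"
  proof
    fix a assume "a \<in> - (hfun n D b c ` {z. chi n D z \<noteq> 0})"
    then have a: "chi n D z = 0" if "hfun n D b c z = a" for z using that by auto
    obtain as where as: "length as = Suc n" "\<And>z. chi (Suc n) (asm n D b c a) z = (\<Prod>a\<leftarrow>as. z - a)"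
      using chi_factorized by blast
    have "set as \<subseteq> Z"
    proof
      fix r assume "r \<in> set as"
      then have "chi (Suc n) (asm n D b c a) r = 0"
        unfolding as(2) by (auto simp: prod_list_zero_iff)
      then show "r \<in> Z"
        using a[of r] chi_schur[of n D r b c a] by (auto simp: Z_def)
    qed
    then have "chi (Suc n) (asm n D b c a) z0 \<in> V"
      unfolding V_def as(2) using as(1) by auto
    moreover have "a = hfun n D b c z0 - chi (Suc n) (asm n D b c a) z0 / chi n D z0"
      using z0 by (simp add: chi_schur Z_def)
    ultimately show "a \<in> (\<lambda>w. hfun n D b c z0 - w / chi n D z0) ` V" by blast
  qed
  then show ?thesis using \<open>finite V\<close> finite_subset by blast
qed

global_interpretation lborelC: product_sigma_finite "\<lambda>_::'i. lborel :: complex measure"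
  by standard

section \<open>Lebesgue measure on vectors and matrices\<close>

abbreviation LB :: "'i set \<Rightarrow> ('i \<Rightarrow> complex) measure" where
  "LB I \<equiv> PiM I (\<lambda>_. lborel)"

abbreviation LV :: "nat \<Rightarrow> (nat \<Rightarrow> complex) measure" where
  "LV n \<equiv> LB {..<n}"

abbreviation LM :: "nat \<Rightarrow> (nat \<times> nat \<Rightarrow> complex) measure" where
  "LM n \<equiv> LB ({..<n} \<times> {..<n})"

lemma sigma_finite_LB: "finite I \<Longrightarrow> sigma_finite_measure (LB I)"
  by (rule lborelC.sigma_finite)

section \<open>Reindexing, translation and densities in finite products\<close>

lemma distr_PiM_bij:
  assumes M: "sigma_finite_measure M" and "finite I" and bij: "bij_betw \<pi> I J"
  shows "distr (PiM J (\<lambda>_. M)) (PiM I (\<lambda>_. M)) (\<lambda>x. \<lambda>i\<in>I. x (\<pi> i)) = PiM I (\<lambda>_. M)"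
proof -
  interpret product_sigma_finite "\<lambda>_. M"
    using M by (simp add: product_sigma_finite_def)
  interpret P: product_sigma_finite "\<lambda>_. M"
    using M by (simp add: product_sigma_finite_def)
  have fJ: "finite J" using bij \<open>finite I\<close> by (simp add: bij_betw_finite)
  have meas: "(\<lambda>x. \<lambda>i\<in>I. x (\<pi> i)) \<in> measurable (PiM J (\<lambda>_. M)) (PiM I (\<lambda>_. M))"
    using bij by (intro measurable_restrict measurable_component_singleton) (auto simp: bij_betw_def)
  show ?thesis
  proof (rule PiM_eqI[OF \<open>finite I\<close>])
    fix A assume A: "\<And>i. i \<in> I \<Longrightarrow> A i \<in> sets M"
    define \<rho> where "\<rho> = the_inv_into I \<pi>"
    have \<rho>: "\<And>i. i \<in> I \<Longrightarrow> \<rho> (\<pi> i) = i" "\<And>j. j \<in> J \<Longrightarrow> \<rho> j \<in> I \<and> \<pi> (\<rho> j) = j"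
      using bij unfolding \<rho>_def bij_betw_def
      by (auto simp: the_inv_into_f_f f_the_inv_into_f the_inv_into_into)
    have AJ: "\<And>j. j \<in> J \<Longrightarrow> A (\<rho> j) \<in> sets M" using A \<rho> by auto
    have "(\<lambda>x. \<lambda>i\<in>I. x (\<pi> i)) -` Pi\<^sub>E I A \<inter> space (PiM J (\<lambda>_. M)) = Pi\<^sub>E J (\<lambda>j. A (\<rho> j))"
    proof (intro equalityI subsetI)
      fix x assume x: "x \<in> (\<lambda>x. \<lambda>i\<in>I. x (\<pi> i)) -` Pi\<^sub>E I A \<inter> space (PiM J (\<lambda>_. M))"
      then have "x (\<pi> i) \<in> A i" if "i \<in> I" for i using that by (auto simp: PiE_iff)
      then have "x j \<in> A (\<rho> j)" if "j \<in> J" for j using \<rho>(2)[OF that] by metis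
      then show "x \<in> Pi\<^sub>E J (\<lambda>j. A (\<rho> j))" using x by (auto simp: space_PiM PiE_iff)
    next
      fix x assume x: "x \<in> Pi\<^sub>E J (\<lambda>j. A (\<rho> j))"
      have "x (\<pi> i) \<in> A i" if "i \<in> I" for i
        using that x \<rho>(1)[OF that] bij_betwE[OF bij] by (fastforce simp: PiE_iff)
      moreover have "x j \<in> space M" if "j \<in> J" for j
        using x AJ[OF that] that sets.sets_into_space by (fastforce simp: PiE_iff)
      ultimately show "x \<in> (\<lambda>x. \<lambda>i\<in>I. x (\<pi> i)) -` Pi\<^sub>E I A \<inter> space (PiM J (\<lambda>_. M))"
        using x by (auto simp: space_PiM PiE_iff)
    qed
    then have "emeasure (distr (PiM J (\<lambda>_. M)) (PiM I (\<lambda>_. M)) (\<lambda>x. \<lambda>i\<in>I. x (\<pi> i))) (Pi\<^sub>E I A)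
       = (\<Prod>j\<in>J. emeasure M (A (\<rho> j)))"
      using A AJ by (subst emeasure_distr[OF meas]) (auto simp: emeasure_PiM fJ \<open>finite I\<close> intro!: sets_PiM_I_finite)
    also have "\<dots> = (\<Prod>i\<in>I. emeasure M (A i))"
      using \<rho>(1) by (subst prod.reindex_bij_betw[OF bij, symmetric]) (auto intro!: prod.cong)
    finally show "emeasure (distr (PiM J (\<lambda>_. M)) (PiM I (\<lambda>_. M)) (\<lambda>x. \<lambda>i\<in>I. x (\<pi> i))) (Pi\<^sub>E I A)
       = (\<Prod>i\<in>I. emeasure M (A i))" .
  qed simp
qed

lemma nn_integral_PiM_bij:
  assumes M: "sigma_finite_measure M" and "finite I" and bij: "bij_betw \<pi> I J"
    and f: "f \<in> borel_measurable (PiM I (\<lambda>_. M))"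
  shows "(\<integral>\<^sup>+x. f x \<partial>PiM I (\<lambda>_. M)) = (\<integral>\<^sup>+x. f (\<lambda>i\<in>I. x (\<pi> i)) \<partial>PiM J (\<lambda>_. M))"
proof -
  have "(\<lambda>x. \<lambda>i\<in>I. x (\<pi> i)) \<in> measurable (PiM J (\<lambda>_. M)) (PiM I (\<lambda>_. M))"
    using bij by (intro measurable_restrict measurable_component_singleton) (auto simp: bij_betw_def)
  then show ?thesis
    using f by (subst distr_PiM_bij[OF assms(1-3), symmetric]) (simp add: nn_integral_distr)
qed

lemma distr_PiM_componentwise:
  assumes M: "sigma_finite_measure M" and "finite I"
    and \<phi>: "\<And>i. i \<in> I \<Longrightarrow> \<phi> i \<in> measurable M M" "\<And>i. i \<in> I \<Longrightarrow> distr M M (\<phi> i) = M"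
  shows "distr (PiM I (\<lambda>_. M)) (PiM I (\<lambda>_. M)) (\<lambda>x. \<lambda>i\<in>I. \<phi> i (x i)) = PiM I (\<lambda>_. M)"
proof -
  interpret product_sigma_finite "\<lambda>_. M"
    using M by (simp add: product_sigma_finite_def)
  have meas: "(\<lambda>x. \<lambda>i\<in>I. \<phi> i (x i)) \<in> measurable (PiM I (\<lambda>_. M)) (PiM I (\<lambda>_. M))"
    using \<phi>(1) by (intro measurable_restrict measurable_compose[OF measurable_component_singleton]) auto
  show ?thesis
  proof (rule PiM_eqI[OF \<open>finite I\<close>])
    fix A assume A: "\<And>i. i \<in> I \<Longrightarrow> A i \<in> sets M"
    have "(\<lambda>x. \<lambda>i\<in>I. \<phi> i (x i)) -` Pi\<^sub>E I A \<inter> space (PiM I (\<lambda>_. M)) = Pi\<^sub>E I (\<lambda>i. \<phi> i -` A i \<inter> space M)"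
      by (auto simp: space_PiM PiE_iff)
    then have "emeasure (distr (PiM I (\<lambda>_. M)) (PiM I (\<lambda>_. M)) (\<lambda>x. \<lambda>i\<in>I. \<phi> i (x i))) (Pi\<^sub>E I A)
       = (\<Prod>i\<in>I. emeasure M (\<phi> i -` A i \<inter> space M))"
      using A \<phi>(1) by (subst emeasure_distr[OF meas])
        (auto simp: emeasure_PiM \<open>finite I\<close> intro!: sets_PiM_I_finite measurable_sets)
    also have "\<dots> = (\<Prod>i\<in>I. emeasure (distr M M (\<phi> i)) (A i))"
      using A \<phi>(1) by (intro prod.cong) (auto simp: emeasure_distr)
    finally show "emeasure (distr (PiM I (\<lambda>_. M)) (PiM I (\<lambda>_. M)) (\<lambda>x. \<lambda>i\<in>I. \<phi> i (x i))) (Pi\<^sub>E I A)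
       = (\<Prod>i\<in>I. emeasure M (A i))"
      using \<phi>(2) by simp
  qed simp
qed

lemma nn_integral_LB_translate:
  assumes "finite I" and f: "f \<in> borel_measurable (LB I)"
  shows "(\<integral>\<^sup>+x. f (\<lambda>i\<in>I. t i + x i) \<partial>LB I) = (\<integral>\<^sup>+x. f x \<partial>LB I)"
proof -
  have *: "distr (LB I) (LB I) (\<lambda>x. \<lambda>i\<in>I. t i + x i) = LB I"
    using assms(1) by (intro distr_PiM_componentwise sigma_finite_lborel)
      (auto simp: lborel_distr_plus cong: distr_cong)
  have "(\<lambda>x. \<lambda>i\<in>I. t i + x i) \<in> measurable (LB I) (LB I)" by measurable
  then have "(\<integral>\<^sup>+x. f x \<partial>distr (LB I) (LB I) (\<lambda>x. \<lambda>i\<in>I. t i + x i)) = (\<integral>\<^sup>+x. f (\<lambda>i\<in>I. t i + x i) \<partial>LB I)"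
    by (rule nn_integral_distr) (use f in simp)
  then show ?thesis unfolding * ..
qed

lemma PiM_density:
  assumes M: "sigma_finite_measure M" and "finite I" and g[measurable]: "g \<in> borel_measurable M"
    and Mg: "sigma_finite_measure (density M g)"
  shows "PiM I (\<lambda>_. density M g) = density (PiM I (\<lambda>_. M)) (\<lambda>x. \<Prod>i\<in>I. g (x i))"
proof -
  interpret M: product_sigma_finite "\<lambda>_. M"
    using M by (simp add: product_sigma_finite_def)
  interpret product_sigma_finite "\<lambda>_. density M g"
    using Mg by (simp add: product_sigma_finite_def)
  have sets_eq: "sets (PiM I (\<lambda>_. density M g)) = sets (PiM I (\<lambda>_. M))"
    by (rule sets_PiM_cong) auto
  show ?thesis
  proof (rule PiM_eqI[OF \<open>finite I\<close>, symmetric])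
    fix A assume "\<And>i. i \<in> I \<Longrightarrow> A i \<in> sets (density M g)"
    then have A[measurable]: "\<And>i. i \<in> I \<Longrightarrow> A i \<in> sets M" by simp
    have [measurable]: "Pi\<^sub>E I A \<in> sets (PiM I (\<lambda>_. M))"
      using A \<open>finite I\<close> by (intro sets_PiM_I_finite) auto
    have "emeasure (density (PiM I (\<lambda>_. M)) (\<lambda>x. \<Prod>i\<in>I. g (x i))) (Pi\<^sub>E I A)
        = (\<integral>\<^sup>+x. (\<Prod>i\<in>I. g (x i)) * indicator (Pi\<^sub>E I A) x \<partial>PiM I (\<lambda>_. M))"
      by (rule emeasure_density) measurable
    also have "\<dots> = (\<integral>\<^sup>+x. (\<Prod>i\<in>I. g (x i) * indicator (A i) (x i)) \<partial>PiM I (\<lambda>_. M))"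
    proof (rule nn_integral_cong)
      fix x assume x: "x \<in> space (PiM I (\<lambda>_. M))"
      show "(\<Prod>i\<in>I. g (x i)) * indicator (Pi\<^sub>E I A) x = (\<Prod>i\<in>I. g (x i) * indicator (A i) (x i))"
      proof (cases "x \<in> Pi\<^sub>E I A")
        case False
        then obtain i where "i \<in> I" "x i \<notin> A i" using x by (auto simp: space_PiM PiE_iff)
        then show ?thesis
          using False \<open>finite I\<close> by (auto intro!: prod_zero[symmetric] bexI[of _ i])
      qed (auto simp: PiE_iff intro!: prod.cong)
    qed
    also have "\<dots> = (\<Prod>i\<in>I. \<integral>\<^sup>+x. g x * indicator (A i) x \<partial>M)"
      using \<open>finite I\<close> by (intro M.product_nn_integral_prod) auto
    also have "\<dots> = (\<Prod>i\<in>I. emeasure (density M g) (A i))"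
      using A by (intro prod.cong) (auto simp: emeasure_density)
    finally show "emeasure (density (PiM I (\<lambda>_. M)) (\<lambda>x. \<Prod>i\<in>I. g (x i))) (Pi\<^sub>E I A)
        = (\<Prod>i\<in>I. emeasure (density M g) (A i))" .
  qed (simp add: sets_eq)
qed

text \<open>An affine map covers every value exactly once, so with \<open>m = 1\<close> and
  \<open>N = {}\<close> the two inequalities of \<open>area_formula\<close> meet.\<close>

lemma nn_integral_complex_affine:
  fixes f :: "complex \<Rightarrow> ennreal"
  assumes "c \<noteq> 0" and f: "f \<in> borel_measurable borel"
  shows "ennreal ((cmod c)\<^sup>2) * (\<integral>\<^sup>+z. f (e + c * z) \<partial>lborel) = (\<integral>\<^sup>+z. f z \<partial>lborel)"
proof -
  have d: "deriv (\<lambda>z. e + c * z) z = c" for z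
    by (rule DERIV_imp_deriv) (auto intro!: derivative_eq_intros)
  have fib: "{z \<in> UNIV. e + c * z = a} = {(a - e) / c}" for a
    using assms(1) by (auto simp: field_simps)
  have sub: "- {} \<subseteq> (\<lambda>z. e + c * z) ` UNIV"
  proof
    fix a show "a \<in> (\<lambda>z. e + c * z) ` UNIV"
      using assms(1) by (intro image_eqI[of _ _ "(a - e) / c"]) auto
  qed
  have hol: "(\<lambda>z. e + c * z) holomorphic_on UNIV" by (intro holomorphic_intros)
  note af = area_formula[OF open_UNIV connected_UNIV hol f, of 1 "{}", unfolded fib]
  have "(\<integral>\<^sup>+z. indicator UNIV z * ennreal ((cmod (deriv (\<lambda>z. e + c * z) z))\<^sup>2) * f (e + c * z) \<partial>lborel)
      = (\<integral>\<^sup>+z. f z \<partial>lborel)"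
    using af sub by (intro antisym) auto
  moreover have "(\<integral>\<^sup>+z. indicator UNIV z * ennreal ((cmod (deriv (\<lambda>z. e + c * z) z))\<^sup>2) * f (e + c * z) \<partial>lborel)
      = ennreal ((cmod c)\<^sup>2) * (\<integral>\<^sup>+z. f (e + c * z) \<partial>lborel)"
    unfolding d using f by (simp add: nn_integral_cmult)
  ultimately show ?thesis by simp
qed

text \<open>The outer restriction, here and in \<open>csnoc\<close>, \<open>rsnoc\<close> and
  \<open>asm\<close>, makes the result extensional and hence a point of the product space.\<close>

definition snoc :: "nat \<Rightarrow> (nat \<Rightarrow> complex) \<Rightarrow> complex \<Rightarrow> nat \<Rightarrow> complex" where
  "snoc n x y = (\<lambda>i\<in>{..<Suc n}. if i < n then x i else y)"

definition csnoc :: "nat \<Rightarrow> nat \<Rightarrow> (nat \<times> nat \<Rightarrow> complex) \<Rightarrow> (nat \<Rightarrow> complex) \<Rightarrow> nat \<times> nat \<Rightarrow> complex" where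
  "csnoc n m X y = (\<lambda>ij\<in>{..<n} \<times> {..<Suc m}. if snd ij < m then X ij else y (fst ij))"

definition rsnoc :: "nat \<Rightarrow> nat \<Rightarrow> (nat \<times> nat \<Rightarrow> complex) \<Rightarrow> (nat \<Rightarrow> complex) \<Rightarrow> nat \<times> nat \<Rightarrow> complex" where
  "rsnoc n m X y = (\<lambda>ij\<in>{..<Suc n} \<times> {..<m}. if fst ij < n then X ij else y (snd ij))"

lemma measurable_LB_component:
  assumes "X \<in> measurable N (LB I)" "i \<in> I"
  shows "(\<lambda>p. X p i) \<in> borel_measurable N"
  using measurable_compose[OF assms(1) measurable_component_singleton[OF assms(2)]] by simp

lemma measurable_LB_restrict:
  assumes "\<And>i. i \<in> I \<Longrightarrow> (\<lambda>p. X p i) \<in> borel_measurable N"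
  shows "(\<lambda>p. \<lambda>i\<in>I. X p i) \<in> measurable N (LB I)"
  using assms by (intro measurable_restrict) simp

lemma measurable_snoc [measurable (raw)]:
  assumes "X \<in> measurable N (LV n)" "Y \<in> borel_measurable N"
  shows "(\<lambda>p. snoc n (X p) (Y p)) \<in> measurable N (LV (Suc n))"
  unfolding snoc_def
proof (rule measurable_LB_restrict)
  fix i assume "i \<in> {..<Suc n}"
  show "(\<lambda>p. if i < n then X p i else Y p) \<in> borel_measurable N"
    using assms measurable_LB_component[OF assms(1), of i] by (cases "i < n") auto
qed

lemma measurable_csnoc [measurable (raw)]:
  assumes "X \<in> measurable N (LB ({..<n} \<times> {..<m}))" "Y \<in> measurable N (LV n)"
  shows "(\<lambda>p. csnoc n m (X p) (Y p)) \<in> measurable N (LB ({..<n} \<times> {..<Suc m}))"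
  unfolding csnoc_def
proof (rule measurable_LB_restrict)
  fix i assume "i \<in> {..<n} \<times> {..<Suc m}"
  then show "(\<lambda>p. if snd i < m then X p i else Y p (fst i)) \<in> borel_measurable N"
    using measurable_LB_component[OF assms(1), of i] measurable_LB_component[OF assms(2), of "fst i"]
    by (cases "snd i < m") auto
qed

lemma measurable_rsnoc [measurable (raw)]:
  assumes "X \<in> measurable N (LB ({..<n} \<times> {..<m}))" "Y \<in> measurable N (LV m)"
  shows "(\<lambda>p. rsnoc n m (X p) (Y p)) \<in> measurable N (LB ({..<Suc n} \<times> {..<m}))"
  unfolding rsnoc_def
proof (rule measurable_LB_restrict)
  fix i assume "i \<in> {..<Suc n} \<times> {..<m}"
  then show "(\<lambda>p. if fst i < n then X p i else Y p (snd i)) \<in> borel_measurable N"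
    using measurable_LB_component[OF assms(1), of i] measurable_LB_component[OF assms(2), of "snd i"]
    by (cases "fst i < n") auto
qed

lemma measurable_mvf:
  assumes "\<And>i j. i < n \<Longrightarrow> j < n \<Longrightarrow> (\<lambda>p. T p (i, j)) \<in> borel_measurable N"
    and "\<And>j. j < n \<Longrightarrow> (\<lambda>p. X p j) \<in> borel_measurable N"
  shows "(\<lambda>p. mvf n (T p) (X p)) \<in> measurable N (LV n)"
  unfolding mvf_def using assms by (intro measurable_LB_restrict borel_measurable_sum borel_measurable_times) auto

lemma measurable_detf:
  assumes "\<And>i j. i < n \<Longrightarrow> j < n \<Longrightarrow> (\<lambda>p. T p (i, j)) \<in> borel_measurable N"
  shows "(\<lambda>p. detf n (T p)) \<in> borel_measurable N"
  unfolding detf_expand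
  by (intro borel_measurable_sum borel_measurable_times borel_measurable_prod assms)
     (auto simp: permutes_in_image)

lemma measurable_invf:
  assumes T: "\<And>i j. i < n \<Longrightarrow> j < n \<Longrightarrow> (\<lambda>p. T p (i, j)) \<in> borel_measurable N" and ij: "i < n" "j < n"
  shows "(\<lambda>p. invf n (T p) (i, j)) \<in> borel_measurable N"
proof -
  have "adj_mat (mat n n (T p)) $$ (i, j) = (-1) ^ (j + i) *
      detf (n - 1) (\<lambda>(k, l). T p (if k < j then k else Suc k, if l < i then l else Suc l))" for p
  proof -
    have "mat_delete (mat n n (T p)) j i = mat (n - 1) (n - 1) (\<lambda>(k, l). T p (if k < j then k else Suc k, if l < i then l else Suc l))"
      unfolding mat_delete_def using ij by (intro eq_matI) auto
    then show ?thesis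
      using ij by (simp add: adj_mat_def cofactor_def detf_def)
  qed
  moreover have "(\<lambda>p. detf (n - 1) (\<lambda>(k, l). T p (if k < j then k else Suc k, if l < i then l else Suc l))) \<in> borel_measurable N"
    using ij by (intro measurable_detf) (auto intro!: T)
  moreover have "(\<lambda>p. detf n (T p)) \<in> borel_measurable N"
    by (rule measurable_detf) (rule T)
  ultimately show ?thesis
    unfolding invf_def by simp
qed

lemma nn_integral_LV_Suc:
  assumes f: "f \<in> borel_measurable (LV (Suc n))"
  shows "(\<integral>\<^sup>+x. f x \<partial>LV (Suc n)) = (\<integral>\<^sup>+x. \<integral>\<^sup>+y. f (snoc n x y) \<partial>lborel \<partial>LV n)"
proof -
  have f': "f \<in> borel_measurable (LB (insert n {..<n}))" using f by (simp add: lessThan_Suc)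
  have "(\<integral>\<^sup>+x. f x \<partial>LV (Suc n)) = (\<integral>\<^sup>+x. \<integral>\<^sup>+y. f (x(n := y)) \<partial>lborel \<partial>LV n)"
    unfolding lessThan_Suc by (rule lborelC.product_nn_integral_insert[OF _ _ f']) auto
  also have "\<dots> = (\<integral>\<^sup>+x. \<integral>\<^sup>+y. f (snoc n x y) \<partial>lborel \<partial>LV n)"
  proof (intro nn_integral_cong arg_cong[where f=f])
    fix x y assume "x \<in> space (LV n)"
    then show "x(n := y) = snoc n x y"
      by (auto simp: snoc_def space_PiM PiE_iff extensional_def fun_eq_iff)
  qed
  finally show ?thesis .
qed

lemma nn_integral_swap:
  assumes "sigma_finite_measure M" "sigma_finite_measure N" "case_prod f \<in> borel_measurable (M \<Otimes>\<^sub>M N)"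
  shows "(\<integral>\<^sup>+x. \<integral>\<^sup>+y. f x y \<partial>N \<partial>M) = (\<integral>\<^sup>+y. \<integral>\<^sup>+x. f x y \<partial>M \<partial>N)"
proof -
  interpret pair_sigma_finite M N using assms by (simp add: pair_sigma_finite_def)
  show ?thesis using Fubini'[OF assms(3)] by simp
qed

lemma nn_integral_LV_Suc':
  assumes [measurable]: "f \<in> borel_measurable (LV (Suc n))"
  shows "(\<integral>\<^sup>+x. f x \<partial>LV (Suc n)) = (\<integral>\<^sup>+y. \<integral>\<^sup>+x. f (snoc n x y) \<partial>LV n \<partial>lborel)"
  unfolding nn_integral_LV_Suc[OF assms]
  by (rule nn_integral_swap) (auto intro: sigma_finite_LB sigma_finite_lborel)

lemma nn_integral_csnoc:
  assumes f: "f \<in> borel_measurable (LB ({..<n} \<times> {..<Suc m}))"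
  shows "(\<integral>\<^sup>+x. f x \<partial>LB ({..<n} \<times> {..<Suc m})) = (\<integral>\<^sup>+X. \<integral>\<^sup>+y. f (csnoc n m X y) \<partial>LV n \<partial>LB ({..<n} \<times> {..<m}))"
proof -
  have eq: "{..<n} \<times> {..<m} \<union> {..<n} \<times> {m} = {..<n} \<times> {..<Suc m}" by auto
  have bij: "bij_betw fst ({..<n} \<times> {m}) {..<n}"
    by (rule bij_betwI[of _ _ _ "\<lambda>i. (i, m)"]) auto
  have "(\<integral>\<^sup>+x. f x \<partial>LB ({..<n} \<times> {..<Suc m})) = (\<integral>\<^sup>+X. \<integral>\<^sup>+y. f (merge ({..<n} \<times> {..<m}) ({..<n} \<times> {m}) (X, y)) \<partial>LB ({..<n} \<times> {m}) \<partial>LB ({..<n} \<times> {..<m}))"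
    unfolding eq[symmetric] by (rule lborelC.product_nn_integral_fold) (use f eq in auto)
  also have "\<dots> = (\<integral>\<^sup>+X. \<integral>\<^sup>+y. f (csnoc n m X y) \<partial>LV n \<partial>LB ({..<n} \<times> {..<m}))"
  proof (rule nn_integral_cong)
    fix X assume X: "X \<in> space (LB ({..<n} \<times> {..<m}))"
    have "(\<lambda>y. merge ({..<n} \<times> {..<m}) ({..<n} \<times> {m}) (X, y)) \<in> measurable (LB ({..<n} \<times> {m})) (LB ({..<n} \<times> {..<Suc m}))"
      unfolding eq[symmetric] by (rule measurable_compose[OF measurable_Pair1'[OF X] measurable_merge])
    then have "(\<integral>\<^sup>+y. f (merge ({..<n} \<times> {..<m}) ({..<n} \<times> {m}) (X, y)) \<partial>LB ({..<n} \<times> {m}))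
      = (\<integral>\<^sup>+y. f (merge ({..<n} \<times> {..<m}) ({..<n} \<times> {m}) (X, \<lambda>ij\<in>{..<n} \<times> {m}. y (fst ij))) \<partial>LV n)"
      by (intro nn_integral_PiM_bij[OF sigma_finite_lborel _ bij]) (auto intro: measurable_compose[OF _ f])
    also have "\<dots> = (\<integral>\<^sup>+y. f (csnoc n m X y) \<partial>LV n)"
      by (intro nn_integral_cong arg_cong[where f=f]) (auto simp: merge_def csnoc_def fun_eq_iff)
    finally show "(\<integral>\<^sup>+y. f (merge ({..<n} \<times> {..<m}) ({..<n} \<times> {m}) (X, y)) \<partial>LB ({..<n} \<times> {m}))
      = (\<integral>\<^sup>+y. f (csnoc n m X y) \<partial>LV n)" .
  qed
  finally show ?thesis .
qed

lemma nn_integral_rsnoc: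
  assumes f: "f \<in> borel_measurable (LB ({..<Suc n} \<times> {..<m}))"
  shows "(\<integral>\<^sup>+x. f x \<partial>LB ({..<Suc n} \<times> {..<m})) = (\<integral>\<^sup>+X. \<integral>\<^sup>+y. f (rsnoc n m X y) \<partial>LV m \<partial>LB ({..<n} \<times> {..<m}))"
proof -
  have eq: "{..<n} \<times> {..<m} \<union> {n} \<times> {..<m} = {..<Suc n} \<times> {..<m}" by auto
  have bij: "bij_betw snd ({n} \<times> {..<m}) {..<m}"
    by (rule bij_betwI[of _ _ _ "\<lambda>i. (n, i)"]) auto
  have "(\<integral>\<^sup>+x. f x \<partial>LB ({..<Suc n} \<times> {..<m})) = (\<integral>\<^sup>+X. \<integral>\<^sup>+y. f (merge ({..<n} \<times> {..<m}) ({n} \<times> {..<m}) (X, y)) \<partial>LB ({n} \<times> {..<m}) \<partial>LB ({..<n} \<times> {..<m}))"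
    unfolding eq[symmetric] by (rule lborelC.product_nn_integral_fold) (use f eq in auto)
  also have "\<dots> = (\<integral>\<^sup>+X. \<integral>\<^sup>+y. f (rsnoc n m X y) \<partial>LV m \<partial>LB ({..<n} \<times> {..<m}))"
  proof (rule nn_integral_cong)
    fix X assume X: "X \<in> space (LB ({..<n} \<times> {..<m}))"
    have "(\<lambda>y. merge ({..<n} \<times> {..<m}) ({n} \<times> {..<m}) (X, y)) \<in> measurable (LB ({n} \<times> {..<m})) (LB ({..<Suc n} \<times> {..<m}))"
      unfolding eq[symmetric] by (rule measurable_compose[OF measurable_Pair1'[OF X] measurable_merge])
    then have "(\<integral>\<^sup>+y. f (merge ({..<n} \<times> {..<m}) ({n} \<times> {..<m}) (X, y)) \<partial>LB ({n} \<times> {..<m}))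
      = (\<integral>\<^sup>+y. f (merge ({..<n} \<times> {..<m}) ({n} \<times> {..<m}) (X, \<lambda>ij\<in>{n} \<times> {..<m}. y (snd ij))) \<partial>LV m)"
      by (intro nn_integral_PiM_bij[OF sigma_finite_lborel _ bij]) (auto intro: measurable_compose[OF _ f])
    also have "\<dots> = (\<integral>\<^sup>+y. f (rsnoc n m X y) \<partial>LV m)"
      by (intro nn_integral_cong arg_cong[where f=f]) (auto simp: merge_def rsnoc_def fun_eq_iff)
    finally show "(\<integral>\<^sup>+y. f (merge ({..<n} \<times> {..<m}) ({n} \<times> {..<m}) (X, y)) \<partial>LB ({n} \<times> {..<m}))
      = (\<integral>\<^sup>+y. f (rsnoc n m X y) \<partial>LV m)" .
  qed
  finally show ?thesis .
qed

lemma asm_eq: "asm n D b c a = csnoc (Suc n) n (rsnoc n n D b) (snoc n c a)"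
  by (auto simp: asm_def csnoc_def rsnoc_def snoc_def fun_eq_iff restrict_def)

lemma measurable_asm [measurable (raw)]:
  assumes [measurable]: "D \<in> measurable N (LM n)" "b \<in> measurable N (LV n)" "c \<in> measurable N (LV n)" "a \<in> borel_measurable N"
  shows "(\<lambda>p. asm n (D p) (b p) (c p) (a p)) \<in> measurable N (LM (Suc n))"
  unfolding asm_eq by measurable

text \<open>The order of integration matters: the last column \<open>(c, a)\<close> is innermost,
  because it is the column that is re-parametrised by an eigenvalue and an eigenvector while
  \<open>D\<close> and \<open>b\<close> stay fixed.\<close>

lemma nn_integral_asm:
  assumes [measurable]: "f \<in> borel_measurable (LM (Suc n))"
  shows "(\<integral>\<^sup>+x. f x \<partial>LM (Suc n)) =
    (\<integral>\<^sup>+D. \<integral>\<^sup>+b. \<integral>\<^sup>+c. \<integral>\<^sup>+a. f (asm n D b c a) \<partial>lborel \<partial>LV n \<partial>LV n \<partial>LM n)"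
proof -
  interpret sigma_finite_measure "LV (Suc n)" by (rule sigma_finite_LB) simp
  have "(\<lambda>p. f (csnoc (Suc n) n (fst p) (snd p))) \<in> borel_measurable (LB ({..<Suc n} \<times> {..<n}) \<Otimes>\<^sub>M LV (Suc n))"
    by measurable
  then have *[measurable]: "(\<lambda>X. \<integral>\<^sup>+y. f (csnoc (Suc n) n X y) \<partial>LV (Suc n)) \<in> borel_measurable (LB ({..<Suc n} \<times> {..<n}))"
    by (intro borel_measurable_nn_integral) (simp add: case_prod_beta')
  show ?thesis
    by (subst nn_integral_csnoc, simp, subst nn_integral_rsnoc, rule *)
       (simp add: asm_eq nn_integral_LV_Suc cong: nn_integral_cong)
qed

text \<open>Gaussian elimination without pivoting, one coordinate at a time, hence the condition on
  all leading minors. It is met by \<open>lam l D\<close> for almost every \<open>l\<close> and by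
  the matrices \<open>rank1\<close> used below.\<close>

lemma nn_integral_LV_linear:
  assumes "\<And>k. k \<le> n \<Longrightarrow> detf k T \<noteq> 0" "f \<in> borel_measurable (LV n)"
  shows "ennreal ((cmod (detf n T))\<^sup>2) * (\<integral>\<^sup>+x. f (mvf n T x) \<partial>LV n) = (\<integral>\<^sup>+x. f x \<partial>LV n)"
  using assms
proof (induction n arbitrary: f)
  case 0
  have "(\<integral>\<^sup>+x. f (mvf 0 T x) \<partial>LV 0) = (\<integral>\<^sup>+x. f x \<partial>LV 0)"
    by (intro nn_integral_cong arg_cong[where f=f]) (auto simp: mvf_def space_PiM)
  then show ?case by (simp add: detf_def)
next
  case (Suc n)
  note [measurable] = Suc.prems(2)
  have dn: "detf n T \<noteq> 0" using Suc.prems(1) by simp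
  define x0 where "x0 = mvf n (invf n T) (\<lambda>i. T (i, n))"
  define \<sigma> where "\<sigma> = T (n, n) - (\<Sum>j<n. T (n, j) * x0 j)"
  have det_Suc: "detf (Suc n) T = detf n T * \<sigma>"
    unfolding \<sigma>_def using dn by (intro detf_schur) (simp add: x0_def mvf_invf_right flip: mvf_apply)
  then have "\<sigma> \<noteq> 0" using Suc.prems(1)[of "Suc n"] by auto
  \<comment> \<open>\<open>F u y\<close> is the integrand in terms of \<open>u = T x\<close> for the
    first \<open>n\<close> coordinates. The shift of \<open>u\<close> by \<open>y\<close> times the
    last column turns it into \<open>H\<close>, where the last coordinate is
    \<open>e w + \<sigma> * y\<close>: a one-variable affine map with the Schur complement as its
    slope.\<close>
  define F where "F u y = f (snoc n (\<lambda>i\<in>{..<n}. T (i, n) * y + u i) ((\<Sum>j<n. T (n, j) * mvf n (invf n T) u j) + T (n, n) * y))" for u y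
  define e where "e w = (\<Sum>j<n. T (n, j) * mvf n (invf n T) w j)" for w
  define H where "H w y = f (snoc n w (e w + \<sigma> * y))" for w y
  have mv[measurable]: "(\<lambda>p. mvf n (invf n T) (u p)) \<in> measurable N (LV n)" if "u \<in> measurable N (LV n)" for u N
    using that by (intro measurable_mvf) (auto intro: measurable_LB_component)
  have mv'[measurable]: "(\<lambda>p. mvf n T (u p)) \<in> measurable N (LV n)" if "u \<in> measurable N (LV n)" for u N
    using that by (intro measurable_mvf) (auto intro: measurable_LB_component)
  have [measurable]: "(\<lambda>p. e (u p)) \<in> borel_measurable N" if [measurable]: "u \<in> measurable N (LV n)" for u N
    unfolding e_def using measurable_LB_component[OF mv[OF that]] by auto
  have Fm[measurable]: "(\<lambda>p. F (u p) (y p)) \<in> borel_measurable N" if [measurable]: "u \<in> measurable N (LV n)" "y \<in> borel_measurable N" for u y and N :: "'z measure"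
  proof -
    have [measurable]: "(\<lambda>p. \<lambda>i\<in>{..<n}. T (i, n) * y p + u p i) \<in> measurable N (LV n)"
      using measurable_LB_component[OF that(1)] by (intro measurable_LB_restrict) auto
    show ?thesis
      unfolding F_def e_def[symmetric] by measurable
  qed
  have Hm[measurable]: "(\<lambda>p. H (u p) (y p)) \<in> borel_measurable N" if [measurable]: "u \<in> measurable N (LV n)" "y \<in> borel_measurable N" for u y and N :: "'z measure"
    unfolding H_def by measurable
  have "mvf (Suc n) T (snoc n x y) = snoc n (\<lambda>i\<in>{..<n}. T (i, n) * y + mvf n T x i) ((\<Sum>j<n. T (n, j) * mvf n (invf n T) (mvf n T x) j) + T (n, n) * y)" for x y
  proof -
    have "(\<Sum>j<n. T (n, j) * mvf n (invf n T) (mvf n T x) j) = (\<Sum>j<n. T (n, j) * x j)"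
      using dn by (simp add: mvf_invf_left)
    then show ?thesis
      by (simp only:) (auto simp: mvf_def snoc_def fun_eq_iff dest: less_antisym)
  qed
  then have "(\<integral>\<^sup>+x. f (mvf (Suc n) T x) \<partial>LV (Suc n)) = (\<integral>\<^sup>+y. \<integral>\<^sup>+x. F (mvf n T x) y \<partial>LV n \<partial>lborel)"
    by (subst nn_integral_LV_Suc') (auto simp: F_def intro!: measurable_compose[OF measurable_mvf Suc.prems(2)] intro: measurable_LB_component)
  then have "ennreal ((cmod (detf n T))\<^sup>2) * (\<integral>\<^sup>+x. f (mvf (Suc n) T x) \<partial>LV (Suc n))
      = (\<integral>\<^sup>+y. ennreal ((cmod (detf n T))\<^sup>2) * (\<integral>\<^sup>+x. F (mvf n T x) y \<partial>LV n) \<partial>lborel)"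
    by (simp, intro nn_integral_cmult[symmetric] sigma_finite_measure.borel_measurable_nn_integral sigma_finite_LB)
       (auto simp: case_prod_beta')
  also have "\<dots> = (\<integral>\<^sup>+y. \<integral>\<^sup>+u. F u y \<partial>LV n \<partial>lborel)"
    by (intro nn_integral_cong Suc.IH) (use Suc.prems(1) in auto)
  also have "\<dots> = (\<integral>\<^sup>+y. \<integral>\<^sup>+w. H w y \<partial>LV n \<partial>lborel)"
  proof (rule nn_integral_cong)
    fix y
    have "F u y = H (\<lambda>i\<in>{..<n}. T (i, n) * y + u i) y" for u
    proof -
      have "mvf n (invf n T) (\<lambda>i\<in>{..<n}. T (i, n) * y + u i) j = x0 j * y + mvf n (invf n T) u j" if "j < n" for j
        using that by (simp add: x0_def mvf_apply sum.distrib sum_distrib_right distrib_left mult.assoc)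
      then have "e (\<lambda>i\<in>{..<n}. T (i, n) * y + u i) = (\<Sum>j<n. T (n, j) * x0 j) * y + e u"
        by (simp add: e_def sum.distrib sum_distrib_right distrib_left mult.assoc)
      then show ?thesis
        by (simp add: F_def H_def \<sigma>_def e_def algebra_simps)
    qed
    then show "(\<integral>\<^sup>+u. F u y \<partial>LV n) = (\<integral>\<^sup>+w. H w y \<partial>LV n)"
      using nn_integral_LB_translate[of "{..<n}" "\<lambda>w. H w y" "\<lambda>i. T (i, n) * y"] by simp
  qed
  also have "\<dots> = (\<integral>\<^sup>+w. \<integral>\<^sup>+y. H w y \<partial>lborel \<partial>LV n)"
    by (rule nn_integral_swap) (auto simp: case_prod_beta' intro: sigma_finite_LB sigma_finite_lborel)
  finally have "ennreal ((cmod (detf (Suc n) T))\<^sup>2) * (\<integral>\<^sup>+x. f (mvf (Suc n) T x) \<partial>LV (Suc n))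
      = ennreal ((cmod \<sigma>)\<^sup>2) * (\<integral>\<^sup>+w. \<integral>\<^sup>+y. H w y \<partial>lborel \<partial>LV n)"
    by (simp add: det_Suc norm_mult power_mult_distrib ennreal_mult mult_ac)
  also have "\<dots> = (\<integral>\<^sup>+w. ennreal ((cmod \<sigma>)\<^sup>2) * (\<integral>\<^sup>+y. H w y \<partial>lborel) \<partial>LV n)"
    by (intro nn_integral_cmult[symmetric] sigma_finite_measure.borel_measurable_nn_integral sigma_finite_lborel)
       (auto simp: case_prod_beta')
  also have "\<dots> = (\<integral>\<^sup>+w. \<integral>\<^sup>+y. f (snoc n w y) \<partial>lborel \<partial>LV n)"
  proof (rule nn_integral_cong)
    fix w assume w[measurable]: "w \<in> space (LV n)"
    have [measurable]: "(\<lambda>y. f (snoc n w y)) \<in> borel_measurable borel"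
      by measurable
    show "ennreal ((cmod \<sigma>)\<^sup>2) * (\<integral>\<^sup>+y. H w y \<partial>lborel) = (\<integral>\<^sup>+y. f (snoc n w y) \<partial>lborel)"
      unfolding H_def by (rule nn_integral_complex_affine[OF \<open>\<sigma> \<noteq> 0\<close>]) measurable
  qed
  also have "\<dots> = (\<integral>\<^sup>+x. f x \<partial>LV (Suc n))"
    by (rule nn_integral_LV_Suc[symmetric]) measurable
  finally show ?case .
qed

section \<open>Left and right multiplication as maps of matrices\<close>

definition colop :: "nat \<Rightarrow> nat \<Rightarrow> (nat \<times> nat \<Rightarrow> complex) \<Rightarrow> (nat \<times> nat \<Rightarrow> complex) \<Rightarrow> nat \<times> nat \<Rightarrow> complex" where
  "colop n m T X = (\<lambda>(i, j)\<in>{..<n} \<times> {..<m}. \<Sum>k<n. T (i, k) * X (k, j))"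

definition rowop :: "nat \<Rightarrow> (nat \<times> nat \<Rightarrow> complex) \<Rightarrow> (nat \<times> nat \<Rightarrow> complex) \<Rightarrow> nat \<times> nat \<Rightarrow> complex" where
  "rowop n B X = (\<lambda>(i, j)\<in>{..<n} \<times> {..<n}. \<Sum>k<n. X (i, k) * B (k, j))"

lemma measurable_colop [measurable (raw)]:
  assumes "X \<in> measurable N (LB ({..<n} \<times> {..<m}))"
  shows "(\<lambda>p. colop n m T (X p)) \<in> measurable N (LB ({..<n} \<times> {..<m}))"
  unfolding colop_def using measurable_LB_component[OF assms]
  by (intro measurable_LB_restrict) (auto intro!: borel_measurable_sum)

lemma measurable_rowop [measurable (raw)]:
  assumes "X \<in> measurable N (LM n)"
  shows "(\<lambda>p. rowop n T (X p)) \<in> measurable N (LM n)"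
  unfolding rowop_def using measurable_LB_component[OF assms]
  by (intro measurable_LB_restrict) (auto intro!: borel_measurable_sum)

text \<open>Left multiplication acts on each of the \<open>m\<close> columns separately, so the
  Jacobian of a single vector is raised to the power \<open>m\<close>. Right multiplication is
  reduced to this by transposition.\<close>

lemma nn_integral_colop:
  assumes "\<And>k. k \<le> n \<Longrightarrow> detf k T \<noteq> 0" "f \<in> borel_measurable (LB ({..<n} \<times> {..<m}))"
  shows "ennreal ((cmod (detf n T))\<^sup>2) ^ m * (\<integral>\<^sup>+X. f (colop n m T X) \<partial>LB ({..<n} \<times> {..<m})) = (\<integral>\<^sup>+X. f X \<partial>LB ({..<n} \<times> {..<m}))"
  using assms(2)
proof (induction m arbitrary: f)
  case 0
  have "(\<integral>\<^sup>+X. f (colop n 0 T X) \<partial>LB ({..<n} \<times> {..<0})) = (\<integral>\<^sup>+X. f X \<partial>LB ({..<n} \<times> {..<0}))"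
    by (intro nn_integral_cong arg_cong[where f=f]) (auto simp: colop_def space_PiM)
  then show ?case by simp
next
  case (Suc m)
  note [measurable] = Suc.prems
  interpret sigma_finite_measure "LV n" by (rule sigma_finite_LB) simp
  let ?d = "ennreal ((cmod (detf n T))\<^sup>2)"
  define G where "G X = (\<integral>\<^sup>+y. f (csnoc n m X y) \<partial>LV n)" for X
  have [measurable]: "G \<in> borel_measurable (LB ({..<n} \<times> {..<m}))"
    unfolding G_def by (intro borel_measurable_nn_integral) (simp add: case_prod_beta')
  have col: "colop n (Suc m) T (csnoc n m X y) = csnoc n m (colop n m T X) (mvf n T y)" for X y
    by (auto simp: colop_def csnoc_def mvf_def fun_eq_iff intro!: sum.cong)
  have [measurable]: "(\<lambda>p. mvf n T (u p)) \<in> measurable N (LV n)" if "u \<in> measurable N (LV n)" for u N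
    using that by (intro measurable_mvf) (auto intro: measurable_LB_component)
  have "?d ^ Suc m * (\<integral>\<^sup>+X. f (colop n (Suc m) T X) \<partial>LB ({..<n} \<times> {..<Suc m}))
      = ?d ^ m * (?d * (\<integral>\<^sup>+X. \<integral>\<^sup>+y. f (csnoc n m (colop n m T X) (mvf n T y)) \<partial>LV n \<partial>LB ({..<n} \<times> {..<m})))"
    by (subst nn_integral_csnoc) (auto simp: col mult_ac)
  also have "\<dots> = ?d ^ m * (\<integral>\<^sup>+X. ?d * (\<integral>\<^sup>+y. f (csnoc n m (colop n m T X) (mvf n T y)) \<partial>LV n) \<partial>LB ({..<n} \<times> {..<m}))"
    by (subst nn_integral_cmult) (auto intro!: borel_measurable_nn_integral simp: case_prod_beta')
  also have "\<dots> = ?d ^ m * (\<integral>\<^sup>+X. G (colop n m T X) \<partial>LB ({..<n} \<times> {..<m}))"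
  proof -
    have "?d * (\<integral>\<^sup>+y. f (csnoc n m (colop n m T X) (mvf n T y)) \<partial>LV n) = G (colop n m T X)"
      if [measurable]: "X \<in> space (LB ({..<n} \<times> {..<m}))" for X
      unfolding G_def by (rule nn_integral_LV_linear[OF assms(1)]) (auto intro!: measurable_compose[OF _ Suc.prems])
    then show ?thesis by (simp cong: nn_integral_cong)
  qed
  also have "\<dots> = (\<integral>\<^sup>+X. G X \<partial>LB ({..<n} \<times> {..<m}))"
    by (rule Suc.IH) measurable
  also have "\<dots> = (\<integral>\<^sup>+X. f X \<partial>LB ({..<n} \<times> {..<Suc m}))"
    unfolding G_def by (rule nn_integral_csnoc[symmetric]) measurable
  finally show ?case .
qed

lemma detf_transpose: "detf n (\<lambda>(i, j). T (j, i)) = detf n T"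
proof -
  have "mat n n (\<lambda>(i, j). T (j, i)) = transpose_mat (mat n n T)"
    by (rule eq_matI) auto
  then show ?thesis unfolding detf_def by (simp add: det_transpose[of _ n])
qed

lemma nn_integral_rowop:
  assumes B: "\<And>k. k \<le> n \<Longrightarrow> detf k B \<noteq> 0" and f[measurable]: "f \<in> borel_measurable (LM n)"
  shows "ennreal ((cmod (detf n B))\<^sup>2) ^ n * (\<integral>\<^sup>+X. f (rowop n B X) \<partial>LM n) = (\<integral>\<^sup>+X. f X \<partial>LM n)"
proof -
  define tr :: "(nat \<times> nat \<Rightarrow> complex) \<Rightarrow> nat \<times> nat \<Rightarrow> complex" where "tr X = (\<lambda>ij\<in>{..<n} \<times> {..<n}. X (prod.swap ij))" for X
  define B' where "B' = (\<lambda>(i, j). B (j, i))"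
  have [measurable]: "tr \<in> measurable (LM n) (LM n)"
    unfolding tr_def by (intro measurable_LB_restrict measurable_LB_component[OF measurable_ident]) auto
  have bij: "bij_betw prod.swap ({..<n} \<times> {..<n}) ({..<n} \<times> {..<n})"
    by (rule bij_betwI[of _ _ _ prod.swap]) auto
  have tr: "(\<integral>\<^sup>+X. g X \<partial>LM n) = (\<integral>\<^sup>+X. g (tr X) \<partial>LM n)" if "g \<in> borel_measurable (LM n)" for g
    unfolding tr_def by (rule nn_integral_PiM_bij[OF sigma_finite_lborel _ bij that]) simp
  have row: "rowop n B X = tr (colop n n B' (tr X))" for X
    by (auto simp: rowop_def tr_def colop_def B'_def fun_eq_iff mult.commute intro!: sum.cong)
  have det: "detf k B' = detf k B" for k
    unfolding B'_def by (rule detf_transpose)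
  have "(\<integral>\<^sup>+X. f (rowop n B X) \<partial>LM n) = (\<integral>\<^sup>+X. f (tr (colop n n B' X)) \<partial>LM n)"
    unfolding row by (rule tr[symmetric]) measurable
  then have "ennreal ((cmod (detf n B))\<^sup>2) ^ n * (\<integral>\<^sup>+X. f (rowop n B X) \<partial>LM n) =
      ennreal ((cmod (detf n B'))\<^sup>2) ^ n * (\<integral>\<^sup>+X. f (tr (colop n n B' X)) \<partial>LM n)"
    by (simp add: det)
  also have "\<dots> = (\<integral>\<^sup>+X. f (tr X) \<partial>LM n)"
    by (rule nn_integral_colop) (use B det in auto)
  also have "\<dots> = (\<integral>\<^sup>+X. f X \<partial>LM n)"
    by (rule tr[symmetric]) measurable
  finally show ?thesis .
qed

section \<open>The Frobenius norm and deflation\<close>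

definition frob :: "nat \<Rightarrow> (nat \<times> nat \<Rightarrow> complex) \<Rightarrow> real" where
  "frob n M = (\<Sum>i<n. \<Sum>j<n. (cmod (M (i, j)))\<^sup>2)"

definition nsq :: "nat \<Rightarrow> (nat \<Rightarrow> complex) \<Rightarrow> real" where
  "nsq n v = (\<Sum>i<n. (cmod (v i))\<^sup>2)"

text \<open>With \<open>s = 1 + |v|\<^sup>2\<close>, the matrices \<open>I - \<alpha> v v\<^sup>*\<close> and \<open>I + \<beta> v v\<^sup>*\<close> are the inverse and the
  square root of \<open>I + v v\<^sup>*\<close>: up to the last column they give an orthonormal basis of the complement of \<open>(v, 1)\<close>.\<close>
definition alp :: "nat \<Rightarrow> (nat \<Rightarrow> complex) \<Rightarrow> real" where
  "alp n v = 1 / (sqrt (1 + nsq n v) * (1 + sqrt (1 + nsq n v)))"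

definition bet :: "nat \<Rightarrow> (nat \<Rightarrow> complex) \<Rightarrow> real" where
  "bet n v = 1 / (1 + sqrt (1 + nsq n v))"

definition rank1 :: "real \<Rightarrow> (nat \<Rightarrow> complex) \<Rightarrow> nat \<times> nat \<Rightarrow> complex" where
  "rank1 t v = (\<lambda>(i, j). (if i = j then 1 else 0) + of_real t * v i * cnj (v j))"

lemma nsq_nonneg [simp]: "0 \<le> nsq n v"
  by (simp add: nsq_def sum_nonneg)

lemma nsq_complex: "of_real (nsq n v) = (\<Sum>i<n. v i * cnj (v i))"
  unfolding nsq_def of_real_sum by (simp only: complex_norm_square)

context
  fixes n :: nat and v :: "nat \<Rightarrow> complex" and s :: real
  assumes s_def: "s = 1 + nsq n v"
begin

lemma s_pos: "s > 0" "sqrt s > 0" "sqrt s * sqrt s = s"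
proof -
  show "s > 0" unfolding s_def using nsq_nonneg[of n v] by linarith
  then show "sqrt s > 0" "sqrt s * sqrt s = s" by auto
qed

lemma alp_eq: "alp n v * (sqrt s * (1 + sqrt s)) = 1" and bet_eq: "bet n v * (1 + sqrt s) = 1"
proof -
  have p: "1 + sqrt s > 0" using s_pos(2) by linarith
  then have "sqrt s * (1 + sqrt s) > 0" using s_pos(2) by (intro mult_pos_pos)
  with p show "alp n v * (sqrt s * (1 + sqrt s)) = 1" "bet n v * (1 + sqrt s) = 1"
    unfolding alp_def bet_def s_def[symmetric] by (metis less_irrefl nonzero_eq_divide_eq)+
qed

lemma alp_bet: "bet n v = alp n v * sqrt s" "alp n v + bet n v = 1 / sqrt s"
  "alp n v * (s - 1) + 1 / sqrt s = 1" "bet n v * (s - 1) + 1 = sqrt s"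
proof -
  show 1: "bet n v = alp n v * sqrt s"
    using s_pos(2) by (simp add: alp_def bet_def s_def[symmetric])
  have "alp n v * (1 + sqrt s) * sqrt s = 1"
    using alp_eq by (simp only: mult_ac)
  then have "1 / sqrt s = alp n v * (1 + sqrt s)"
    using s_pos(2) by (simp add: divide_eq_eq)
  then show 2: "alp n v + bet n v = 1 / sqrt s" by (simp add: 1 algebra_simps)
  have s1: "s - 1 = (sqrt s - 1) * (1 + sqrt s)" using s_pos(3) by (simp add: algebra_simps)
  have b: "bet n v * (s - 1) = sqrt s - 1"
    unfolding s1 using bet_eq by (simp add: mult.left_commute)
  then show "bet n v * (s - 1) + 1 = sqrt s" by simp
  have "sqrt s * (alp n v * (s - 1)) = sqrt s - 1" using b by (simp add: 1 mult_ac)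
  then show "alp n v * (s - 1) + 1 / sqrt s = 1" using s_pos(2) by (simp add: field_simps)
qed

text \<open>The row \<open>(r, t)\<close> is multiplied by a unitary matrix. One column of that
  matrix is \<open>(v, 1) / sqrt s\<close>, which gives the first term; another consists of column
  \<open>j\<close> of \<open>rank1 (- alp n v) v\<close> followed by
  \<open>- cnj (v j) / sqrt s\<close>, which gives \<open>r j - q * cnj (v j)\<close>.\<close>

lemma row_isometry:
  fixes r :: "nat \<Rightarrow> complex" and t :: complex
  defines "p \<equiv> \<Sum>j<n. r j * v j"
  defines "q \<equiv> of_real (alp n v) * p + t / of_real (sqrt s)"
  shows "nsq n r + (cmod t)\<^sup>2 = (cmod (p + t))\<^sup>2 / s + (\<Sum>j<n. (cmod (r j - q * cnj (v j)))\<^sup>2)"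
proof -
  let ?a = "alp n v" and ?u = "1 / sqrt s"
  have "of_real (\<Sum>j<n. (cmod (r j - q * cnj (v j)))\<^sup>2)
      = (\<Sum>j<n. r j * cnj (r j) - q * cnj (r j * v j) - cnj q * (r j * v j) + q * cnj q * (v j * cnj (v j)))"
    unfolding of_real_sum complex_norm_square by (intro sum.cong) (auto simp: algebra_simps)
  also have "\<dots> = of_real (nsq n r) - q * cnj p - cnj q * p + q * cnj q * of_real (nsq n v)"
    unfolding nsq_complex p_def by (simp add: sum.distrib sum_subtractf sum_distrib_left)
  finally have 1: "of_real (\<Sum>j<n. (cmod (r j - q * cnj (v j)))\<^sup>2)
      = of_real (nsq n r) - q * cnj p - cnj q * p + q * cnj q * of_real (nsq n v)" .
  have nv: "nsq n v = s - 1" by (simp add: s_def)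
  have uu: "1 / s = ?u * ?u" using s_pos by (simp add: field_simps)
  have q: "q = of_real ?a * p + of_real ?u * t" by (simp add: q_def divide_simps)
  \<comment> \<open>\<open>A\<close>, \<open>B\<close> and \<open>C\<close> evaluate the
    coefficients of \<open>|p|^2\<close>, of the mixed terms and of \<open>|t|^2\<close> in the
    difference of the two sides; the last one enters reduced by 1.\<close>
  have A: "?u * ?u - 2 * ?a + ?a * ?a * (s - 1) = 0"
  proof -
    have "?a * (s - 1) = 1 - ?u" using alp_bet(3) by simp
    then have "?a * ?a * (s - 1) = ?a * (1 - ?u)" by (simp only: mult.assoc)
    moreover have au: "?a * sqrt s + ?a = ?u" using alp_bet(1,2) by linarith
    have "?u * ?u = ?u * (?a * sqrt s + ?a)" unfolding au ..
    moreover have "?u * (?a * sqrt s + ?a) = ?a + ?u * ?a" using s_pos(2) by (simp add: distrib_left)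
    ultimately show ?thesis by (simp add: right_diff_distrib)
  qed
  have B: "?u * ?u - ?u + ?a * ?u * (s - 1) = 0"
  proof -
    have "?a * (s - 1) = 1 - ?u" using alp_bet(3) by simp
    then have "?a * ?u * (s - 1) = ?u * (1 - ?u)" by (metis mult.assoc mult.commute)
    then show ?thesis by (simp add: algebra_simps)
  qed
  have C: "?u * ?u + ?u * ?u * (s - 1) = 1"
    using s_pos by (simp add: field_simps)
  have "of_real ((cmod (p + t))\<^sup>2 / s) - q * cnj p - cnj q * p + q * cnj q * of_real (s - 1) - t * cnj t
     = of_real (?u * ?u - 2 * ?a + ?a * ?a * (s - 1)) * (p * cnj p)
     + of_real (?u * ?u - ?u + ?a * ?u * (s - 1)) * (p * cnj t + t * cnj p)
     + of_real (?u * ?u + ?u * ?u * (s - 1) - 1) * (t * cnj t)"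
  proof -
    have gen: "u * u * ((p + t) * (cp + ct)) - (a * p + u * t) * cp - (a * cp + u * ct) * p + (a * p + u * t) * (a * cp + u * ct) * S - t * ct
      = (u * u - 2 * a + a * a * S) * (p * cp) + (u * u - u + a * u * S) * (p * ct + t * cp) + (u * u + u * u * S - 1) * (t * ct)"
      for a u S p cp t ct :: complex by (simp add: algebra_simps)
    have "of_real ((cmod (p + t))\<^sup>2 / s) = of_real ?u * of_real ?u * ((p + t) * (cnj p + cnj t))"
      unfolding complex_cnj_add[symmetric] complex_norm_square[symmetric] of_real_mult[symmetric] uu[symmetric] by simp
    moreover have "cnj q = of_real ?a * cnj p + of_real ?u * cnj t"
      unfolding q complex_cnj_add complex_cnj_mult complex_cnj_complex_of_real ..
    ultimately show ?thesis
      using gen[where u="of_real ?u" and p=p and cp="cnj p" and t=t and ct="cnj t" and a="of_real ?a" and S="of_real (s - 1)"]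
      by (simp only: q of_real_add of_real_diff of_real_mult of_real_1 of_real_numeral)
  qed
  also have "\<dots> = 0" unfolding A B C by simp
  finally have "of_real (nsq n r + (cmod t)\<^sup>2) = (of_real ((cmod (p + t))\<^sup>2 / s + (\<Sum>j<n. (cmod (r j - q * cnj (v j)))\<^sup>2)) :: complex)"
    unfolding of_real_add 1 nv complex_norm_square[of t] by (simp add: algebra_simps)
  then show ?thesis by (simp only: of_real_eq_iff)
qed

text \<open>The rotation of \<open>row_isometry\<close> is applied to all rows and then, conjugated,
  to all columns. This unitary conjugation makes the matrix block triangular, with diagonal blocks
  \<open>l\<close> and \<open>A D' B\<close> for \<open>A = rank1 (- alp n v) v\<close> and
  \<open>B = rank1 (bet n v) v\<close>, and with \<open>sqrt s\<close> times \<open>x B\<close> as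
  the remaining row. For given \<open>D'\<close> the row \<open>b\<close> enters only through its
  translate \<open>x\<close>, so the Gaussian weight separates.\<close>

lemma frob_deflate:
  fixes b c :: "nat \<Rightarrow> complex" and a l :: complex and D :: "nat \<times> nat \<Rightarrow> complex"
  assumes c: "\<And>i. i < n \<Longrightarrow> c i = l * v i - (\<Sum>j<n. D (i, j) * v j)" and a: "a = l - (\<Sum>j<n. b j * v j)"
  defines "D' \<equiv> deflate D b v"
  defines "e \<equiv> \<lambda>j. ((\<Sum>k<n. cnj (v k) * D' (k, j)) - l * cnj (v j)) / of_real s"
  defines "x \<equiv> \<lambda>j. e j + b j"
  shows "frob (Suc n) (asm n D b c a) = (cmod l)\<^sup>2
    + frob n (\<lambda>(i, j). \<Sum>k<n. rank1 (- alp n v) v (i, k) * (\<Sum>m<n. D' (k, m) * rank1 (bet n v) v (m, j)))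
    + s * (\<Sum>j<n. (cmod (\<Sum>k<n. x k * rank1 (bet n v) v (k, j)))\<^sup>2)"
proof -
  let ?a = "of_real (alp n v) :: complex" and ?b = "of_real (bet n v) :: complex" and ?r = "of_real (sqrt s) :: complex"
  have r0: "?r \<noteq> 0" "of_real s \<noteq> (0::complex)" "?r * ?r = of_real s" using s_pos by (auto simp flip: of_real_mult)
  have ab: "?a - 1 / ?r = - ?b"
  proof -
    have "alp n v - 1 / sqrt s = - bet n v" using alp_bet(2) by simp
    then have "of_real (alp n v - 1 / sqrt s) = (of_real (- bet n v) :: complex)" by simp
    then show ?thesis by simp
  qed
  define w where "w = (\<Sum>j<n. b j * v j)"
  define d where "d i = (\<Sum>j<n. D' (i, j) * v j)" for i
  define qn where "qn = - ?b * w + l / ?r"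
  define En where "En j = b j - qn * cnj (v j)" for j
  define F where "F i j = D' (i, j) + ?b * d i * cnj (v j)" for i j
  define P where "P j = (\<Sum>k<n. cnj (v k) * F k j)" for j
  have D: "D (i, j) = D' (i, j) + v i * b j" for i j by (simp add: D'_def deflate_def)
  have Dv: "(\<Sum>j<n. D (i, j) * v j) = d i + v i * w" for i
    by (simp add: D d_def w_def distrib_right sum.distrib sum_distrib_left mult.assoc)
  have rows: "nsq n (\<lambda>j. D (i, j)) + (cmod (c i))\<^sup>2 = (cmod l)\<^sup>2 * (cmod (v i))\<^sup>2 / s + (\<Sum>j<n. (cmod (F i j + v i * En j))\<^sup>2)"
    if "i < n" for i
  proof -
    have "?a * (d i + v i * w) + c i / ?r = (?a - 1 / ?r) * (d i + v i * w) + l * v i / ?r"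
      unfolding c[OF that] Dv by (simp add: diff_divide_distrib left_diff_distrib)
    also have "\<dots> = - ?b * d i + v i * qn"
      unfolding ab by (simp add: qn_def algebra_simps)
    finally have q: "?a * (d i + v i * w) + c i / ?r = - ?b * d i + v i * qn" .
    have "D (i, j) - (- ?b * d i + v i * qn) * cnj (v j) = F i j + v i * En j" for j
      by (simp add: D F_def En_def algebra_simps)
    moreover have "d i + v i * w + c i = l * v i" using c[OF that] Dv by simp
    ultimately show ?thesis
      using row_isometry[of "\<lambda>j. D (i, j)" "c i"] unfolding Dv q
      by (simp add: norm_mult power_mult_distrib)
  qed
  have last: "nsq n b + (cmod a)\<^sup>2 = (cmod l)\<^sup>2 / s + (\<Sum>j<n. (cmod (En j))\<^sup>2)"
  proof -
    have "?a * w + a / ?r = (?a - 1 / ?r) * w + l / ?r"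
      unfolding a w_def[symmetric] by (simp add: diff_divide_distrib left_diff_distrib)
    also have "\<dots> = qn" unfolding ab qn_def ..
    finally have "?a * w + a / ?r = qn" .
    then show ?thesis
      using row_isometry[of b a] a unfolding w_def[symmetric] by (simp add: En_def)
  qed
  have cols: "(\<Sum>i<n. (cmod (F i j + v i * En j))\<^sup>2) + (cmod (En j))\<^sup>2
    = (cmod (P j + of_real s * En j))\<^sup>2 / s + (\<Sum>i<n. (cmod (F i j - ?a * P j * v i))\<^sup>2)" for j
  proof -
    have p: "(\<Sum>i<n. cnj (F i j + v i * En j) * v i) = cnj (P j + of_real (s - 1) * En j)"
    proof -
      have "of_real (s - 1) = (\<Sum>i<n. v i * cnj (v i))" by (simp add: s_def nsq_complex)
      then show ?thesis
        by (simp add: P_def distrib_right distrib_left sum.distrib sum_distrib_left sum_distrib_right mult_ac)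
    qed
    have "?a * cnj (P j + of_real (s - 1) * En j) + cnj (En j) / ?r
        = ?a * cnj (P j) + of_real (alp n v * (s - 1) + 1 / sqrt s) * cnj (En j)"
      by (simp add: algebra_simps)
    also have "\<dots> = ?a * cnj (P j) + cnj (En j)" unfolding alp_bet(3) by simp
    finally have q: "?a * cnj (P j + of_real (s - 1) * En j) + cnj (En j) / ?r = ?a * cnj (P j) + cnj (En j)" .
    have r: "cmod (cnj (F i j + v i * En j) - (?a * cnj (P j) + cnj (En j)) * cnj (v i)) = cmod (F i j - ?a * P j * v i)" for i
    proof -
      have "cnj (F i j + v i * En j) - (?a * cnj (P j) + cnj (En j)) * cnj (v i) = cnj (F i j - ?a * P j * v i)"
        by (simp add: algebra_simps)
      then show ?thesis by (metis complex_mod_cnj)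
    qed
    have t: "cmod (cnj (P j + of_real (s - 1) * En j) + cnj (En j)) = cmod (P j + of_real s * En j)"
    proof -
      have "cnj (P j + of_real (s - 1) * En j) + cnj (En j) = cnj (P j + of_real s * En j)"
        by (simp add: algebra_simps)
      then show ?thesis by (metis complex_mod_cnj)
    qed
    show ?thesis
      using row_isometry[of "\<lambda>i. cnj (F i j + v i * En j)" "cnj (En j)"]
      unfolding p q r t nsq_def complex_mod_cnj by simp
  qed
  have DB: "(\<Sum>m<n. D' (k, m) * rank1 (bet n v) v (m, j)) = F k j" if "j < n" for k j
    using that by (simp add: rank1_def F_def d_def distrib_left sum.distrib sum_distrib_left sum_distrib_right mult_ac
        if_distrib[of "\<lambda>t. _ * t"] cong: if_cong)
  have ADB: "(\<Sum>k<n. rank1 (- alp n v) v (i, k) * (\<Sum>m<n. D' (k, m) * rank1 (bet n v) v (m, j))) = F i j - ?a * P j * v i"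
    if "i < n" "j < n" for i j
  proof -
    have "(\<Sum>k<n. rank1 (- alp n v) v (i, k) * F k j) = (\<Sum>k<n. (if k = i then F k j else 0) - ?a * v i * (cnj (v k) * F k j))"
      by (intro sum.cong) (auto simp: rank1_def algebra_simps)
    also have "\<dots> = F i j - ?a * P j * v i"
      using that by (simp add: sum_subtractf P_def sum_distrib_left[symmetric])
    finally show ?thesis using that by (simp add: DB)
  qed
  \<comment> \<open>This identity is what dictates the shift \<open>e\<close>: it completes the part
    of the remaining row that does not depend on \<open>b\<close> to a multiple of a vector times
    \<open>B\<close>.\<close>
  have xB: "P j + of_real s * En j = of_real s * (\<Sum>k<n. x k * rank1 (bet n v) v (k, j))" if "j < n" for j
  proof -
    define ev where "ev = (\<Sum>k<n. e k * v k)"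
    have "(\<Sum>k<n. x k * rank1 (bet n v) v (k, j)) = x j + ?b * (\<Sum>k<n. x k * v k) * cnj (v j)"
      using that by (simp add: rank1_def distrib_left sum.distrib sum_distrib_left sum_distrib_right mult_ac
        if_distrib[of "\<lambda>t. _ * t"] cong: if_cong)
    also have "(\<Sum>k<n. x k * v k) = ev + w"
      by (simp add: x_def ev_def w_def distrib_right sum.distrib)
    finally have 1: "(\<Sum>k<n. x k * rank1 (bet n v) v (k, j)) = x j + ?b * (ev + w) * cnj (v j)" .
    have se: "of_real s * e j = (\<Sum>k<n. cnj (v k) * D' (k, j)) - l * cnj (v j)" for j
      using r0 by (simp add: e_def)
    have "of_real s * ev = (\<Sum>k<n. (of_real s * e k) * v k)"
      by (simp add: ev_def sum_distrib_left mult.assoc)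
    also have "\<dots> = (\<Sum>k<n. \<Sum>i<n. cnj (v i) * (D' (i, k) * v k)) - l * (\<Sum>k<n. v k * cnj (v k))"
      unfolding se by (simp add: left_diff_distrib right_diff_distrib sum_subtractf sum_distrib_left sum_distrib_right mult_ac)
    also have "(\<Sum>k<n. \<Sum>i<n. cnj (v i) * (D' (i, k) * v k)) = (\<Sum>i<n. cnj (v i) * d i)"
      by (subst sum.swap) (simp add: d_def sum_distrib_left)
    finally have sev: "of_real s * ev = (\<Sum>i<n. cnj (v i) * d i) - l * of_real (s - 1)"
      by (simp add: s_def nsq_complex)
    have P: "P j = (\<Sum>k<n. cnj (v k) * D' (k, j)) + ?b * (\<Sum>i<n. cnj (v i) * d i) * cnj (v j)"
      by (simp add: P_def F_def distrib_left sum.distrib sum_distrib_left sum_distrib_right mult_ac)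
    have "of_real s * (x j + ?b * (ev + w) * cnj (v j))
        = of_real s * e j + of_real s * b j + ?b * (of_real s * ev) * cnj (v j) + of_real s * ?b * w * cnj (v j)"
      by (simp add: x_def algebra_simps)
    also have "\<dots> = P j + of_real s * (b j + ?b * w * cnj (v j)) - of_real (bet n v * (s - 1) + 1) * l * cnj (v j)"
      unfolding se sev P by (simp add: algebra_simps)
    also have "\<dots> = P j + of_real s * (b j + ?b * w * cnj (v j)) - ?r * l * cnj (v j)"
      unfolding alp_bet(4) ..
    also have "\<dots> = P j + of_real s * En j"
      unfolding En_def qn_def r0(3)[symmetric] using r0(1) by (simp add: field_simps)
    finally show ?thesis unfolding 1 ..
  qed
  have "frob (Suc n) (asm n D b c a) = (\<Sum>i<n. nsq n (\<lambda>j. D (i, j)) + (cmod (c i))\<^sup>2) + (nsq n b + (cmod a)\<^sup>2)"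
    by (simp add: frob_def nsq_def sum.distrib)
  also have "\<dots> = (\<Sum>i<n. (cmod l)\<^sup>2 * (cmod (v i))\<^sup>2 / s) + (cmod l)\<^sup>2 / s
      + (\<Sum>i<n. \<Sum>j<n. (cmod (F i j + v i * En j))\<^sup>2) + (\<Sum>j<n. (cmod (En j))\<^sup>2)"
    unfolding last by (simp add: rows sum.distrib)
  also have "(\<Sum>i<n. (cmod l)\<^sup>2 * (cmod (v i))\<^sup>2 / s) + (cmod l)\<^sup>2 / s = (cmod l)\<^sup>2 * ((nsq n v + 1) / s)"
    by (simp add: nsq_def sum_divide_distrib sum_distrib_left add_divide_distrib distrib_left)
  also have "(nsq n v + 1) / s = 1" using s_pos by (simp add: s_def)
  also have "(\<Sum>i<n. \<Sum>j<n. (cmod (F i j + v i * En j))\<^sup>2) = (\<Sum>j<n. \<Sum>i<n. (cmod (F i j + v i * En j))\<^sup>2)"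
    by (rule sum.swap)
  finally have "frob (Suc n) (asm n D b c a) = (cmod l)\<^sup>2
      + (\<Sum>j<n. (\<Sum>i<n. (cmod (F i j + v i * En j))\<^sup>2) + (cmod (En j))\<^sup>2)"
    by (simp add: sum.distrib)
  also have "\<dots> = (cmod l)\<^sup>2 + ((\<Sum>j<n. (cmod (P j + of_real s * En j))\<^sup>2 / s) + (\<Sum>j<n. \<Sum>i<n. (cmod (F i j - ?a * P j * v i))\<^sup>2))"
    unfolding cols by (simp add: sum.distrib)
  also have "(\<Sum>j<n. (cmod (P j + of_real s * En j))\<^sup>2 / s) = s * (\<Sum>j<n. (cmod (\<Sum>k<n. x k * rank1 (bet n v) v (k, j)))\<^sup>2)"
    unfolding sum_distrib_left using s_pos(1)
    by (intro sum.cong) (auto simp: xB norm_mult power_mult_distrib power2_eq_square)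
  also have "(\<Sum>j<n. \<Sum>i<n. (cmod (F i j - ?a * P j * v i))\<^sup>2)
      = frob n (\<lambda>(i, j). \<Sum>k<n. rank1 (- alp n v) v (i, k) * (\<Sum>m<n. D' (k, m) * rank1 (bet n v) v (m, j)))"
    unfolding frob_def by (subst sum.swap) (simp add: ADB)
  finally show ?thesis by simp
qed

lemma rank1_inverse:
  assumes "i < n" "j < n"
  shows "(\<Sum>k<n. rank1 (- alp n v) v (i, k) * rank1 (bet n v) v (k, j)) = (if i = j then 1 else 0)"
proof -
  have "(\<Sum>k<n. rank1 (- alp n v) v (i, k) * rank1 (bet n v) v (k, j))
     = (\<Sum>k<n. (if i = k then rank1 (bet n v) v (k, j) else 0)
        + (if k = j then - of_real (alp n v) * v i * cnj (v k) else 0)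
        - of_real (alp n v * bet n v) * (v i * cnj (v j)) * (v k * cnj (v k)))"
    by (intro sum.cong) (auto simp: rank1_def algebra_simps)
  also have "\<dots> = rank1 (bet n v) v (i, j) - of_real (alp n v) * v i * cnj (v j)
        - of_real (alp n v * bet n v) * (v i * cnj (v j)) * of_real (s - 1)"
    using assms by (simp add: sum.distrib sum_subtractf sum_distrib_left[symmetric] s_def nsq_complex)
  also have "\<dots> = (if i = j then 1 else 0) + of_real (bet n v - alp n v - alp n v * (bet n v * (s - 1))) * (v i * cnj (v j))"
    by (simp add: rank1_def algebra_simps)
  also have "bet n v * (s - 1) = sqrt s - 1" using alp_bet(4) by simp
  also have "bet n v - alp n v - alp n v * (sqrt s - 1) = 0" using alp_bet(1) by (simp add: algebra_simps)
  finally show ?thesis by simp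
qed

end

lemma detf_one: "detf n (\<lambda>(i, j). if i = j then 1 else 0) = 1"
  by (subst detf_upper) auto

text \<open>One bordered identity matrix, evaluated once by eliminating the border and once by its
  Schur complement.\<close>

lemma detf_rank1: "detf n (rank1 t v) = of_real (1 + t * nsq n v)"
proof -
  define T where "T = (\<lambda>(i, j). if i < n then if j < n then (if i = j then 1 else 0) else - of_real t * v i
     else if j < n then cnj (v j) else (1::complex))"
  have "detf n (rank1 t v) = detf n (\<lambda>(i, j). T (i, j) - T (i, n) * T (n, j))"
    by (rule detf_cong) (auto simp: T_def rank1_def)
  also have "\<dots> = detf (Suc n) T"
    by (rule detf_rank_one_update[symmetric]) (simp add: T_def)
  also have "\<dots> = detf n T * (T (n, n) - (\<Sum>k<n. T (n, k) * (- of_real t * v k)))"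
    by (rule detf_schur) (auto simp: T_def sum_negf if_distrib[of "\<lambda>t. t * _"] cong: if_cong)
  also have "detf n T = detf n (\<lambda>(i, j). if i = j then 1 else 0)"
    by (rule detf_cong) (auto simp: T_def)
  also have "T (n, n) - (\<Sum>k<n. T (n, k) * (- of_real t * v k)) = of_real (1 + t * nsq n v)"
    by (simp add: T_def nsq_complex sum_negf sum_distrib_left mult_ac)
  finally show ?thesis by (simp add: detf_one)
qed

text \<open>A leading block of \<open>rank1\<close> has the same form with \<open>v\<close>
  truncated. Truncation only decreases \<open>nsq\<close>, and
  \<open>alp n v * nsq n v = 1 - 1 / sqrt s\<close> is less than 1 already for the whole
  vector.\<close>

lemma detf_rank1_nz:
  assumes "k \<le> n"
  shows "detf k (rank1 (- alp n v) v) \<noteq> 0" "detf k (rank1 (bet n v) v) \<noteq> 0"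
proof -
  let ?s = "1 + nsq n v"
  have le: "nsq k v \<le> nsq n v" unfolding nsq_def using assms by (intro sum_mono2) auto
  have "alp n v > 0" "bet n v > 0"
    by (auto simp: alp_def bet_def add_pos_nonneg intro!: divide_pos_pos mult_pos_pos)
  then have "alp n v * nsq k v \<le> alp n v * nsq n v" using le by simp
  also have "\<dots> < 1"
  proof -
    have "1 / sqrt (1 + nsq n v) > 0" using s_pos(2)[OF refl, of n v] by (simp only: zero_less_divide_1_iff)
    moreover have "alp n v * nsq n v + 1 / sqrt (1 + nsq n v) = 1" using alp_bet(3)[OF refl, of n v] by simp
    ultimately show ?thesis by linarith
  qed
  finally have "1 + - alp n v * nsq k v \<noteq> 0" by simp
  then show "detf k (rank1 (- alp n v) v) \<noteq> 0" unfolding detf_rank1 of_real_eq_0_iff .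
  have "0 \<le> bet n v * nsq k v" using \<open>bet n v > 0\<close> by simp
  then have "1 + bet n v * nsq k v \<noteq> 0" by linarith
  then show "detf k (rank1 (bet n v) v) \<noteq> 0" unfolding detf_rank1 of_real_eq_0_iff .
qed

lemma chi_conjugate:
  assumes AB: "\<And>i j. i < n \<Longrightarrow> j < n \<Longrightarrow> (\<Sum>k<n. A (i, k) * B (k, j)) = (if i = j then 1 else 0)"
  shows "chi n (\<lambda>(i, j). \<Sum>k<n. A (i, k) * (\<Sum>m<n. D (k, m) * B (m, j))) z = chi n D z"
proof -
  define L where "L = (\<lambda>(k, j). \<Sum>m<n. lam z D (k, m) * B (m, j))"
  have "lam z (\<lambda>(i, j). \<Sum>k<n. A (i, k) * (\<Sum>m<n. D (k, m) * B (m, j))) (i, j) = (\<Sum>k<n. A (i, k) * L (k, j))"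
    if "i < n" "j < n" for i j
  proof -
    have "(\<Sum>k<n. A (i, k) * L (k, j)) = (\<Sum>k<n. A (i, k) * (z * B (k, j) - (\<Sum>m<n. D (k, m) * B (m, j))))"
      by (intro sum.cong) (auto simp: L_def lam_sum)
    also have "\<dots> = z * (\<Sum>k<n. A (i, k) * B (k, j)) - (\<Sum>k<n. A (i, k) * (\<Sum>m<n. D (k, m) * B (m, j)))"
      by (simp add: right_diff_distrib sum_subtractf sum_distrib_left mult_ac)
    finally show ?thesis using that by (simp add: AB lam_def)
  qed
  then have "chi n (\<lambda>(i, j). \<Sum>k<n. A (i, k) * (\<Sum>m<n. D (k, m) * B (m, j))) z = detf n (\<lambda>(i, j). \<Sum>k<n. A (i, k) * L (k, j))"
    unfolding chi_def by (intro detf_cong) auto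
  also have "\<dots> = detf n A * (detf n (lam z D) * detf n B)"
    unfolding detf_mult L_def ..
  also have "\<dots> = detf n (\<lambda>(i, j). \<Sum>k<n. A (i, k) * B (k, j)) * chi n D z"
    unfolding detf_mult chi_def by simp
  also have "detf n (\<lambda>(i, j). \<Sum>k<n. A (i, k) * B (k, j)) = 1"
    by (subst detf_one[of n, symmetric], rule detf_cong) (simp add: AB)
  finally show ?thesis by simp
qed

section \<open>Splitting off one eigenvalue\<close>

lemma measurable_cnj [measurable]: "cnj \<in> borel_measurable borel"
  by (intro borel_measurable_continuous_onI continuous_intros)

lemma measurable_lam_entry:
  assumes "D \<in> measurable N (LM n)" "z \<in> borel_measurable N" "i < n" "j < n"
  shows "(\<lambda>p. lam (z p) (D p) (i, j)) \<in> borel_measurable N"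
  using assms measurable_LB_component[OF assms(1), of "(i, j)"] by (cases "i = j") (auto simp: lam_def)

lemma measurable_chi [measurable (raw)]:
  assumes "D \<in> measurable N (LM n)" "z \<in> borel_measurable N"
  shows "(\<lambda>p. chi n (D p) (z p)) \<in> borel_measurable N"
  unfolding chi_def by (intro measurable_detf measurable_lam_entry[OF assms])

lemma measurable_resolvent [measurable (raw)]:
  assumes "D \<in> measurable N (LM n)" "z \<in> borel_measurable N" "c \<in> measurable N (LV n)"
  shows "(\<lambda>p. resolvent n (D p) (z p) (c p)) \<in> measurable N (LV n)"
  unfolding resolvent_def using measurable_LB_component[OF assms(3)]
  by (intro measurable_mvf measurable_invf measurable_lam_entry[OF assms(1,2)]) auto

lemma measurable_mvf_lam [measurable (raw)]:
  assumes "D \<in> measurable N (LM n)" "z \<in> borel_measurable N" "c \<in> measurable N (LV n)"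
  shows "(\<lambda>p. mvf n (lam (z p) (D p)) (c p)) \<in> measurable N (LV n)"
  using measurable_LB_component[OF assms(3)]
  by (intro measurable_mvf measurable_lam_entry[OF assms(1,2)]) auto

lemma measurable_dot [measurable (raw)]:
  assumes "b \<in> measurable N (LV n)" "c \<in> measurable N (LV n)"
  shows "(\<lambda>p. \<Sum>j<n. b p j * c p j) \<in> borel_measurable N"
  using measurable_LB_component[OF assms(1)] measurable_LB_component[OF assms(2)] by auto

lemma measurable_hfun [measurable (raw)]:
  assumes [measurable]: "D \<in> measurable N (LM n)" "z \<in> borel_measurable N" "b \<in> measurable N (LV n)" "c \<in> measurable N (LV n)"
  shows "(\<lambda>p. hfun n (D p) (b p) (c p) (z p)) \<in> borel_measurable N"
  unfolding hfun_def by measurable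

lemma measurable_frob [measurable (raw)]:
  assumes "D \<in> measurable N (LM n)"
  shows "(\<lambda>p. frob n (D p)) \<in> borel_measurable N"
  unfolding frob_def using measurable_LB_component[OF assms] by (auto intro!: borel_measurable_sum)

text \<open>The extensional form of \<open>deflate\<close>, measurable as a map into
  \<open>LM n\<close>; \<open>chi\<close> does not distinguish the two.\<close>

definition defl :: "nat \<Rightarrow> (nat \<times> nat \<Rightarrow> complex) \<Rightarrow> (nat \<Rightarrow> complex) \<Rightarrow> (nat \<Rightarrow> complex) \<Rightarrow> nat \<times> nat \<Rightarrow> complex" where
  "defl n D b v = (\<lambda>ij\<in>{..<n} \<times> {..<n}. - (v (fst ij) * b (snd ij)) + D ij)"

lemma measurable_defl [measurable (raw)]:
  assumes "D \<in> measurable N (LM n)" "b \<in> measurable N (LV n)" "v \<in> measurable N (LV n)"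
  shows "(\<lambda>p. defl n (D p) (b p) (v p)) \<in> measurable N (LM n)"
  unfolding defl_def
  using measurable_LB_component[OF assms(1)] measurable_LB_component[OF assms(2)] measurable_LB_component[OF assms(3)]
  by (intro measurable_LB_restrict) auto

lemma chi_defl: "chi n (defl n D b v) z = chi n (deflate D b v) z"
  by (rule chi_cong) (auto simp: defl_def deflate_def)

text \<open>The list \<open>zs\<close> holds the eigenvalues already split off; each has left its
  Jacobian, a squared characteristic polynomial, as a weight on the smaller matrix. When a further
  eigenvalue \<open>l\<close> is split off, every such factor loses \<open>|z - l|^2\<close> to
  \<open>qfun\<close>, and the new Jacobian becomes the factor belonging to \<open>l\<close>. In
  this way the Vandermonde product builds up.\<close>

definition Psi :: "complex set \<Rightarrow> nat \<Rightarrow> complex list \<Rightarrow> (nat \<times> nat \<Rightarrow> complex) \<Rightarrow> ennreal" where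
  "Psi V n zs G = (if \<forall>z\<in>V. chi n G z \<noteq> 0 then \<Prod>z\<leftarrow>zs. ennreal ((cmod (chi n G z))\<^sup>2) else 0)"

definition hole_weight :: "complex set \<Rightarrow> nat \<Rightarrow> complex list \<Rightarrow> ennreal" where
  "hole_weight V n zs = (\<integral>\<^sup>+G. Psi V n zs G * ennreal (exp (- frob n G)) \<partial>LM n)"

definition qfun :: "complex set \<Rightarrow> complex list \<Rightarrow> complex \<Rightarrow> ennreal" where
  "qfun V zs l = (if l \<in> V then 0 else \<Prod>z\<leftarrow>zs. ennreal ((cmod (z - l))\<^sup>2))"

lemma prod_list_mult: "(\<Prod>z\<leftarrow>zs. f z * g z :: 'a::comm_monoid_mult) = (\<Prod>z\<leftarrow>zs. f z) * (\<Prod>z\<leftarrow>zs. g z)"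
  by (induction zs) (auto simp: mult_ac)

lemma Psi_Suc:
  assumes "\<And>z. chi (Suc n) G z = (z - l) * chi n D z"
  shows "ennreal ((cmod (chi n D l))\<^sup>2) * Psi V (Suc n) zs G = qfun V zs l * Psi V n (l # zs) D"
proof -
  have "(\<forall>z\<in>V. chi (Suc n) G z \<noteq> 0) \<longleftrightarrow> l \<notin> V \<and> (\<forall>z\<in>V. chi n D z \<noteq> 0)"
    by (auto simp: assms)
  then show ?thesis
    by (simp add: Psi_def qfun_def assms norm_mult power_mult_distrib ennreal_mult prod_list_mult mult_ac)
qed

text \<open>A compact set contains a root iff the infimum of the modulus over a countable dense subset vanishes.\<close>
lemma measurable_no_root:
  assumes "open V"
  shows "{G \<in> space (LM n). \<forall>z\<in>V. chi n G z \<noteq> 0} \<in> sets (LM n)"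
proof -
  obtain \<D> where D: "countable \<D>" "\<And>X. X \<in> \<D> \<Longrightarrow> \<exists>a b. X = cbox a b" "\<Union>\<D> = V"
    using open_countable_Union_open_cbox[OF assms] by metis
  have 1: "{G \<in> space (LM n). \<forall>z\<in>X. chi n G z \<noteq> 0} \<in> sets (LM n)" if "X \<in> \<D>" for X
  proof (cases "X = {}")
    case False
    have "compact X" using D(2)[OF that] by auto
    obtain T where T: "countable T" "T \<subseteq> X" "X \<subseteq> closure T"
      using separable[of X] by auto
    have "(\<forall>z\<in>X. chi n G z \<noteq> 0) \<longleftrightarrow> (\<exists>k::nat. \<forall>z\<in>T. cmod (chi n G z) \<ge> 1 / Suc k)" for G
    proof
      assume nz: "\<forall>z\<in>X. chi n G z \<noteq> 0"
      have "continuous_on X (\<lambda>z. cmod (chi n G z))"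
        by (intro continuous_on_norm continuous_at_imp_continuous_on ballI isCont_chi)
      then obtain z0 where z0: "z0 \<in> X" "\<And>z. z \<in> X \<Longrightarrow> cmod (chi n G z0) \<le> cmod (chi n G z)"
        using continuous_attains_inf[OF \<open>compact X\<close> False] by metis
      then have "cmod (chi n G z0) > 0" using nz by auto
      then obtain k where "1 / real (Suc k) < cmod (chi n G z0)"
        using nat_approx_posE by metis
      then show "\<exists>k::nat. \<forall>z\<in>T. cmod (chi n G z) \<ge> 1 / Suc k"
        using z0(2) T(2) by (intro exI[of _ k]) force
    next
      assume "\<exists>k::nat. \<forall>z\<in>T. cmod (chi n G z) \<ge> 1 / Suc k"
      then obtain k :: nat where k: "\<And>z. z \<in> T \<Longrightarrow> cmod (chi n G z) \<ge> 1 / Suc k" by auto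
      have "closed {z. cmod (chi n G z) \<ge> 1 / Suc k}"
        by (intro closed_Collect_le continuous_on_norm continuous_on_const continuous_at_imp_continuous_on ballI isCont_chi)
      then have "closure T \<subseteq> {z. cmod (chi n G z) \<ge> 1 / Suc k}"
        using k by (intro closure_minimal) auto
      then have "cmod (chi n G z) \<ge> 1 / Suc k" if "z \<in> X" for z
        using that T(3) by auto
      moreover have "1 / real (Suc k) > 0" by simp
      ultimately show "\<forall>z\<in>X. chi n G z \<noteq> 0" by (metis norm_zero not_le)
    qed
    then show ?thesis using T(1) by simp
  qed simp
  have "{G \<in> space (LM n). \<forall>z\<in>V. chi n G z \<noteq> 0} = {G \<in> space (LM n). \<forall>X\<in>\<D>. G \<in> {G \<in> space (LM n). \<forall>z\<in>X. chi n G z \<noteq> 0}}"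
    unfolding D(3)[symmetric] by auto
  also have "\<dots> \<in> sets (LM n)"
    using D(1) 1 by measurable
  finally show ?thesis .
qed

lemma measurable_Psi [measurable]:
  assumes "open V"
  shows "Psi V n zs \<in> borel_measurable (LM n)"
proof -
  have "(\<lambda>G. \<Prod>z\<leftarrow>zs. ennreal ((cmod (chi n G z))\<^sup>2)) \<in> borel_measurable (LM n)"
    by (induction zs) (auto intro!: borel_measurable_times_ennreal)
  then show ?thesis
    unfolding Psi_def[abs_def] using measurable_no_root[OF assms, of n] by (intro measurable_If) auto
qed

lemma measurable_qfun [measurable]:
  assumes "open V"
  shows "qfun V zs \<in> borel_measurable borel"
proof -
  have "(\<lambda>l. \<Prod>z\<leftarrow>zs. ennreal ((cmod (z - l))\<^sup>2)) \<in> borel_measurable borel"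
    by (induction zs) (auto intro!: borel_measurable_times_ennreal)
  then show ?thesis
    unfolding qfun_def[abs_def] using assms by (intro measurable_If) auto
qed

text \<open>The Gaussian integral over the row \<open>b\<close> after its translation. It depends on
  \<open>v\<close> alone, neither on the hole nor on the eigenvalue or the compression, and
  therefore goes into the constant \<open>Kc\<close>.\<close>

definition K1 :: "nat \<Rightarrow> (nat \<Rightarrow> complex) \<Rightarrow> ennreal" where
  "K1 n v = (\<integral>\<^sup>+x. ennreal (exp (- ((1 + nsq n v) * (\<Sum>j<n. (cmod (\<Sum>k<n. x k * rank1 (bet n v) v (k, j)))\<^sup>2)))) \<partial>LV n)"

lemma measurable_K1_integrand [measurable (raw)]:
  assumes "v \<in> measurable N (LV n)" "x \<in> measurable N (LV n)"
  shows "(\<lambda>p. (1 + nsq n (v p)) * (\<Sum>j<n. (cmod (\<Sum>k<n. x p k * rank1 (bet n (v p)) (v p) (k, j)))\<^sup>2)) \<in> borel_measurable N"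
proof -
  note c = measurable_LB_component[OF assms(1)] measurable_LB_component[OF assms(2)]
  have n: "(\<lambda>p. nsq n (v p)) \<in> borel_measurable N"
    unfolding nsq_def using c by (auto intro!: borel_measurable_sum)
  then have b: "(\<lambda>p. bet n (v p)) \<in> borel_measurable N"
    unfolding bet_def by simp
  have "(\<lambda>p. rank1 (bet n (v p)) (v p) (k, j)) \<in> borel_measurable N" if "k < n" "j < n" for k j
  proof -
    have "(\<lambda>p. v p k) \<in> borel_measurable N" "(\<lambda>p. cnj (v p j)) \<in> borel_measurable N"
      using c that by (auto intro: measurable_compose[OF _ measurable_cnj])
    then show ?thesis using b by (auto simp: rank1_def)
  qed
  then show ?thesis using c n
    by (auto intro!: borel_measurable_times borel_measurable_add borel_measurable_sum borel_measurable_power borel_measurable_norm)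
qed

lemma measurable_K1 [measurable]: "K1 n \<in> borel_measurable (LV n)"
  unfolding K1_def[abs_def]
  by (intro sigma_finite_measure.borel_measurable_nn_integral sigma_finite_LB) (auto simp: case_prod_beta')

definition conj1 :: "nat \<Rightarrow> (nat \<Rightarrow> complex) \<Rightarrow> (nat \<times> nat \<Rightarrow> complex) \<Rightarrow> nat \<times> nat \<Rightarrow> complex" where
  "conj1 n v D = colop n n (rank1 (- alp n v) v) (rowop n (rank1 (bet n v) v) D)"

lemma conj1_apply:
  "i < n \<Longrightarrow> j < n \<Longrightarrow> conj1 n v D (i, j) = (\<Sum>k<n. rank1 (- alp n v) v (i, k) * (\<Sum>m<n. D (k, m) * rank1 (bet n v) v (m, j)))"
  by (simp add: conj1_def colop_def rowop_def)

lemma chi_conj1: "chi n (conj1 n v D) z = chi n D z"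
proof -
  have "chi n (conj1 n v D) z = chi n (\<lambda>(i, j). \<Sum>k<n. rank1 (- alp n v) v (i, k) * (\<Sum>m<n. D (k, m) * rank1 (bet n v) v (m, j))) z"
    by (rule chi_cong) (simp add: conj1_apply)
  also have "\<dots> = chi n D z"
    by (rule chi_conjugate) (rule rank1_inverse[OF refl])
  finally show ?thesis .
qed

text \<open>The matrices multiplying from the left and from the right are inverse to each other, so
  their Jacobians cancel.\<close>

lemma nn_integral_conj1:
  assumes [measurable]: "f \<in> borel_measurable (LM n)"
  shows "(\<integral>\<^sup>+D. f (conj1 n v D) \<partial>LM n) = (\<integral>\<^sup>+D. f D \<partial>LM n)"
proof -
  let ?A = "rank1 (- alp n v) v" and ?B = "rank1 (bet n v) v"
  let ?a = "ennreal ((cmod (detf n ?A))\<^sup>2)" and ?b = "ennreal ((cmod (detf n ?B))\<^sup>2)"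
  have "detf n ?A * detf n ?B = detf n (\<lambda>(i, j). \<Sum>k<n. ?A (i, k) * ?B (k, j))"
    by (rule detf_mult[symmetric])
  also have "\<dots> = 1"
    by (subst detf_one[of n, symmetric], rule detf_cong) (simp add: rank1_inverse[OF refl])
  finally have "cmod (detf n ?A) * cmod (detf n ?B) = 1"
    by (metis norm_mult norm_one)
  then have "?a * ?b = 1"
    by (simp add: ennreal_mult[symmetric] power_mult_distrib[symmetric])
  then have "(\<integral>\<^sup>+D. f (conj1 n v D) \<partial>LM n) = (?a * ?b) ^ n * (\<integral>\<^sup>+D. f (conj1 n v D) \<partial>LM n)" by simp
  also have "\<dots> = ?a ^ n * (?b ^ n * (\<integral>\<^sup>+D. f (colop n n ?A (rowop n ?B D)) \<partial>LM n))"
    by (simp add: conj1_def power_mult_distrib mult_ac)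
  also have "?b ^ n * (\<integral>\<^sup>+D. f (colop n n ?A (rowop n ?B D)) \<partial>LM n) = (\<integral>\<^sup>+D. f (colop n n ?A D) \<partial>LM n)"
    by (rule nn_integral_rowop, erule detf_rank1_nz, measurable)
  also have "?a ^ n * \<dots> = (\<integral>\<^sup>+D. f D \<partial>LM n)"
    by (rule nn_integral_colop, erule detf_rank1_nz, measurable)
  finally show ?thesis .
qed

text \<open>The matrix with eigenvalue \<open>l\<close>, eigenvector \<open>(v, 1)\<close>, last row \<open>(b, _)\<close> and compression \<open>D - v b\<close>.\<close>
definition Gmk :: "nat \<Rightarrow> complex \<Rightarrow> (nat \<Rightarrow> complex) \<Rightarrow> (nat \<Rightarrow> complex) \<Rightarrow> (nat \<times> nat \<Rightarrow> complex) \<Rightarrow> nat \<times> nat \<Rightarrow> complex" where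
  "Gmk n l v b D = asm n D b (mvf n (lam l D) v) (l - (\<Sum>j<n. b j * v j))"

lemma measurable_Gmk [measurable (raw)]:
  assumes [measurable]: "D \<in> measurable N (LM n)" "l \<in> borel_measurable N" "b \<in> measurable N (LV n)" "v \<in> measurable N (LV n)"
  shows "(\<lambda>p. Gmk n (l p) (v p) (b p) (D p)) \<in> measurable N (LM (Suc n))"
  unfolding Gmk_def by measurable

lemma chi_Gmk: "chi (Suc n) (Gmk n l v b D) z = (z - l) * chi n (deflate D b v) z"
  unfolding Gmk_def by (rule chi_deflate) (auto simp: mvf_apply lam_sum)

lemma frob_Gmk:
  assumes D: "\<And>i j. i < n \<Longrightarrow> j < n \<Longrightarrow> deflate D b v (i, j) = D' (i, j)"
  shows "frob (Suc n) (Gmk n l v b D) = (cmod l)\<^sup>2 + frob n (conj1 n v D')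
    + (1 + nsq n v) * (\<Sum>j<n. (cmod (\<Sum>k<n. (((\<Sum>i<n. cnj (v i) * D' (i, k)) - l * cnj (v k)) / of_real (1 + nsq n v) + b k)
        * rank1 (bet n v) v (k, j)))\<^sup>2)"
proof -
  have "frob n (\<lambda>(i, j). \<Sum>k<n. rank1 (- alp n v) v (i, k) * (\<Sum>m<n. deflate D b v (k, m) * rank1 (bet n v) v (m, j)))
     = frob n (conj1 n v D')"
    unfolding frob_def by (intro sum.cong refl) (auto simp: conj1_apply D)
  moreover have "(\<Sum>j<n. (cmod (\<Sum>k<n. (((\<Sum>i<n. cnj (v i) * deflate D b v (i, k)) - l * cnj (v k)) / of_real (1 + nsq n v) + b k)
        * rank1 (bet n v) v (k, j)))\<^sup>2) = (\<Sum>j<n. (cmod (\<Sum>k<n. (((\<Sum>i<n. cnj (v i) * D' (i, k)) - l * cnj (v k)) / of_real (1 + nsq n v) + b k)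
        * rank1 (bet n v) v (k, j)))\<^sup>2)"
    by (intro sum.cong refl arg_cong[where f="\<lambda>t. (cmod t)\<^sup>2"]) (auto simp: D)
  ultimately show ?thesis
    unfolding Gmk_def
    by (subst frob_deflate[OF refl]) (auto simp: mvf_apply lam_sum)
qed

definition fwt :: "complex set \<Rightarrow> nat \<Rightarrow> complex list \<Rightarrow> (nat \<times> nat \<Rightarrow> complex) \<Rightarrow> ennreal" where
  "fwt V n zs G = Psi V n zs G * ennreal (exp (- frob n G))"

lemma measurable_fwt [measurable]: "open V \<Longrightarrow> fwt V n zs \<in> borel_measurable (LM n)"
  unfolding fwt_def[abs_def] by measurable

text \<open>With \<open>l\<close>, \<open>v\<close> and \<open>b\<close> fixed, \<open>D\<close> is
  translated by \<open>v b\<close>, so that the compression becomes \<open>D\<close> itself. By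
  \<open>frob_Gmk\<close> the weight then splits: \<open>b\<close> sees a translated Gaussian, which
  integrates to \<open>K1 n v\<close>, and the compression is weighted through
  \<open>conj1 n v D\<close>, which preserves both \<open>chi\<close> and Lebesgue measure.\<close>

lemma eigenvector_slice:
  assumes V: "open V" and v[measurable]: "v \<in> space (LV n)"
  shows "qfun V zs l * ennreal (exp (- (cmod l)\<^sup>2)) * (K1 n v * hole_weight V n (l # zs))
    = (\<integral>\<^sup>+b. \<integral>\<^sup>+D. ennreal ((cmod (chi n (deflate D b v) l))\<^sup>2) * fwt V (Suc n) zs (Gmk n l v b D) \<partial>LM n \<partial>LV n)"
proof -
  note measurable_Psi[OF V, measurable] measurable_fwt[OF V, measurable]
  interpret LVs: sigma_finite_measure "LV n" by (rule sigma_finite_LB) simp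
  interpret LMs: sigma_finite_measure "LM n" by (rule sigma_finite_LB) simp
  let ?s = "1 + nsq n v"
  let ?q = "qfun V zs l * ennreal (exp (- (cmod l)\<^sup>2))"
  define inf where "inf D b = (\<lambda>ij\<in>{..<n} \<times> {..<n}. v (fst ij) * b (snd ij) + D ij)" for D b
  have defl: "deflate (inf D b) b v (i, j) = D (i, j)" if "i < n" "j < n" for D b i j
    using that by (simp add: inf_def deflate_def)
  \<comment> \<open>The shift \<open>e\<close> of \<open>frob_deflate\<close>; translation
    invariance in \<open>b\<close> removes it.\<close>
  define sh where "sh D k = ((\<Sum>i<n. cnj (v i) * D (i, k)) - l * cnj (v k)) / of_real ?s" for D k
  define g where "g x = exp (- (?s * (\<Sum>j<n. (cmod (\<Sum>k<n. x k * rank1 (bet n v) v (k, j)))\<^sup>2)))" for x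
  have [measurable]: "(\<lambda>p. g (x p)) \<in> borel_measurable N" if [measurable]: "x \<in> measurable N (LV n)" for x N
    unfolding g_def by measurable
  define Q where "Q D b = ennreal ((cmod (chi n (deflate D b v) l))\<^sup>2) * fwt V (Suc n) zs (Gmk n l v b D)" for D b
  have Qm[measurable]: "(\<lambda>p. Q (D p) (b p)) \<in> borel_measurable N" if [measurable]: "D \<in> measurable N (LM n)" "b \<in> measurable N (LV n)" for D b and N :: "'z measure"
    unfolding Q_def chi_defl[symmetric] by measurable
  have Q: "Q (inf D b) b = ?q * (Psi V n (l # zs) D * ennreal (exp (- frob n (conj1 n v D))) * ennreal (g (\<lambda>k\<in>{..<n}. sh D k + b k)))" for D b
  proof -
    have chi: "chi n (deflate (inf D b) b v) z = chi n D z" for z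
      by (rule chi_cong) (simp add: defl)
    have "ennreal ((cmod (chi n D l))\<^sup>2) * Psi V (Suc n) zs (Gmk n l v b (inf D b)) = qfun V zs l * Psi V n (l # zs) D"
      by (rule Psi_Suc) (simp add: chi_Gmk chi)
    moreover have "exp (- frob (Suc n) (Gmk n l v b (inf D b))) = exp (- (cmod l)\<^sup>2) * (exp (- frob n (conj1 n v D)) * g (\<lambda>k\<in>{..<n}. sh D k + b k))"
    proof -
      have "(\<Sum>k<n. (\<lambda>k\<in>{..<n}. sh D k + b k) k * rank1 (bet n v) v (k, j)) = (\<Sum>k<n. (sh D k + b k) * rank1 (bet n v) v (k, j))" for j
        by (intro sum.cong) auto
      moreover have "frob (Suc n) (Gmk n l v b (inf D b)) = (cmod l)\<^sup>2 + frob n (conj1 n v D)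
          + ?s * (\<Sum>j<n. (cmod (\<Sum>k<n. (sh D k + b k) * rank1 (bet n v) v (k, j)))\<^sup>2)"
        unfolding sh_def by (rule frob_Gmk) (rule defl)
      ultimately show ?thesis
        by (simp add: g_def exp_add[symmetric])
    qed
    moreover have "Q (inf D b) b = ennreal ((cmod (chi n D l))\<^sup>2) * Psi V (Suc n) zs (Gmk n l v b (inf D b)) * ennreal (exp (- frob (Suc n) (Gmk n l v b (inf D b))))"
      unfolding Q_def fwt_def chi by (simp only: mult.assoc)
    ultimately have "Q (inf D b) b = qfun V zs l * Psi V n (l # zs) D * ennreal (exp (- (cmod l)\<^sup>2) * (exp (- frob n (conj1 n v D)) * g (\<lambda>k\<in>{..<n}. sh D k + b k)))"
      by (simp only:)
    moreover have "g x \<ge> 0" for x by (simp add: g_def)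
    ultimately show ?thesis
      by (simp add: ennreal_mult mult_ac)
  qed
  have [measurable]: "(\<lambda>p. inf (D p) (b p)) \<in> measurable N (LM n)"
    if "D \<in> measurable N (LM n)" "b \<in> measurable N (LV n)" for D b and N :: "'z measure"
    unfolding inf_def using measurable_LB_component[OF that(1)] measurable_LB_component[OF that(2)]
    by (intro measurable_LB_restrict) auto
  have "(\<integral>\<^sup>+b. \<integral>\<^sup>+D. Q D b \<partial>LM n \<partial>LV n) = (\<integral>\<^sup>+b. \<integral>\<^sup>+D. Q (inf D b) b \<partial>LM n \<partial>LV n)"
  proof (rule nn_integral_cong)
    fix b assume [measurable]: "b \<in> space (LV n)"
    show "(\<integral>\<^sup>+D. Q D b \<partial>LM n) = (\<integral>\<^sup>+D. Q (inf D b) b \<partial>LM n)"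
      unfolding inf_def by (rule nn_integral_LB_translate[symmetric]) auto
  qed
  also have "\<dots> = (\<integral>\<^sup>+D. \<integral>\<^sup>+b. Q (inf D b) b \<partial>LV n \<partial>LM n)"
    by (rule nn_integral_swap) (auto intro: sigma_finite_LB simp: case_prod_beta')
  also have "\<dots> = (\<integral>\<^sup>+D. ?q * K1 n v * (Psi V n (l # zs) D * ennreal (exp (- frob n (conj1 n v D)))) \<partial>LM n)"
  proof (rule nn_integral_cong)
    fix D assume [measurable]: "D \<in> space (LM n)"
    have "(\<integral>\<^sup>+b. Q (inf D b) b \<partial>LV n)
       = ?q * (Psi V n (l # zs) D * ennreal (exp (- frob n (conj1 n v D)))) * (\<integral>\<^sup>+b. ennreal (g (\<lambda>k\<in>{..<n}. sh D k + b k)) \<partial>LV n)"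
      unfolding Q by (subst nn_integral_cmult[symmetric]) (auto simp: mult_ac intro!: nn_integral_cong)
    also have "(\<integral>\<^sup>+b. ennreal (g (\<lambda>k\<in>{..<n}. sh D k + b k)) \<partial>LV n) = K1 n v"
      unfolding K1_def g_def[symmetric] by (rule nn_integral_LB_translate) auto
    finally show "(\<integral>\<^sup>+b. Q (inf D b) b \<partial>LV n) = ?q * K1 n v * (Psi V n (l # zs) D * ennreal (exp (- frob n (conj1 n v D))))"
      by (simp add: mult_ac)
  qed
  also have "\<dots> = ?q * K1 n v * (\<integral>\<^sup>+D. Psi V n (l # zs) D * ennreal (exp (- frob n (conj1 n v D))) \<partial>LM n)"
    unfolding conj1_def by (rule nn_integral_cmult) measurable
  also have "(\<integral>\<^sup>+D. Psi V n (l # zs) D * ennreal (exp (- frob n (conj1 n v D))) \<partial>LM n) = hole_weight V n (l # zs)"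
  proof -
    have "Psi V n (l # zs) D = Psi V n (l # zs) (conj1 n v D)" for D
      unfolding Psi_def chi_conj1 ..
    then show ?thesis
      unfolding hole_weight_def using nn_integral_conj1[of "\<lambda>D. Psi V n (l # zs) D * ennreal (exp (- frob n D))" n v] by simp
  qed
  finally show ?thesis unfolding Q_def by (simp add: mult_ac)
qed

lemma countable_imp_AE_lborel:
  fixes N :: "complex set"
  assumes "countable N"
  shows "AE z in lborel. z \<notin> N"
  using assms by (intro AE_not_in countable_imp_null_set_lborel)

text \<open>Supplies the nonvanishing leading minors of \<open>lam l D\<close> that the elimination
  in \<open>nn_integral_LV_linear\<close> asks for.\<close>

lemma AE_leading_minors: "AE l in lborel. \<forall>k\<le>n. chi k D l \<noteq> 0"
proof -
  have "countable (\<Union>k\<le>n. {l. chi k D l = 0})"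
    by (intro countable_UN countable_finite chi_roots) auto
  from countable_imp_AE_lborel[OF this] show ?thesis by eventually_elim auto
qed

text \<open>The change of variables from \<open>(\<lambda>, v)\<close> to the last column \<open>(c, a)\<close>, for fixed \<open>D\<close> and \<open>b\<close>: first the
  linear map \<open>v \<mapsto> c = (\<lambda> - D) v\<close>, then the rational map \<open>\<lambda> \<mapsto> a\<close> of one variable.\<close>
lemma last_column_bounds:
  assumes f[measurable]: "f \<in> borel_measurable (LM (Suc n))"
    and D[measurable]: "D \<in> space (LM n)" and b[measurable]: "b \<in> space (LV n)"
  defines "X \<equiv> \<integral>\<^sup>+l. \<integral>\<^sup>+v. ennreal ((cmod (chi n (deflate D b v) l))\<^sup>2) * f (Gmk n l v b D) \<partial>LV n \<partial>lborel"
    and "Y \<equiv> \<integral>\<^sup>+c. \<integral>\<^sup>+a. f (asm n D b c a) \<partial>lborel \<partial>LV n"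
  shows "Y \<le> X" "X \<le> of_nat (Suc n) * Y"
proof -
  interpret LVs: sigma_finite_measure "LV n" by (rule sigma_finite_LB) simp
  define der where "der l c = chi n (deflate D b (resolvent n D l c)) l / chi n D l" for l c
  define Z where "Z l c = ennreal ((cmod (der l c))\<^sup>2) * f (asm n D b c (hfun n D b c l))" for l c
  have [measurable]: "(\<lambda>p. Z (l p) (c p)) \<in> borel_measurable N" if [measurable]: "l \<in> borel_measurable N" "c \<in> measurable N (LV n)" for l c and N :: "'z measure"
    unfolding Z_def der_def chi_defl[symmetric] by measurable
  have "X = (\<integral>\<^sup>+l. \<integral>\<^sup>+c. Z l c \<partial>LV n \<partial>lborel)"
    unfolding X_def
  proof (rule nn_integral_cong_AE, use AE_leading_minors[of n D] in eventually_elim)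
    fix l assume l: "\<forall>k\<le>n. chi k D l \<noteq> 0"
    define d where "d = ennreal ((cmod (chi n D l))\<^sup>2)"
    have nz: "chi n D l \<noteq> 0" using l by auto
    have [measurable]: "(\<lambda>v. Z l (mvf n (lam l D) v)) \<in> borel_measurable (LV n)" by measurable
    \<comment> \<open>The Jacobian \<open>|chi n (deflate D b v) l|^2\<close> is split into
      \<open>|chi n D l|^2\<close>, that of the linear map from \<open>v\<close> to
      \<open>c\<close>, and the squared modulus of the derivative of \<open>hfun\<close> at
      \<open>l\<close>.\<close>
    have "ennreal ((cmod (chi n (deflate D b v) l))\<^sup>2) * f (Gmk n l v b D) = d * Z l (mvf n (lam l D) v)" for v
    proof -
      let ?c = "mvf n (lam l D) v"
      have res: "resolvent n D l ?c j = v j" if "j < n" for j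
        unfolding resolvent_def using nz that by (intro mvf_invf_left) (auto simp: chi_def)
      have "chi n (deflate D b (resolvent n D l ?c)) l = chi n (deflate D b v) l"
        by (rule chi_cong) (simp add: deflate_def res)
      moreover have "hfun n D b ?c l = l - (\<Sum>j<n. b j * v j)"
        by (simp add: hfun_def res)
      ultimately have "d * Z l ?c = d * ennreal ((cmod (chi n (deflate D b v) l / chi n D l))\<^sup>2) * f (Gmk n l v b D)"
        by (simp add: Z_def der_def Gmk_def mult.assoc)
      also have "d * ennreal ((cmod (chi n (deflate D b v) l / chi n D l))\<^sup>2) = ennreal ((cmod (chi n (deflate D b v) l))\<^sup>2)"
        unfolding d_def using nz by (subst ennreal_mult[symmetric]) (auto simp: norm_divide power_divide)
      finally show ?thesis ..
    qed
    then have "(\<integral>\<^sup>+v. ennreal ((cmod (chi n (deflate D b v) l))\<^sup>2) * f (Gmk n l v b D) \<partial>LV n) = d * (\<integral>\<^sup>+v. Z l (mvf n (lam l D) v) \<partial>LV n)"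
      by (simp add: nn_integral_cmult)
    also have "\<dots> = (\<integral>\<^sup>+c. Z l c \<partial>LV n)"
      unfolding d_def chi_def by (rule nn_integral_LV_linear) (use l in \<open>auto simp: chi_def\<close>)
    finally show "(\<integral>\<^sup>+v. ennreal ((cmod (chi n (deflate D b v) l))\<^sup>2) * f (Gmk n l v b D) \<partial>LV n) = (\<integral>\<^sup>+c. Z l c \<partial>LV n)" .
  qed
  also have "\<dots> = (\<integral>\<^sup>+c. \<integral>\<^sup>+l. Z l c \<partial>lborel \<partial>LV n)"
    by (rule nn_integral_swap) (auto intro: sigma_finite_LB sigma_finite_lborel simp: case_prod_beta')
  finally have X: "X = (\<integral>\<^sup>+c. \<integral>\<^sup>+l. Z l c \<partial>lborel \<partial>LV n)" .
  have area: "(\<integral>\<^sup>+a. f (asm n D b c a) \<partial>lborel) \<le> (\<integral>\<^sup>+l. Z l c \<partial>lborel) \<and>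
      (\<integral>\<^sup>+l. Z l c \<partial>lborel) \<le> of_nat (Suc n) * (\<integral>\<^sup>+a. f (asm n D b c a) \<partial>lborel)"
    if [measurable]: "c \<in> space (LV n)" for c
  proof -
    \<comment> \<open>The plane without the spectrum of \<open>D\<close>: open and connected, being
      the complement of a finite set, and \<open>hfun\<close> is holomorphic on it.\<close>
    define \<Omega> where "\<Omega> = {z. chi n D z \<noteq> 0}"
    have fin: "finite (- \<Omega>)" unfolding \<Omega>_def using chi_roots[of n D] by (simp add: Collect_neg_eq[symmetric])
    have op: "open \<Omega>" using finite_imp_closed[OF fin] by (simp add: closed_def)
    have "connected (UNIV - (- \<Omega>))" by (rule connected_open_delete_finite) (use fin in auto)
    then have conn: "connected \<Omega>" by (simp add: Compl_eq_Diff_UNIV[symmetric])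
    have der: "(hfun n D b c has_field_derivative der l c) (at l)" if "l \<in> \<Omega>" for l
      unfolding der_def using that by (intro hfun_has_derivative) (auto simp: \<Omega>_def)
    have hol: "hfun n D b c holomorphic_on \<Omega>"
      using der op by (auto simp: holomorphic_on_open)
    have fib: "finite {z\<in>\<Omega>. hfun n D b c z = a} \<and> card {z\<in>\<Omega>. hfun n D b c z = a} \<le> Suc n" for a
    proof -
      have sub: "{z\<in>\<Omega>. hfun n D b c z = a} \<subseteq> {z. chi (Suc n) (asm n D b c a) z = 0}"
        using hfun_fibre_subset[of n D b c a] by (simp add: \<Omega>_def)
      then show ?thesis
        using chi_roots[of "Suc n" "asm n D b c a"] by (meson card_mono finite_subset le_trans)
    qed
    have gm: "(\<lambda>a. f (asm n D b c a)) \<in> borel_measurable borel" by measurable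
    have N: "countable (- (hfun n D b c ` \<Omega>))"
      unfolding \<Omega>_def by (intro countable_finite hfun_almost_surjective)
    have "(\<integral>\<^sup>+l. Z l c \<partial>lborel) = (\<integral>\<^sup>+z. indicator \<Omega> z * ennreal ((cmod (deriv (hfun n D b c) z))\<^sup>2) * f (asm n D b c (hfun n D b c z)) \<partial>lborel)"
    proof (rule nn_integral_cong_AE)
      have "AE z in lborel. z \<notin> - \<Omega>" using fin by (intro countable_imp_AE_lborel countable_finite)
      then show "AE z in lborel. Z z c = indicator \<Omega> z * ennreal ((cmod (deriv (hfun n D b c) z))\<^sup>2) * f (asm n D b c (hfun n D b c z))"
        by eventually_elim (simp add: Z_def DERIV_imp_deriv[OF der])
    qed
    then show ?thesis
      using area_formula[OF op conn hol gm fib N] by simp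
  qed
  show "Y \<le> X" unfolding X Y_def by (rule nn_integral_mono) (use area in blast)
  have "X \<le> (\<integral>\<^sup>+c. of_nat (Suc n) * (\<integral>\<^sup>+a. f (asm n D b c a) \<partial>lborel) \<partial>LV n)"
    unfolding X by (rule nn_integral_mono) (use area in blast)
  also have "\<dots> = of_nat (Suc n) * Y"
    unfolding Y_def
    by (intro nn_integral_cmult sigma_finite_measure.borel_measurable_nn_integral sigma_finite_lborel) (simp add: case_prod_beta')
  finally show "X \<le> of_nat (Suc n) * Y" .
qed

definition Kc :: "nat \<Rightarrow> ennreal" where
  "Kc n = (\<integral>\<^sup>+v. K1 n v \<partial>LV n)"

definition eigenvalue_int :: "complex set \<Rightarrow> nat \<Rightarrow> complex list \<Rightarrow> ennreal" where
  "eigenvalue_int V n zs = (\<integral>\<^sup>+l. qfun V zs l * ennreal (exp (- (cmod l)\<^sup>2)) * hole_weight V n (l # zs) \<partial>lborel)"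

lemma measurable_hole_weight_Cons:
  assumes V: "open V"
  shows "(\<lambda>l. hole_weight V n (l # zs)) \<in> borel_measurable borel"
proof -
  interpret LMs: sigma_finite_measure "LM n" by (rule sigma_finite_LB) simp
  note measurable_Psi[OF V, measurable]
  have "Psi V n (l # zs) G = ennreal ((cmod (chi n G l))\<^sup>2) * Psi V n zs G" for l G
    by (simp add: Psi_def)
  then show ?thesis
    unfolding hole_weight_def by (intro LMs.borel_measurable_nn_integral) (simp add: case_prod_beta')
qed

text \<open>Both sides are integrals over \<open>l\<close>, \<open>v\<close>, \<open>b\<close> and
  \<open>D\<close>. With \<open>b\<close> and \<open>D\<close> innermost,
  \<open>eigenvector_slice\<close> applies; with \<open>l\<close> and \<open>v\<close> innermost,
  \<open>last_column_bounds\<close> compares with the original matrix, which is counted once per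
  eigenvalue. Everything between is Tonelli's theorem.\<close>

theorem one_step:
  assumes V: "open V"
  shows "hole_weight V (Suc n) zs \<le> Kc n * eigenvalue_int V n zs" "Kc n * eigenvalue_int V n zs \<le> of_nat (Suc n) * hole_weight V (Suc n) zs"
proof -
  note measurable_Psi[OF V, measurable] measurable_fwt[OF V, measurable] measurable_qfun[OF V, measurable] measurable_hole_weight_Cons[OF V, measurable]
  interpret LVs: sigma_finite_measure "LV n" by (rule sigma_finite_LB) simp
  interpret LMs: sigma_finite_measure "LM n" by (rule sigma_finite_LB) simp
  define Q where "Q l v b D = ennreal ((cmod (chi n (deflate D b v) l))\<^sup>2) * fwt V (Suc n) zs (Gmk n l v b D)" for l v b D
  have Qm[measurable]: "(\<lambda>p. Q (l p) (v p) (b p) (D p)) \<in> borel_measurable N"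
    if [measurable]: "l \<in> borel_measurable N" "v \<in> measurable N (LV n)" "D \<in> measurable N (LM n)" "b \<in> measurable N (LV n)" for l v D b and N :: "'z measure"
    unfolding Q_def chi_defl[symmetric] by measurable
  have "Kc n * eigenvalue_int V n zs = (\<integral>\<^sup>+l. Kc n * (qfun V zs l * ennreal (exp (- (cmod l)\<^sup>2)) * hole_weight V n (l # zs)) \<partial>lborel)"
    unfolding eigenvalue_int_def by (rule nn_integral_cmult[symmetric]) measurable
  also have "\<dots> = (\<integral>\<^sup>+l. \<integral>\<^sup>+v. \<integral>\<^sup>+b. \<integral>\<^sup>+D. Q l v b D \<partial>LM n \<partial>LV n \<partial>LV n \<partial>lborel)"
  proof (rule nn_integral_cong)
    fix l :: complex
    have "Kc n * (qfun V zs l * ennreal (exp (- (cmod l)\<^sup>2)) * hole_weight V n (l # zs))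
      = (\<integral>\<^sup>+v. qfun V zs l * ennreal (exp (- (cmod l)\<^sup>2)) * hole_weight V n (l # zs) * K1 n v \<partial>LV n)"
      unfolding Kc_def by (subst nn_integral_cmult) (auto simp: mult_ac)
    also have "\<dots> = (\<integral>\<^sup>+v. \<integral>\<^sup>+b. \<integral>\<^sup>+D. Q l v b D \<partial>LM n \<partial>LV n \<partial>LV n)"
    proof (rule nn_integral_cong)
      fix v assume v: "v \<in> space (LV n)"
      show "qfun V zs l * ennreal (exp (- (cmod l)\<^sup>2)) * hole_weight V n (l # zs) * K1 n v = (\<integral>\<^sup>+b. \<integral>\<^sup>+D. Q l v b D \<partial>LM n \<partial>LV n)"
        unfolding Q_def eigenvector_slice[OF V v, symmetric] by (simp only: mult_ac)
    qed
    finally show "Kc n * (qfun V zs l * ennreal (exp (- (cmod l)\<^sup>2)) * hole_weight V n (l # zs))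
      = (\<integral>\<^sup>+v. \<integral>\<^sup>+b. \<integral>\<^sup>+D. Q l v b D \<partial>LM n \<partial>LV n \<partial>LV n)" .
  qed
  also have "\<dots> = (\<integral>\<^sup>+l. \<integral>\<^sup>+b. \<integral>\<^sup>+v. \<integral>\<^sup>+D. Q l v b D \<partial>LM n \<partial>LV n \<partial>LV n \<partial>lborel)"
    by (intro nn_integral_cong nn_integral_swap) (auto intro!: sigma_finite_LB LMs.borel_measurable_nn_integral simp: case_prod_beta')
  also have "\<dots> = (\<integral>\<^sup>+l. \<integral>\<^sup>+b. \<integral>\<^sup>+D. \<integral>\<^sup>+v. Q l v b D \<partial>LV n \<partial>LM n \<partial>LV n \<partial>lborel)"
    by (intro nn_integral_cong nn_integral_swap) (auto intro!: sigma_finite_LB simp: case_prod_beta')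
  also have "\<dots> = (\<integral>\<^sup>+b. \<integral>\<^sup>+l. \<integral>\<^sup>+D. \<integral>\<^sup>+v. Q l v b D \<partial>LV n \<partial>LM n \<partial>lborel \<partial>LV n)"
    by (intro nn_integral_swap) (auto intro!: sigma_finite_LB sigma_finite_lborel LMs.borel_measurable_nn_integral LVs.borel_measurable_nn_integral simp: case_prod_beta')
  also have "\<dots> = (\<integral>\<^sup>+b. \<integral>\<^sup>+D. \<integral>\<^sup>+l. \<integral>\<^sup>+v. Q l v b D \<partial>LV n \<partial>lborel \<partial>LM n \<partial>LV n)"
    by (intro nn_integral_cong nn_integral_swap) (auto intro!: sigma_finite_LB sigma_finite_lborel LVs.borel_measurable_nn_integral simp: case_prod_beta')
  also have "\<dots> = (\<integral>\<^sup>+D. \<integral>\<^sup>+b. \<integral>\<^sup>+l. \<integral>\<^sup>+v. Q l v b D \<partial>LV n \<partial>lborel \<partial>LV n \<partial>LM n)"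
    by (intro nn_integral_swap) (auto intro!: sigma_finite_LB lborel.borel_measurable_nn_integral LVs.borel_measurable_nn_integral simp: case_prod_beta')
  finally have R: "Kc n * eigenvalue_int V n zs = (\<integral>\<^sup>+D. \<integral>\<^sup>+b. \<integral>\<^sup>+l. \<integral>\<^sup>+v. Q l v b D \<partial>LV n \<partial>lborel \<partial>LV n \<partial>LM n)" .
  have E: "hole_weight V (Suc n) zs = (\<integral>\<^sup>+D. \<integral>\<^sup>+b. \<integral>\<^sup>+c. \<integral>\<^sup>+a. fwt V (Suc n) zs (asm n D b c a) \<partial>lborel \<partial>LV n \<partial>LV n \<partial>LM n)"
    unfolding hole_weight_def fwt_def[symmetric] by (rule nn_integral_asm) measurable
  show "hole_weight V (Suc n) zs \<le> Kc n * eigenvalue_int V n zs"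
    unfolding R E Q_def by (intro nn_integral_mono last_column_bounds(1)) measurable
  have "Kc n * eigenvalue_int V n zs \<le> (\<integral>\<^sup>+D. \<integral>\<^sup>+b. of_nat (Suc n) * (\<integral>\<^sup>+c. \<integral>\<^sup>+a. fwt V (Suc n) zs (asm n D b c a) \<partial>lborel \<partial>LV n) \<partial>LV n \<partial>LM n)"
    unfolding R Q_def by (intro nn_integral_mono last_column_bounds(2)) measurable
  also have "\<dots> = (\<integral>\<^sup>+D. of_nat (Suc n) * (\<integral>\<^sup>+b. \<integral>\<^sup>+c. \<integral>\<^sup>+a. fwt V (Suc n) zs (asm n D b c a) \<partial>lborel \<partial>LV n \<partial>LV n) \<partial>LM n)"
    by (intro nn_integral_cong nn_integral_cmult LVs.borel_measurable_nn_integral) (auto intro!: lborel.borel_measurable_nn_integral LVs.borel_measurable_nn_integral simp: case_prod_beta')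
  also have "\<dots> = of_nat (Suc n) * hole_weight V (Suc n) zs"
    unfolding E
    by (intro nn_integral_cmult) (auto intro!: lborel.borel_measurable_nn_integral LVs.borel_measurable_nn_integral simp: case_prod_beta')
  finally show "Kc n * eigenvalue_int V n zs \<le> of_nat (Suc n) * hole_weight V (Suc n) zs" .
qed

section \<open>The joint density of the eigenvalues\<close>

lemma nn_integral_exp_tail: "(\<integral>\<^sup>+u. ennreal (exp (- u)) * indicator {a..} u \<partial>lborel) = ennreal (exp (- a))"
proof -
  have "((\<lambda>u. - exp (- u)) \<longlongrightarrow> 0) (at_top :: real filter)" by real_asymp
  then have "(\<integral>\<^sup>+u. ennreal (exp (- u)) * indicator {a..} u \<partial>lborel) = ennreal (0 - - exp (- a))"
    by (intro nn_integral_FTC_atLeast) (auto intro!: derivative_eq_intros)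
  then show ?thesis by simp
qed

lemma emeasure_disc:
  "r \<ge> 0 \<Longrightarrow> emeasure lborel (cball (c::complex) r) = ennreal (pi * r\<^sup>2)"
  "r \<ge> 0 \<Longrightarrow> emeasure lborel (ball (c::complex) r) = ennreal (pi * r\<^sup>2)"
  by (simp_all add: emeasure_cball emeasure_ball unit_ball_vol_2)

text \<open>The layer cake formula: \<open>exp (- |z|^2)\<close> is the integral of
  \<open>exp (- u)\<close> over \<open>u >= |z|^2\<close>, and for fixed \<open>u\<close> the points
  \<open>z\<close> fill a disc of area \<open>pi * u\<close>.\<close>

lemma nn_integral_gaussian: "(\<integral>\<^sup>+z. ennreal (exp (- (cmod z)\<^sup>2)) \<partial>lborel) = ennreal pi"
proof -
  have "(\<integral>\<^sup>+z. ennreal (exp (- (cmod z)\<^sup>2)) \<partial>lborel)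
      = (\<integral>\<^sup>+z. \<integral>\<^sup>+u. ennreal (exp (- u)) * indicator {(cmod z)\<^sup>2..} u \<partial>lborel \<partial>lborel)"
    by (simp add: nn_integral_exp_tail)
  also have "\<dots> = (\<integral>\<^sup>+u. \<integral>\<^sup>+z. ennreal (exp (- u)) * indicator {(cmod z)\<^sup>2..} u \<partial>lborel \<partial>lborel)"
    by (rule nn_integral_swap) (auto intro: sigma_finite_lborel simp: case_prod_beta' indicator_def)
  also have "\<dots> = (\<integral>\<^sup>+u. ennreal pi * (ennreal (u * exp (- u)) * indicator {0..} u) \<partial>lborel)"
  proof (rule nn_integral_cong)
    fix u :: real
    show "(\<integral>\<^sup>+z. ennreal (exp (- u)) * indicator {(cmod z)\<^sup>2..} u \<partial>lborel) = ennreal pi * (ennreal (u * exp (- u)) * indicator {0..} u)"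
    proof (cases "u \<ge> 0")
      case True
      have "(cmod z)\<^sup>2 \<le> u \<longleftrightarrow> cmod z \<le> sqrt u" for z
        using True by (metis norm_ge_zero power2_le_iff_abs_le real_le_rsqrt real_sqrt_ge_zero real_sqrt_le_mono real_sqrt_pow2 abs_of_nonneg power_mono)
      then have "(\<integral>\<^sup>+z. ennreal (exp (- u)) * indicator {(cmod z)\<^sup>2..} u \<partial>lborel) = (\<integral>\<^sup>+z. ennreal (exp (- u)) * indicator (cball (0::complex) (sqrt u)) z \<partial>lborel)"
        by (intro nn_integral_cong) (auto simp: indicator_def)
      also have "\<dots> = ennreal (exp (- u)) * ennreal (pi * u)"
        by (subst nn_integral_cmult) (auto simp: emeasure_disc True intro!: borel_measurable_indicator borel_closed)
      finally show ?thesis using True by (simp add: ennreal_mult[symmetric] mult_ac)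
    next
      case False
      then have "\<not> (cmod z)\<^sup>2 \<le> u" for z using order_trans[of 0 "(cmod z)\<^sup>2" u] by auto
      then show ?thesis using False by (simp add: indicator_def)
    qed
  qed
  also have "\<dots> = ennreal pi * (\<integral>\<^sup>+u. ennreal (u * exp (- u)) * indicator {0..} u \<partial>lborel)"
    by (rule nn_integral_cmult) simp
  also have "(\<integral>\<^sup>+u. ennreal (u * exp (- u)) * indicator {0..} u \<partial>lborel) = ennreal (0 - (- (0 + 1) * exp (- 0)))"
  proof (rule nn_integral_FTC_atLeast)
    show "((\<lambda>u. - (u + 1) * exp (- u)) \<longlongrightarrow> 0) (at_top :: real filter)" by real_asymp
    show "DERIV (\<lambda>u. - (u + 1) * exp (- u)) x :> x * exp (- x)" for x :: real
      by (auto intro!: derivative_eq_intros simp: algebra_simps)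
  qed auto
  finally show ?thesis by simp
qed

section \<open>The Vandermonde integral and its recursion\<close>

definition vandermonde_int :: "complex set \<Rightarrow> nat \<Rightarrow> complex list \<Rightarrow> ennreal" where
  "vandermonde_int V n zs = (\<integral>\<^sup>+z. (\<Prod>i<n. qfun V zs (z i) * ennreal (exp (- (cmod (z i))\<^sup>2))) * (\<Prod>i<n. \<Prod>j<i. ennreal ((cmod (z i - z j))\<^sup>2)) \<partial>LV n)"

lemma LV_components: "i < n \<Longrightarrow> (\<lambda>z. z i) \<in> borel_measurable (LV n)"
  using measurable_component_singleton[of i "{..<n}" "\<lambda>_. lborel"] by simp

lemma nn_integral_LB_empty:
  "emeasure (LB {}) (space (LB {})) = 1"
  by (simp add: space_PiM PiM_empty)

lemma qfun_Cons: "qfun V (l # zs) z = ennreal ((cmod (l - z))\<^sup>2) * qfun V zs z"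
  by (simp add: qfun_def)

text \<open>Peeling off the last point moves its interactions with the others into the list. The
  Vandermonde integral therefore satisfies with equality the recursion that \<open>one_step\<close>
  gives for \<open>hole_weight\<close> up to bounded factors.\<close>

lemma vandermonde_int_Suc:
  assumes V: "open V"
  shows "vandermonde_int V (Suc n) zs = (\<integral>\<^sup>+l. qfun V zs l * ennreal (exp (- (cmod l)\<^sup>2)) * vandermonde_int V n (l # zs) \<partial>lborel)"
    and "(\<lambda>l. vandermonde_int V n (l # zs)) \<in> borel_measurable borel"
proof -
  note measurable_qfun[OF V, measurable]
  interpret LVs: sigma_finite_measure "LV n" by (rule sigma_finite_LB) simp
  have comp: "(\<lambda>p. z p i) \<in> borel_measurable N" if "z \<in> measurable N (LV m)" "i < m" for N :: "'z measure" and z i and m :: nat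
    using measurable_LB_component[OF that(1)] that(2) by auto
  define F where "F m zs z = (\<Prod>i<m. qfun V zs (z i) * ennreal (exp (- (cmod (z i))\<^sup>2))) * (\<Prod>i<m. \<Prod>j<i. ennreal ((cmod (z i - z j))\<^sup>2))" for m :: nat and zs z
  have q: "(\<lambda>p. qfun V zs (z p)) \<in> borel_measurable N" if "z \<in> borel_measurable N" for z zs and N :: "'z measure"
    using measurable_compose[OF that measurable_qfun[OF V]] by simp
  have Fm: "F m zs \<in> borel_measurable (LV m)" for m zs
    unfolding F_def[abs_def]
    by (intro borel_measurable_times_ennreal borel_measurable_prod_ennreal q measurable_compose[OF _ measurable_ennreal]
        borel_measurable_power borel_measurable_norm borel_measurable_diff borel_measurable_exp borel_measurable_uminus LV_components)
       auto
  have F2: "(\<lambda>p. F n (fst p # zs) (snd p)) \<in> borel_measurable (borel \<Otimes>\<^sub>M LV n)"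
    unfolding F_def qfun_Cons
    by (intro borel_measurable_times_ennreal borel_measurable_prod_ennreal q measurable_compose[OF _ measurable_ennreal]
        borel_measurable_power borel_measurable_norm borel_measurable_diff borel_measurable_exp borel_measurable_uminus comp[OF measurable_snd])
       auto
  show "(\<lambda>l. vandermonde_int V n (l # zs)) \<in> borel_measurable borel"
    unfolding vandermonde_int_def F_def[symmetric]
    by (rule LVs.borel_measurable_nn_integral) (use F2 in \<open>simp add: case_prod_beta'\<close>)
  have "vandermonde_int V (Suc n) zs = (\<integral>\<^sup>+l. \<integral>\<^sup>+x. F (Suc n) zs (snoc n x l) \<partial>LV n \<partial>lborel)"
    unfolding vandermonde_int_def F_def[symmetric] by (rule nn_integral_LV_Suc') (rule Fm)
  also have "\<dots> = (\<integral>\<^sup>+l. qfun V zs l * ennreal (exp (- (cmod l)\<^sup>2)) * vandermonde_int V n (l # zs) \<partial>lborel)"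
  proof (rule nn_integral_cong)
    fix l :: complex
    have "F (Suc n) zs (snoc n x l) = qfun V zs l * ennreal (exp (- (cmod l)\<^sup>2)) * F n (l # zs) x" for x
    proof -
      have "(\<Prod>i<n. qfun V (l # zs) (x i) * ennreal (exp (- (cmod (x i))\<^sup>2)))
          = (\<Prod>j<n. ennreal ((cmod (l - x j))\<^sup>2)) * (\<Prod>i<n. qfun V zs (x i) * ennreal (exp (- (cmod (x i))\<^sup>2)))"
        by (simp add: qfun_Cons prod.distrib mult_ac)
      moreover have "snoc n x l i = x i" if "i < n" for i using that by (simp add: snoc_def)
      moreover have "snoc n x l n = l" by (simp add: snoc_def)
      ultimately show ?thesis
        by (simp add: F_def mult_ac)
    qed
    then show "(\<integral>\<^sup>+x. F (Suc n) zs (snoc n x l) \<partial>LV n) = qfun V zs l * ennreal (exp (- (cmod l)\<^sup>2)) * vandermonde_int V n (l # zs)"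
      unfolding vandermonde_int_def F_def[symmetric] by (simp add: nn_integral_cmult Fm)
  qed
  finally show "vandermonde_int V (Suc n) zs = (\<integral>\<^sup>+l. qfun V zs l * ennreal (exp (- (cmod l)\<^sup>2)) * vandermonde_int V n (l # zs) \<partial>lborel)" .
qed

lemma hole_weight_0: "hole_weight V 0 zs = 1"
proof -
  have "Psi V 0 zs G = 1" for G
  proof -
    have "(\<Prod>z\<leftarrow>zs. 1::ennreal) = 1" by (induction zs) auto
    then show ?thesis by (simp add: Psi_def chi_def detf_def)
  qed
  then show ?thesis by (simp add: hole_weight_def frob_def nn_integral_LB_empty)
qed

lemma vandermonde_int_0: "vandermonde_int V 0 zs = 1"
  by (simp add: vandermonde_int_def nn_integral_LB_empty)

definition KK :: "nat \<Rightarrow> ennreal" where "KK n = (\<Prod>k<n. Kc k)"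

text \<open>The induction leaves \<open>zs\<close> arbitrary, as the list grows with every step. The
  factors \<open>Suc n\<close> lost in \<open>one_step\<close> multiply up to \<open>fact n\<close>,
  and the constants \<open>Kc\<close> to \<open>KK n\<close>; neither depends on the hole.\<close>

theorem hole_weight_vandermonde_int:
  assumes V: "open V"
  shows "hole_weight V n zs \<le> KK n * vandermonde_int V n zs" "KK n * vandermonde_int V n zs \<le> of_nat (fact n) * hole_weight V n zs"
proof -
  have "hole_weight V n zs \<le> KK n * vandermonde_int V n zs \<and> KK n * vandermonde_int V n zs \<le> of_nat (fact n) * hole_weight V n zs"
  proof (induction n arbitrary: zs)
    case 0
    show ?case by (simp add: hole_weight_0 vandermonde_int_0 KK_def)
  next
    case (Suc n)
    note measurable_qfun[OF V, measurable] vandermonde_int_Suc(2)[OF V, measurable] measurable_hole_weight_Cons[OF V, measurable]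
    let ?q = "\<lambda>l. qfun V zs l * ennreal (exp (- (cmod l)\<^sup>2))"
    have W: "KK (Suc n) * vandermonde_int V (Suc n) zs = Kc n * (\<integral>\<^sup>+l. ?q l * (KK n * vandermonde_int V n (l # zs)) \<partial>lborel)"
    proof -
      have "(\<integral>\<^sup>+l. ?q l * (KK n * vandermonde_int V n (l # zs)) \<partial>lborel) = (\<integral>\<^sup>+l. KK n * (?q l * vandermonde_int V n (l # zs)) \<partial>lborel)"
        by (simp only: mult_ac)
      also have "\<dots> = KK n * vandermonde_int V (Suc n) zs"
        unfolding vandermonde_int_Suc(1)[OF V] by (rule nn_integral_cmult) (use V in measurable)
      finally show ?thesis by (simp add: KK_def mult_ac)
    qed
    have "hole_weight V (Suc n) zs \<le> Kc n * eigenvalue_int V n zs" by (rule one_step[OF V])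
    also have "\<dots> \<le> KK (Suc n) * vandermonde_int V (Suc n) zs"
      unfolding W eigenvalue_int_def using Suc.IH by (intro mult_left_mono nn_integral_mono) auto
    finally have 1: "hole_weight V (Suc n) zs \<le> KK (Suc n) * vandermonde_int V (Suc n) zs" .
    have "KK (Suc n) * vandermonde_int V (Suc n) zs \<le> Kc n * (\<integral>\<^sup>+l. ?q l * (of_nat (fact n) * hole_weight V n (l # zs)) \<partial>lborel)"
      unfolding W using Suc.IH by (intro mult_left_mono nn_integral_mono) auto
    also have "(\<integral>\<^sup>+l. ?q l * (of_nat (fact n) * hole_weight V n (l # zs)) \<partial>lborel) = (\<integral>\<^sup>+l. of_nat (fact n) * (?q l * hole_weight V n (l # zs)) \<partial>lborel)"
      by (simp only: mult_ac)
    also have "\<dots> = of_nat (fact n) * eigenvalue_int V n zs"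
      unfolding eigenvalue_int_def by (rule nn_integral_cmult) (use V in measurable)
    also have "Kc n * (of_nat (fact n) * eigenvalue_int V n zs) = of_nat (fact n) * (Kc n * eigenvalue_int V n zs)"
      by (simp only: mult_ac)
    also have "\<dots> \<le> of_nat (fact n) * (of_nat (Suc n) * hole_weight V (Suc n) zs)"
      by (intro mult_left_mono one_step[OF V]) auto
    finally have "KK (Suc n) * vandermonde_int V (Suc n) zs \<le> of_nat (fact n) * (of_nat (Suc n) * hole_weight V (Suc n) zs)" .
    also have "\<dots> = of_nat (fact (Suc n)) * hole_weight V (Suc n) zs"
      unfolding fact_Suc of_nat_mult of_nat_id by (simp only: mult_ac)
    finally show ?case using 1 by blast
  qed
  then show "hole_weight V n zs \<le> KK n * vandermonde_int V n zs" "KK n * vandermonde_int V n zs \<le> of_nat (fact n) * hole_weight V n zs" by auto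
qed

section \<open>From the hole probability to the partition function\<close>

lemma ginibre_density:
  "ginibre n = density (LM n) (\<lambda>G. ennreal ((1 / pi) ^ (n * n) * exp (- frob n G)))"
proof -
  have "ginibre n = density (LM n) (\<lambda>G. \<Prod>ij\<in>{..<n} \<times> {..<n}. ennreal (exp (- (cmod (G ij))\<^sup>2) / pi))"
    unfolding ginibre_def std_complex_gaussian_def atLeast0LessThan
    by (rule PiM_density) (auto intro: sigma_finite_lborel simp: sigma_finite_measure.sigma_finite_iff_density_finite[OF sigma_finite_lborel])
  also have "(\<lambda>G. \<Prod>ij\<in>{..<n} \<times> {..<n}. ennreal (exp (- (cmod (G ij))\<^sup>2) / pi)) = (\<lambda>G. ennreal ((1 / pi) ^ (n * n) * exp (- frob n G)))"
  proof
    fix G :: "nat \<times> nat \<Rightarrow> complex"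
    have "(\<Prod>ij\<in>{..<n} \<times> {..<n}. exp (- (cmod (G ij))\<^sup>2) / pi) = (1 / pi) ^ (n * n) * exp (- frob n G)"
      by (simp add: prod_dividef exp_sum[symmetric] frob_def sum.cartesian_product sum_negf power_divide)
    then show "(\<Prod>ij\<in>{..<n} \<times> {..<n}. ennreal (exp (- (cmod (G ij))\<^sup>2) / pi)) = ennreal ((1 / pi) ^ (n * n) * exp (- frob n G))"
      by (subst prod_ennreal) auto
  qed
  finally show ?thesis .
qed

lemma emeasure_ginibre_hole_weight:
  assumes V: "open V"
  shows "emeasure (ginibre n) {G \<in> space (ginibre n). \<forall>z\<in>V. \<not> eigenvalue (to_mat n G) z} = ennreal ((1 / pi) ^ (n * n)) * hole_weight V n []"
proof -
  note measurable_no_root[OF V, measurable]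
  have sp: "space (ginibre n) = space (LM n)" by (simp add: ginibre_density)
  have ev: "eigenvalue (to_mat n G) z \<longleftrightarrow> chi n G z = 0" for G z
  proof -
    have "to_mat n G = mat n n G" by (simp add: to_mat_def)
    then show ?thesis
      by (simp add: eigenvalue_root_char_poly[of _ n] chi_eq_char_poly)
  qed
  have "emeasure (ginibre n) {G \<in> space (LM n). \<forall>z\<in>V. chi n G z \<noteq> 0}
      = (\<integral>\<^sup>+G. ennreal ((1 / pi) ^ (n * n) * exp (- frob n G)) * indicator {G \<in> space (LM n). \<forall>z\<in>V. chi n G z \<noteq> 0} G \<partial>LM n)"
    unfolding ginibre_density by (rule emeasure_density) measurable
  also have "\<dots> = (\<integral>\<^sup>+G. ennreal ((1 / pi) ^ (n * n)) * (Psi V n [] G * ennreal (exp (- frob n G))) \<partial>LM n)"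
    by (intro nn_integral_cong) (auto simp: Psi_def indicator_def ennreal_mult)
  also have "\<dots> = ennreal ((1 / pi) ^ (n * n)) * hole_weight V n []"
    unfolding hole_weight_def by (rule nn_integral_cmult) (use V in measurable)
  finally show ?thesis unfolding sp ev .
qed

lemma hole_weight_empty: "hole_weight {} n [] = ennreal (pi ^ (n * n))"
proof -
  have "hole_weight {} n [] = (\<integral>\<^sup>+G. (\<Prod>ij\<in>{..<n} \<times> {..<n}. ennreal (exp (- (cmod (G ij))\<^sup>2))) \<partial>LM n)"
    unfolding hole_weight_def
    by (intro nn_integral_cong)
       (simp add: Psi_def prod_ennreal exp_sum[symmetric] frob_def sum.cartesian_product sum_negf)
  also have "\<dots> = (\<Prod>ij\<in>{..<n} \<times> {..<n}. ennreal pi)"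
    by (subst lborelC.product_nn_integral_prod) (auto simp: nn_integral_gaussian)
  also have "\<dots> = ennreal (pi ^ (n * n))"
    by (simp add: ennreal_power)
  finally show ?thesis .
qed

lemma hole_prob_hole_weight:
  assumes U: "open U" and n: "n > 0"
  defines "V \<equiv> (\<lambda>w. complex_of_real (sqrt (real n)) * w) ` U"
  shows "open V" "ennreal (pi ^ (n * n)) * ennreal (hole_prob n U) = hole_weight V n []"
proof -
  show V: "open V"
  proof -
    have "V = (*\<^sub>R) (sqrt (real n)) ` U" by (simp add: V_def scaleR_conv_of_real)
    then show ?thesis using open_scaling[OF _ U, of "sqrt (real n)"] n by simp
  qed
  have "emeasure (ginibre n) {G \<in> space (ginibre n). \<forall>z\<in>V. \<not> eigenvalue (to_mat n G) z} = ennreal ((1 / pi) ^ (n * n)) * hole_weight V n []"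
    by (rule emeasure_ginibre_hole_weight[OF V])
  \<comment> \<open>Finiteness is inherited from the empty hole, whose weight is a product of
    Gaussian integrals.\<close>
  moreover have "hole_weight V n [] \<le> hole_weight {} n []"
    unfolding hole_weight_def by (intro nn_integral_mono mult_right_mono) (auto simp: Psi_def)
  then have fin: "hole_weight V n [] < \<infinity>"
    unfolding hole_weight_empty by (rule order.strict_trans1) simp
  ultimately have "ennreal (hole_prob n U) = ennreal ((1 / pi) ^ (n * n)) * hole_weight V n []"
    unfolding hole_prob_def V_def[symmetric]
    by (subst emeasure_eq_ennreal_measure[symmetric]) (auto simp: ennreal_mult_eq_top_iff less_top)
  then have "ennreal (pi ^ (n * n)) * ennreal (hole_prob n U) = (ennreal (pi ^ (n * n)) * ennreal ((1 / pi) ^ (n * n))) * hole_weight V n []"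
    by (simp only: mult.assoc)
  also have "ennreal (pi ^ (n * n)) * ennreal ((1 / pi) ^ (n * n)) = 1"
    by (simp add: ennreal_mult[symmetric] power_mult_distrib[symmetric])
  finally show "ennreal (pi ^ (n * n)) * ennreal (hole_prob n U) = hole_weight V n []" by simp
qed

definition partition_fun :: "nat \<Rightarrow> complex set \<Rightarrow> ennreal" where
  "partition_fun n U = (\<integral>\<^sup>+w. (\<Prod>i<n. indicator (- U) (w i) * ennreal (exp (- (real n * (cmod (w i))\<^sup>2)))) * (\<Prod>i<n. \<Prod>j<i. ennreal ((cmod (w i - w j))\<^sup>2)) \<partial>LV n)"

text \<open>Scaling by \<open>sqrt n\<close> contributes \<open>n\<close> for each of the
  \<open>n\<close> coordinates as Jacobian, and another \<open>n\<close> for each of the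
  \<open>\<Sum>i<n. i\<close> pairs in the Vandermonde product. The constant is the same for every
  hole, so it cancels in the comparison.\<close>

lemma vandermonde_int_scale:
  assumes U: "open U" and n: "n > 0"
  shows "vandermonde_int ((\<lambda>w. complex_of_real (sqrt (real n)) * w) ` U) n [] = ennreal (real n ^ n * real n ^ (\<Sum>i<n. i)) * partition_fun n U"
proof -
  let ?c = "complex_of_real (sqrt (real n))" and ?V = "(\<lambda>w. complex_of_real (sqrt (real n)) * w) ` U"
  have V: "open ?V" by (rule hole_prob_hole_weight(1)[OF U n])
  define T :: "nat \<times> nat \<Rightarrow> complex" where "T = (\<lambda>(i, j). if i = j then ?c else 0)"
  have det: "detf k T = ?c ^ k" for k
    by (subst detf_upper) (auto simp: T_def)
  define F where "F z = (\<Prod>i<n. qfun ?V [] (z i) * ennreal (exp (- (cmod (z i))\<^sup>2))) * (\<Prod>i<n. \<Prod>j<i. ennreal ((cmod (z i - z j))\<^sup>2))" for z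
  have Fm: "F \<in> borel_measurable (LV n)"
    unfolding F_def[abs_def]
    by (intro borel_measurable_times_ennreal borel_measurable_prod_ennreal measurable_compose[OF _ measurable_qfun[OF V]] measurable_compose[OF _ measurable_ennreal]
        borel_measurable_power borel_measurable_norm borel_measurable_diff borel_measurable_exp borel_measurable_uminus LV_components)
       auto
  have Tw: "mvf n T w i = ?c * w i" if "i < n" for w i
    using that by (simp add: mvf_apply T_def if_distrib[of "\<lambda>t. t * _"] cong: if_cong)
  define H where "H w = (\<Prod>i<n. indicator (- U) (w i) * ennreal (exp (- (real n * (cmod (w i))\<^sup>2)))) * (\<Prod>i<n. \<Prod>j<i. ennreal ((cmod (w i - w j))\<^sup>2))" for w :: "nat \<Rightarrow> complex"
  have ind: "indicator (- U) \<in> borel_measurable borel"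
    using U by (intro borel_measurable_indicator) auto
  have Hm: "H \<in> borel_measurable (LV n)"
    unfolding H_def[abs_def]
    by (intro borel_measurable_times_ennreal borel_measurable_prod_ennreal measurable_compose[OF LV_components ind] measurable_compose[OF _ measurable_ennreal]
        borel_measurable_power borel_measurable_norm borel_measurable_diff borel_measurable_exp borel_measurable_uminus borel_measurable_times)
       (auto intro: LV_components)
  have F: "F (mvf n T w) = ennreal (real n ^ (\<Sum>i<n. i)) * H w" for w
  proof -
    have 1: "qfun ?V [] (mvf n T w i) * ennreal (exp (- (cmod (mvf n T w i))\<^sup>2)) = indicator (- U) (w i) * ennreal (exp (- (real n * (cmod (w i))\<^sup>2)))" if "i < n" for i
      using that n by (auto simp: Tw qfun_def norm_mult power_mult_distrib image_iff)
    have 2: "ennreal ((cmod (mvf n T w i - mvf n T w j))\<^sup>2) = ennreal (real n) * ennreal ((cmod (w i - w j))\<^sup>2)" if "i < n" "j < i" for i j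
      using that by (simp add: Tw right_diff_distrib[symmetric] norm_mult power_mult_distrib ennreal_mult)
    have "(\<Prod>i<n. \<Prod>j<i. ennreal ((cmod (mvf n T w i - mvf n T w j))\<^sup>2)) = (\<Prod>i<n. \<Prod>j<i. ennreal (real n) * ennreal ((cmod (w i - w j))\<^sup>2))"
      by (intro prod.cong) (auto simp: 2)
    also have "\<dots> = ennreal (real n) ^ (\<Sum>i<n. i) * (\<Prod>i<n. \<Prod>j<i. ennreal ((cmod (w i - w j))\<^sup>2))"
      by (simp add: prod.distrib power_sum)
    finally have 3: "(\<Prod>i<n. \<Prod>j<i. ennreal ((cmod (mvf n T w i - mvf n T w j))\<^sup>2)) = ennreal (real n ^ (\<Sum>i<n. i)) * (\<Prod>i<n. \<Prod>j<i. ennreal ((cmod (w i - w j))\<^sup>2))"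
      by (simp add: ennreal_power)
    have 4: "(\<Prod>i<n. qfun ?V [] (mvf n T w i) * ennreal (exp (- (cmod (mvf n T w i))\<^sup>2))) = (\<Prod>i<n. indicator (- U) (w i) * ennreal (exp (- (real n * (cmod (w i))\<^sup>2))))"
      by (rule prod.cong[OF refl]) (rule 1, simp)
    show ?thesis
      unfolding F_def H_def 3 4 by (simp only: mult_ac)
  qed
  have "(cmod (detf n T))\<^sup>2 = real n ^ n"
    by (simp add: det norm_power power_mult[symmetric] mult.commute[of n 2] power_mult)
  have "vandermonde_int ?V n [] = ennreal ((cmod (detf n T))\<^sup>2) * (\<integral>\<^sup>+w. F (mvf n T w) \<partial>LV n)"
    unfolding vandermonde_int_def F_def[symmetric] by (rule nn_integral_LV_linear[symmetric]) (use n Fm in \<open>auto simp: det\<close>)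
  also have "\<dots> = ennreal (real n ^ n) * (ennreal (real n ^ (\<Sum>i<n. i)) * (\<integral>\<^sup>+w. H w \<partial>LV n))"
    unfolding F \<open>(cmod (detf n T))\<^sup>2 = real n ^ n\<close> by (simp add: nn_integral_cmult Hm)
  finally show ?thesis
    unfolding partition_fun_def H_def[symmetric] by (simp add: ennreal_mult mult.assoc)
qed

text \<open>The constant of the eigenvalue density is eliminated by comparing with the empty hole; the multiplicity lost
  in counting eigenvalues amounts to a factor between \<open>1\<close> and \<open>n!\<close>.\<close>
theorem hole_prob_partition_fun:
  assumes U: "open U" and n: "n > 0" and partition_fun: "0 < partition_fun n {}" "partition_fun n {} < \<infinity>"
  shows "ennreal (hole_prob n U) * partition_fun n {} \<le> of_nat (fact n) * partition_fun n U"
    and "partition_fun n U \<le> of_nat (fact n) * ennreal (hole_prob n U) * partition_fun n {}"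
proof -
  define V where "V = (\<lambda>w. complex_of_real (sqrt (real n)) * w) ` U"
  define c where "c = real n ^ n * real n ^ (\<Sum>i<n. i)"
  define p where "p = (pi ^ (n * n) :: real)"
  have c: "c > 0" "p > 0" using n by (auto simp: c_def p_def)
  have V: "open V" "ennreal p * ennreal (hole_prob n U) = hole_weight V n []"
    using hole_prob_hole_weight[OF U n] by (auto simp: V_def p_def)
  have W: "vandermonde_int V n [] = ennreal c * partition_fun n U" "vandermonde_int {} n [] = ennreal c * partition_fun n {}"
    using vandermonde_int_scale[OF U n] vandermonde_int_scale[OF open_empty n] by (auto simp: V_def c_def)
  define K where "K = KK n * ennreal c"
  note b = hole_weight_vandermonde_int[OF V(1), of n "[]", unfolded W V(2)[symmetric]] hole_weight_vandermonde_int[OF open_empty, of n "[]", unfolded W hole_weight_empty p_def[symmetric]]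
  have b1: "ennreal p * ennreal (hole_prob n U) \<le> K * partition_fun n U" and b2: "K * partition_fun n U \<le> of_nat (fact n) * (ennreal p * ennreal (hole_prob n U))"
    and b3: "ennreal p \<le> K * partition_fun n {}" and b4: "K * partition_fun n {} \<le> of_nat (fact n) * ennreal p"
    using b by (auto simp: K_def mult_ac)
  \<comment> \<open>That \<open>K\<close> is finite and positive is read off the two bounds for the
    empty hole; the integrals \<open>Kc\<close> are never evaluated.\<close>
  have "of_nat (fact n) * ennreal p < \<infinity>"
    using of_nat_less_top[of "fact n"] by (simp add: ennreal_mult_less_top del: of_nat_fact)
  then have "K * partition_fun n {} < \<infinity>" using b4 by (rule le_less_trans[rotated])
  then have "K \<noteq> \<infinity>" using partition_fun by (auto simp: ennreal_mult_less_top)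
  moreover have "K \<noteq> 0" using b3 c by (auto simp: ennreal_eq_0_iff)
  ultimately obtain k where k: "K = ennreal k" "k > 0"
    by (cases K) (auto simp: less_le)
  have canc: "x \<le> y" if "ennreal t * x \<le> ennreal t * y" "t > 0" for t x y
    using that ennreal_mult_le_mult_iff[of "ennreal t" x y] by auto
  have "K * (ennreal (hole_prob n U) * partition_fun n {}) = (K * partition_fun n {}) * ennreal (hole_prob n U)" by (simp only: mult_ac)
  also have "\<dots> \<le> of_nat (fact n) * ennreal p * ennreal (hole_prob n U)"
    by (intro mult_right_mono b4) auto
  also have "\<dots> = of_nat (fact n) * (ennreal p * ennreal (hole_prob n U))" by (simp only: mult_ac)
  also have "\<dots> \<le> of_nat (fact n) * (K * partition_fun n U)"
    by (intro mult_left_mono b1) auto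
  also have "\<dots> = K * (of_nat (fact n) * partition_fun n U)" by (simp only: mult_ac)
  finally show "ennreal (hole_prob n U) * partition_fun n {} \<le> of_nat (fact n) * partition_fun n U"
    using k canc by auto
  have "K * partition_fun n U \<le> of_nat (fact n) * (ennreal p * ennreal (hole_prob n U))" by (rule b2)
  also have "\<dots> \<le> of_nat (fact n) * (K * partition_fun n {} * ennreal (hole_prob n U))"
    by (intro mult_left_mono mult_right_mono b3) auto
  also have "\<dots> = K * (of_nat (fact n) * ennreal (hole_prob n U) * partition_fun n {})" by (simp only: mult_ac)
  finally show "partition_fun n U \<le> of_nat (fact n) * ennreal (hole_prob n U) * partition_fun n {}"
    using k canc by auto
qed

section \<open>Weighted logarithmic energy\<close>

text \<open>Since \<open>ln |z - w| \<le> (|z|\<^sup>2 + |w|\<^sup>2) / 2\<close>, splitting the potential evenly between the two points makes the kernel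
  nonnegative, and the energy of the definition becomes a single nonnegative integral.\<close>
definition wker_real :: "complex \<Rightarrow> complex \<Rightarrow> real" where
  "wker_real z w = - ln (cmod (z - w)) + ((cmod z)\<^sup>2 + (cmod w)\<^sup>2) / 2"

definition wker :: "complex \<Rightarrow> complex \<Rightarrow> ennreal" where
  "wker z w = (if z = w then \<infinity> else ennreal (wker_real z w))"

definition wenergy :: "complex measure \<Rightarrow> ennreal" where
  "wenergy \<mu> = (\<integral>\<^sup>+z. \<integral>\<^sup>+w. wker z w \<partial>\<mu> \<partial>\<mu>)"

lemma measurable_wker [measurable (raw)]:
  assumes [measurable]: "f \<in> borel_measurable N" "g \<in> borel_measurable N"
  shows "(\<lambda>p. wker (f p) (g p)) \<in> borel_measurable N"
  unfolding wker_def wker_real_def by measurable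

lemma measurable_logker [measurable (raw)]:
  assumes [measurable]: "f \<in> borel_measurable N" "g \<in> borel_measurable N"
  shows "(\<lambda>p. logker_pos (f p) (g p)) \<in> borel_measurable N" "(\<lambda>p. logker_neg (f p) (g p)) \<in> borel_measurable N"
  unfolding logker_pos_def logker_neg_def by measurable

text \<open>All bounds but the last rest on \<open>|z - w|^2 <= 2 (|z|^2 + |w|^2)\<close> and a
  tangent line of \<open>ln\<close>. The first one, with its quadratic growth, confines
  configurations of bounded energy; the last one shows that close points have a large
  kernel.\<close>

lemma wker_real_ge:
  assumes "z \<noteq> w"
  shows "wker_real z w \<ge> ((cmod z)\<^sup>2 + (cmod w)\<^sup>2) / 4 - 1 / 2" "wker_real z w \<ge> 0" "wker_real z w \<ge> - ln (cmod (z - w))"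
proof -
  define s where "s = (cmod z)\<^sup>2 + (cmod w)\<^sup>2"
  have d: "cmod (z - w) > 0" using assms by simp
  have "cmod (z - w) \<le> cmod z + cmod w" by (rule norm_triangle_ineq4)
  then have "(cmod (z - w))\<^sup>2 \<le> (cmod z + cmod w)\<^sup>2" using d by (intro power_mono) auto
  also have "\<dots> \<le> 2 * s"
    using sum_squares_bound[of "cmod z" "cmod w"] by (simp add: s_def power2_sum)
  finally have le: "(cmod (z - w))\<^sup>2 \<le> 2 * s" .
  have sp: "s > 0" using le d by (metis less_le_trans mult_pos_pos zero_less_numeral zero_less_power zero_less_mult_pos)
  have "2 * ln (cmod (z - w)) = ln ((cmod (z - w))\<^sup>2)"
    using d by (simp add: ln_realpow)
  also have "\<dots> \<le> ln (2 * s)" using le d sp by (subst ln_le_cancel_iff) auto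
  finally have l: "ln (cmod (z - w)) \<le> ln (2 * s) / 2" by simp
  have k: "wker_real z w = s / 2 - ln (cmod (z - w))" by (simp add: wker_real_def s_def)
  have ln2: "ln (2::real) \<le> 1" using ln_add_one_self_le_self[of 1] by simp
  \<comment> \<open>The tangent of \<open>ln\<close> at \<open>s = 2\<close> has slope
    \<open>1 / 2\<close>, so that a quarter of \<open>s\<close> is left over for the growth bound.
    Nonnegativity uses the tangent at \<open>s = 1\<close> instead.\<close>
  have "ln (2 * s) = ln (4 * (s / 2))" by simp
  also have "\<dots> = ln 4 + ln (s / 2)" using sp by (subst ln_mult) auto
  also have "ln (4::real) = 2 * ln 2" using ln_realpow[of 2 2] by simp
  also have "ln (s / 2) \<le> s / 2 - 1" using sp ln_le_minus_one[of "s / 2"] by simp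
  finally have "ln (2 * s) \<le> s / 2 + 1" using ln2 by simp
  then show "wker_real z w \<ge> ((cmod z)\<^sup>2 + (cmod w)\<^sup>2) / 4 - 1 / 2"
    unfolding s_def[symmetric] k using l by simp
  have "ln (2 * s) = ln 2 + ln s" using sp by (simp add: ln_mult)
  also have "ln s \<le> s - 1" using sp by (rule ln_le_minus_one)
  finally have "ln (2 * s) \<le> s" using ln2 by simp
  then show "wker_real z w \<ge> 0" unfolding k using l by simp
  show "wker_real z w \<ge> - ln (cmod (z - w))" unfolding wker_real_def by simp
qed

lemma logker_wker:
  "logker_pos z w + ennreal (((cmod z)\<^sup>2 + (cmod w)\<^sup>2) / 2) = wker z w + logker_neg z w"
proof (cases "z = w")
  case False
  have "max 0 (- ln (cmod (z - w))) + ((cmod z)\<^sup>2 + (cmod w)\<^sup>2) / 2 = wker_real z w + max 0 (ln (cmod (z - w)))"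
    by (simp add: wker_real_def max_def)
  then have "ennreal (max 0 (- ln (cmod (z - w))) + ((cmod z)\<^sup>2 + (cmod w)\<^sup>2) / 2) = ennreal (wker_real z w + max 0 (ln (cmod (z - w))))"
    by (simp only:)
  moreover have "ennreal (max 0 (- ln (cmod (z - w))) + ((cmod z)\<^sup>2 + (cmod w)\<^sup>2) / 2) = logker_pos z w + ennreal (((cmod z)\<^sup>2 + (cmod w)\<^sup>2) / 2)"
    unfolding logker_pos_def using False by (subst ennreal_plus) auto
  moreover have "ennreal (wker_real z w + max 0 (ln (cmod (z - w)))) = wker z w + logker_neg z w"
    unfolding logker_neg_def wker_def using False wker_real_ge(2)[OF False] by (subst ennreal_plus) auto
  ultimately show ?thesis by (simp only:)
qed (simp add: logker_pos_def wker_def)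

text \<open>Subtraction is avoided: \<open>logker_wker\<close> is integrated as an equation between
  sums, and the two terms to be cancelled are finite because the support is compact. The positive
  part may be infinite.\<close>

lemma energy_eq_wenergy:
  assumes \<mu>: "\<mu> \<in> cprob_measures E"
  shows "energy \<mu> = enn2ereal (wenergy \<mu>)"
proof -
  have sets[measurable_cong]: "sets \<mu> = sets borel" and "prob_space \<mu>"
    using \<mu> by (auto simp: cprob_measures_def)
  obtain K where K: "compact K" "emeasure \<mu> (UNIV - K) = 0"
    using \<mu> by (auto simp: cprob_measures_def)
  interpret prob_space \<mu> by fact
  obtain B where B: "\<And>z. z \<in> K \<Longrightarrow> cmod z \<le> B" "B > 0"
    using compact_imp_bounded[OF K(1)] unfolding bounded_pos by auto
  have "UNIV - K \<in> null_sets \<mu>"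
    using K by (auto simp: null_sets_def sets compact_imp_closed borel_closed borel_open)
  then have AEK: "AE z in \<mu>. z \<in> K" using AE_not_in by fastforce
  define P where "P = (\<integral>\<^sup>+ z. (\<integral>\<^sup>+ w. logker_pos z w \<partial>\<mu>) \<partial>\<mu>)"
  define N where "N = (\<integral>\<^sup>+ z. (\<integral>\<^sup>+ w. logker_neg z w \<partial>\<mu>) \<partial>\<mu>)"
  define S where "S = (\<integral>\<^sup>+ z. ennreal ((cmod z)\<^sup>2) \<partial>\<mu>)"
  have "S \<le> (\<integral>\<^sup>+ z. ennreal (B\<^sup>2) \<partial>\<mu>)"
    unfolding S_def by (rule nn_integral_mono_AE, use AEK in eventually_elim) (auto intro!: ennreal_leI power_mono B)
  then have S: "S < \<infinity>" by (rule order.strict_trans1) (simp add: emeasure_space_1)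
  have "N \<le> (\<integral>\<^sup>+ z. \<integral>\<^sup>+ w. ennreal (B + B) \<partial>\<mu> \<partial>\<mu>)"
    unfolding N_def
  proof (rule nn_integral_mono_AE, use AEK in eventually_elim)
    fix z assume "z \<in> K"
    show "(\<integral>\<^sup>+ w. logker_neg z w \<partial>\<mu>) \<le> (\<integral>\<^sup>+ w. ennreal (B + B) \<partial>\<mu>)"
    proof (rule nn_integral_mono_AE, use AEK in eventually_elim)
      fix w assume "w \<in> K"
      have "cmod (z - w) \<le> B + B" using norm_triangle_ineq4[of z w] B(1)[OF \<open>z \<in> K\<close>] B(1)[OF \<open>w \<in> K\<close>] by simp
      then have "z \<noteq> w \<Longrightarrow> ln (cmod (z - w)) \<le> B + B"
        using ln_le_minus_one[of "cmod (z - w)"] by simp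
      then show "logker_neg z w \<le> ennreal (B + B)"
        using B(2) by (auto simp: logker_neg_def intro!: ennreal_leI)
    qed
  qed
  then have N: "N < \<infinity>" by (rule order.strict_trans1) (simp add: emeasure_space_1 del: ennreal_plus)
  have "P + S = (\<integral>\<^sup>+ z. \<integral>\<^sup>+ w. logker_pos z w + ennreal (((cmod z)\<^sup>2 + (cmod w)\<^sup>2) / 2) \<partial>\<mu> \<partial>\<mu>)"
  proof -
    have "(\<integral>\<^sup>+ z. \<integral>\<^sup>+ w. ennreal (((cmod z)\<^sup>2 + (cmod w)\<^sup>2) / 2) \<partial>\<mu> \<partial>\<mu>)
      = (\<integral>\<^sup>+ z. ennreal ((cmod z)\<^sup>2 / 2) + (\<integral>\<^sup>+ w. ennreal ((cmod w)\<^sup>2 / 2) \<partial>\<mu>) \<partial>\<mu>)"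
      by (simp add: add_divide_distrib nn_integral_add emeasure_space_1)
    also have "\<dots> = (\<integral>\<^sup>+ z. ennreal ((cmod z)\<^sup>2 / 2) \<partial>\<mu>) + (\<integral>\<^sup>+ w. ennreal ((cmod w)\<^sup>2 / 2) \<partial>\<mu>)"
      by (simp add: nn_integral_add emeasure_space_1)
    also have "\<dots> = (\<integral>\<^sup>+ z. ennreal ((cmod z)\<^sup>2 / 2) + ennreal ((cmod z)\<^sup>2 / 2) \<partial>\<mu>)"
      by (simp add: nn_integral_add)
    also have "\<dots> = S"
      unfolding S_def by (intro nn_integral_cong) (simp add: ennreal_plus[symmetric] del: ennreal_plus)
    finally have S': "S = (\<integral>\<^sup>+ z. \<integral>\<^sup>+ w. ennreal (((cmod z)\<^sup>2 + (cmod w)\<^sup>2) / 2) \<partial>\<mu> \<partial>\<mu>)" ..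
    show ?thesis
      unfolding P_def S' by (simp add: nn_integral_add)
  qed
  also have "\<dots> = (\<integral>\<^sup>+ z. \<integral>\<^sup>+ w. wker z w + logker_neg z w \<partial>\<mu> \<partial>\<mu>)"
    unfolding logker_wker ..
  also have "\<dots> = wenergy \<mu> + N"
    unfolding wenergy_def N_def by (simp add: nn_integral_add)
  finally have PS: "P + S = wenergy \<mu> + N" .
  obtain n where n: "N = ennreal n" "n \<ge> 0" using N by (cases N) auto
  obtain s where s: "S = ennreal s" "s \<ge> 0" using S by (cases S) auto
  have "enn2ereal P + ereal s = enn2ereal (wenergy \<mu>) + ereal n"
    using arg_cong[OF PS, of enn2ereal] n s by (simp add: plus_ennreal.rep_eq enn2ereal_ennreal)
  moreover have "energy \<mu> = enn2ereal P - ereal n + ereal s"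
    unfolding energy_def P_def[symmetric] N_def[symmetric] S_def[symmetric] using n s by (simp add: enn2ereal_ennreal)
  ultimately show ?thesis
    by (cases "enn2ereal P"; cases "enn2ereal (wenergy \<mu>)") auto
qed

section \<open>Averages over discs\<close>

definition avg :: "real \<Rightarrow> complex \<Rightarrow> (complex \<Rightarrow> ennreal) \<Rightarrow> ennreal" where
  "avg r c f = (\<integral>\<^sup>+x. f x * indicator (ball c r) x \<partial>lborel) / ennreal (pi * r\<^sup>2)"

lemma avg_mono_AE:
  assumes "AE x in lborel. x \<in> ball c r \<longrightarrow> f x \<le> g x"
  shows "avg r c f \<le> avg r c g"
  unfolding avg_def using assms
  by (intro divide_right_mono_ennreal nn_integral_mono_AE) (auto simp: indicator_def)

lemma avg_const:
  assumes "r > 0"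
  shows "avg r c (\<lambda>_. a) = a"
proof -
  have "pi * r\<^sup>2 > 0" using assms by simp
  then show ?thesis
    using assms unfolding avg_def
    by (subst nn_integral_cmult) (auto simp: emeasure_disc ennreal_mult_divide_eq intro!: borel_measurable_indicator borel_open)
qed

lemma avg_add:
  assumes "f \<in> borel_measurable borel" "g \<in> borel_measurable borel"
  shows "avg r c (\<lambda>x. f x + g x) = avg r c f + avg r c g"
proof -
  have "indicator (ball c r) \<in> borel_measurable (borel :: complex measure)" by (intro borel_measurable_indicator borel_open) auto
  with assms have "(\<integral>\<^sup>+x. (f x + g x) * indicator (ball c r) x \<partial>lborel) =
      (\<integral>\<^sup>+x. f x * indicator (ball c r) x \<partial>lborel) + (\<integral>\<^sup>+x. g x * indicator (ball c r) x \<partial>lborel)"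
    unfolding distrib_right by (intro nn_integral_add) (auto intro!: borel_measurable_times_ennreal)
  then show ?thesis
    unfolding avg_def by (simp only: add_divide_distrib_ennreal)
qed

text \<open>For \<open>u >= 0\<close>, the points where \<open>ln (r / |x - y|)\<close> exceeds
  \<open>u\<close> form a disc of radius \<open>r * exp (- u)\<close> around \<open>y\<close>.
  Integrating the areas over \<open>u\<close> gives half the area of a disc of radius
  \<open>r\<close>, wherever the averaging disc lies.\<close>

lemma avg_log:
  assumes r: "r > 0"
  shows "avg r c (\<lambda>x. ennreal (max 0 (ln (r / cmod (x - y))))) \<le> ennreal (1 / 2)"
proof -
  have "(\<integral>\<^sup>+x. ennreal (max 0 (ln (r / cmod (x - y)))) * indicator (ball c r) x \<partial>lborel)
      \<le> (\<integral>\<^sup>+x. \<integral>\<^sup>+u. indicator {0..} u * indicator {p. cmod (fst p - y) < r * exp (- snd p)} (x, u) \<partial>lborel \<partial>lborel)"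
  proof (rule nn_integral_mono)
    fix x
    define a where "a = max 0 (ln (r / cmod (x - y)))"
    have "ennreal a = (\<integral>\<^sup>+u. indicator {0..<a} u \<partial>lborel)" by (simp add: a_def)
    also have "\<dots> \<le> (\<integral>\<^sup>+u. indicator {0..} u * indicator {p. cmod (fst p - y) < r * exp (- snd p)} (x, u) \<partial>lborel)"
    proof (rule nn_integral_mono)
      fix u :: real
      have "cmod (x - y) < r * exp (- u)" if "0 \<le> u" "u < a"
      proof -
        have ua: "u < ln (r / cmod (x - y))" using that by (auto simp: a_def max_def split: if_splits)
        then have "cmod (x - y) > 0" using that by (cases "x = y") auto
        then have "exp u < r / cmod (x - y)" using ua r by (metis divide_pos_pos exp_less_cancel_iff exp_ln)
        then show ?thesis using \<open>cmod (x - y) > 0\<close> by (simp add: exp_minus field_simps)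
      qed
      then show "indicator {0..<a} u \<le> (indicator {0..} u * indicator {p. cmod (fst p - y) < r * exp (- snd p)} (x, u) :: ennreal)"
        by (auto simp: indicator_def)
    qed
    finally have "ennreal a \<le> (\<integral>\<^sup>+u. indicator {0..} u * indicator {p. cmod (fst p - y) < r * exp (- snd p)} (x, u) \<partial>lborel)" .
    then show "ennreal a * indicator (ball c r) x \<le> (\<integral>\<^sup>+u. indicator {0..} u * indicator {p. cmod (fst p - y) < r * exp (- snd p)} (x, u) \<partial>lborel)"
      by (auto simp: indicator_def)
  qed
  also have "\<dots> = (\<integral>\<^sup>+u. \<integral>\<^sup>+x. indicator {0..} u * indicator {p. cmod (fst p - y) < r * exp (- snd p)} (x, u) \<partial>lborel \<partial>lborel)"
  proof (rule nn_integral_swap)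
    have "{p. cmod (fst p - y) < r * exp (- snd p)} \<in> sets (borel \<Otimes>\<^sub>M (borel :: real measure))"
      unfolding borel_prod by (intro borel_open open_Collect_less continuous_intros)
    then show "(\<lambda>(x, u). indicator {0..} u * indicator {p. cmod (fst p - y) < r * exp (- snd p)} (x, u) :: ennreal) \<in> borel_measurable (lborel \<Otimes>\<^sub>M lborel)"
      by (simp add: case_prod_beta')
  qed (auto intro: sigma_finite_lborel)
  also have "\<dots> = (\<integral>\<^sup>+u. ennreal (pi * r\<^sup>2 * exp (- 2 * u)) * indicator {0..} u \<partial>lborel)"
  proof (rule nn_integral_cong)
    fix u :: real
    have "(\<integral>\<^sup>+x. indicator {0..} u * indicator {p. cmod (fst p - y) < r * exp (- snd p)} (x, u) \<partial>lborel)
        = (\<integral>\<^sup>+x. indicator {0..} u * indicator (ball y (r * exp (- u))) x \<partial>lborel)"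
      by (intro nn_integral_cong) (auto simp: indicator_def dist_norm norm_minus_commute)
    also have "\<dots> = indicator {0..} u * ennreal (pi * (r * exp (- u))\<^sup>2)"
      using r by (subst nn_integral_cmult) (auto simp: emeasure_disc intro!: borel_measurable_indicator borel_open)
    also have "(r * exp (- u))\<^sup>2 = r\<^sup>2 * exp (- 2 * u)"
      by (simp add: power_mult_distrib exp_double[symmetric] power2_eq_square[of "exp _"] exp_add[symmetric])
    finally show "(\<integral>\<^sup>+x. indicator {0..} u * indicator {p. cmod (fst p - y) < r * exp (- snd p)} (x, u) \<partial>lborel)
        = ennreal (pi * r\<^sup>2 * exp (- 2 * u)) * indicator {0..} u"
      by (simp add: mult_ac)
  qed
  also have "\<dots> = ennreal (0 - - (pi * r\<^sup>2 * exp (- 2 * 0)) / 2)"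
  proof (rule nn_integral_FTC_atLeast)
    show "((\<lambda>u. - (pi * r\<^sup>2 * exp (- 2 * u)) / 2) \<longlongrightarrow> 0) (at_top :: real filter)"
      using r by real_asymp
    show "DERIV (\<lambda>u. - (pi * r\<^sup>2 * exp (- 2 * u)) / 2) x :> pi * r\<^sup>2 * exp (- 2 * x)" for x
      by (auto intro!: derivative_eq_intros)
  qed (use r in auto)
  finally have "(\<integral>\<^sup>+x. ennreal (max 0 (ln (r / cmod (x - y)))) * indicator (ball c r) x \<partial>lborel) \<le> ennreal (pi * r\<^sup>2 / 2)"
    by simp
  then have "avg r c (\<lambda>x. ennreal (max 0 (ln (r / cmod (x - y))))) \<le> ennreal (pi * r\<^sup>2 / 2) / ennreal (pi * r\<^sup>2)"
    unfolding avg_def by (rule divide_right_mono_ennreal)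
  also have "\<dots> = ennreal (1 / 2)"
    using r by (subst divide_ennreal) auto
  finally show ?thesis .
qed

text \<open>The interaction of two uniform distributions on discs of equal radius. It is finite also
  when the discs coincide.\<close>

definition smeared_ker :: "real \<Rightarrow> complex \<Rightarrow> complex \<Rightarrow> ennreal" where
  "smeared_ker r c c' = avg r c (\<lambda>x. avg r c' (\<lambda>y. wker x y))"

lemma smeared_ker_near:
  assumes r: "0 < r" "r \<le> 1"
    and A: "\<And>x. x \<in> ball c r \<Longrightarrow> (cmod x)\<^sup>2 \<le> A" "\<And>x. x \<in> ball c' r \<Longrightarrow> (cmod x)\<^sup>2 \<le> A'"
  shows "smeared_ker r c c' \<le> ennreal (- ln r + 1 / 2 + (A + A') / 2)"
proof -
  have A0: "A \<ge> 0" "A' \<ge> 0"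
    using A(1)[of c] A(2)[of c'] r order_trans[OF zero_le_power2] by (auto simp: order_trans[OF zero_le_power2])
  have lr: "- ln r \<ge> 0" using r by simp
  have "avg r c' (\<lambda>y. wker x y) \<le> ennreal (- ln r + 1 / 2 + (A + A') / 2)" if x: "x \<in> ball c r" for x
  proof -
    have "avg r c' (\<lambda>y. wker x y) \<le> avg r c' (\<lambda>y. ennreal (max 0 (ln (r / cmod (y - x)))) + ennreal (- ln r + (A + A') / 2))"
    proof (rule avg_mono_AE)
      have "AE y in lborel. y \<noteq> x" by (rule AE_lborel_singleton)
      then show "AE y in lborel. y \<in> ball c' r \<longrightarrow> wker x y \<le> ennreal (max 0 (ln (r / cmod (y - x)))) + ennreal (- ln r + (A + A') / 2)"
      proof (eventually_elim, intro impI)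
        fix y assume y: "y \<noteq> x" "y \<in> ball c' r"
        have "- ln (cmod (x - y)) = ln (r / cmod (y - x)) - ln r"
          using y r by (simp add: ln_div norm_minus_commute)
        then have "wker_real x y \<le> max 0 (ln (r / cmod (y - x))) + (- ln r + (A + A') / 2)"
          unfolding wker_real_def using A(1)[OF x] A(2)[OF y(2)] max.cobounded2[of "ln (r / cmod (y - x))" 0] by argo
        then have "wker x y \<le> ennreal (max 0 (ln (r / cmod (y - x))) + (- ln r + (A + A') / 2))"
          using not_sym[OF y(1)] by (simp only: wker_def if_False ennreal_leI)
        then show "wker x y \<le> ennreal (max 0 (ln (r / cmod (y - x)))) + ennreal (- ln r + (A + A') / 2)"
          using lr A0 by (subst (asm) ennreal_plus) auto
      qed
    qed
    also have "\<dots> = avg r c' (\<lambda>y. ennreal (max 0 (ln (r / cmod (y - x))))) + ennreal (- ln r + (A + A') / 2)"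
      by (subst avg_add) (auto simp: avg_const[OF r(1)])
    also have "\<dots> \<le> ennreal (1 / 2) + ennreal (- ln r + (A + A') / 2)"
      by (intro add_right_mono avg_log r)
    also have "\<dots> = ennreal (- ln r + 1 / 2 + (A + A') / 2)"
      using lr A0 by (subst ennreal_plus[symmetric]) (auto simp: algebra_simps)
    finally show ?thesis .
  qed
  then have "smeared_ker r c c' \<le> avg r c (\<lambda>_. ennreal (- ln r + 1 / 2 + (A + A') / 2))"
    unfolding smeared_ker_def by (intro avg_mono_AE) auto
  then show ?thesis by (simp add: avg_const[OF r(1)])
qed

lemma smeared_ker_far:
  assumes r: "0 < r" and t: "t > 0"
    and A: "\<And>x. x \<in> ball c r \<Longrightarrow> (cmod x)\<^sup>2 \<le> A" "\<And>x. x \<in> ball c' r \<Longrightarrow> (cmod x)\<^sup>2 \<le> A'"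
    and d: "\<And>x y. x \<in> ball c r \<Longrightarrow> y \<in> ball c' r \<Longrightarrow> t \<le> cmod (x - y)"
  shows "smeared_ker r c c' \<le> ennreal (- ln t + (A + A') / 2)"
proof -
  have "wker x y \<le> ennreal (- ln t + (A + A') / 2)" if "x \<in> ball c r" "y \<in> ball c' r" for x y
  proof -
    have "ln t \<le> ln (cmod (x - y))" using d[OF that] t by (subst ln_le_cancel_iff) auto
    then have "wker_real x y \<le> - ln t + (A + A') / 2"
      unfolding wker_real_def using A(1)[OF that(1)] A(2)[OF that(2)] by argo
    then show ?thesis
      using d[OF that] t by (auto simp: wker_def intro!: ennreal_leI)
  qed
  then have "avg r c' (\<lambda>y. wker x y) \<le> avg r c' (\<lambda>_. ennreal (- ln t + (A + A') / 2))" if "x \<in> ball c r" for x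
    using that by (intro avg_mono_AE) auto
  then have "smeared_ker r c c' \<le> avg r c (\<lambda>_. ennreal (- ln t + (A + A') / 2))"
    unfolding smeared_ker_def by (intro avg_mono_AE) (auto simp: avg_const[OF r])
  then show ?thesis by (simp add: avg_const[OF r])
qed

text \<open>An upper bound for \<open>|x|^2\<close> on a disc of radius \<open>r\<close> whose
  center is within \<open>4 * r\<close> of \<open>z\<close>. From \<open>(|z| + 5 r)^2\<close>, the
  mixed term contributes \<open>5 r (1 + |z|^2)\<close> and the square, for \<open>r <= 1\<close>,
  another \<open>25 r (1 + |z|^2)\<close>.\<close>

definition sq_bound :: "real \<Rightarrow> complex \<Rightarrow> real" where
  "sq_bound r z = (cmod z)\<^sup>2 + 30 * r * (1 + (cmod z)\<^sup>2)"

lemma sq_bound_avg: "(sq_bound r z + sq_bound r w) / 2 = ((cmod z)\<^sup>2 + (cmod w)\<^sup>2) / 2 + 15 * r * (2 + (cmod z)\<^sup>2 + (cmod w)\<^sup>2)"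
  by (simp add: sq_bound_def field_simps)

lemma sq_bound_bound:
  assumes r: "0 < r" "r \<le> 1" and c: "cmod (c - z) \<le> 4 * r" and x: "x \<in> ball c r"
  shows "(cmod x)\<^sup>2 \<le> sq_bound r z"
proof -
  have "cmod x \<le> cmod z + cmod (c - z) + cmod (x - c)"
    using norm_triangle_ineq[of z "c - z"] norm_triangle_ineq[of c "x - c"] by simp
  also have "\<dots> \<le> cmod z + 5 * r" using c x by (simp add: dist_norm norm_minus_commute)
  finally have "(cmod x)\<^sup>2 \<le> (cmod z + 5 * r)\<^sup>2" by (intro power_mono) auto
  also have "\<dots> = (cmod z)\<^sup>2 + 5 * r * (2 * cmod z * 1) + 25 * (r * r)"
    by (simp add: power2_eq_square algebra_simps)
  also have "2 * cmod z * 1 \<le> (cmod z)\<^sup>2 + 1\<^sup>2" by (rule sum_squares_bound)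
  also have "r * r \<le> r * (1 + (cmod z)\<^sup>2)" using r by (intro mult_left_mono) (auto intro: add_increasing2)
  finally show ?thesis using r by (simp add: sq_bound_def algebra_simps)
qed

lemma smeared_ker_bound_near:
  assumes r: "0 < r" "r \<le> 1" and c: "cmod (c - z) \<le> 4 * r" "cmod (c' - w) \<le> 4 * r"
  shows "smeared_ker r c c' \<le> ennreal (- ln r + 1 / 2 + (sq_bound r z + sq_bound r w) / 2)"
  by (rule smeared_ker_near[OF r]) (auto intro: sq_bound_bound[OF r c(1)] sq_bound_bound[OF r c(2)])

text \<open>Smearing moves each of the two points by at most \<open>5 * r\<close>. At distance at
  least \<open>M * r\<close> this shrinks the distance by a factor of at worst
  \<open>1 - 10 / M\<close>. At smaller distance the singularity has been cut off at scale
  \<open>r\<close>, and \<open>- ln r\<close> exceeds \<open>- ln |z - w|\<close> by at most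
  \<open>ln M\<close>.\<close>

lemma smeared_ker_bound:
  assumes r: "0 < r" "r \<le> 1" and c: "cmod (c - z) \<le> 4 * r" "cmod (c' - w) \<le> 4 * r" and M: "M > 10" and "z \<noteq> w"
  shows "smeared_ker r c c' \<le> ennreal (wker_real z w - ln (1 - 10 / M) + 15 * r * (2 + (cmod z)\<^sup>2 + (cmod w)\<^sup>2)
      + (if cmod (z - w) < M * r then ln M + 1 / 2 else 0))"
proof (cases "cmod (z - w) < M * r")
  case True
  have d: "cmod (z - w) > 0" using \<open>z \<noteq> w\<close> by simp
  have "ln (cmod (z - w)) \<le> ln (M * r)" using True d M r by (subst ln_le_cancel_iff) auto
  also have "\<dots> = ln M + ln r" using M r by (simp add: ln_mult)
  finally have "- ln r \<le> - ln (cmod (z - w)) + ln M" by simp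
  moreover have "ln (1 - 10 / M) \<le> 0" using M by (subst ln_le_zero_iff) auto
  ultimately have "- ln r + 1 / 2 + (sq_bound r z + sq_bound r w) / 2 \<le> wker_real z w - ln (1 - 10 / M) + 15 * r * (2 + (cmod z)\<^sup>2 + (cmod w)\<^sup>2) + (ln M + 1 / 2)"
    unfolding wker_real_def sq_bound_avg by linarith
  from order_trans[OF smeared_ker_bound_near[OF r c] ennreal_leI[OF this]] show ?thesis
    using True by (simp only: if_True)
next
  case False
  define t where "t = cmod (z - w) * (1 - 10 / M)"
  have d: "cmod (z - w) > 0" using \<open>z \<noteq> w\<close> by simp
  have pos: "1 - 10 / M > 0" using M by simp
  have t: "t > 0" using d pos by (simp add: t_def)
  have "t \<le> cmod (x - y)" if x: "x \<in> ball c r" and y: "y \<in> ball c' r" for x y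
  proof -
    have "cmod (z - w) \<le> cmod (x - y) + cmod (x - c) + cmod (c - z) + cmod (y - c') + cmod (c' - w)"
    proof -
      have "z - w = (x - y) - (x - c) - (c - z) + (y - c') + (c' - w)" by simp
      then have "cmod (z - w) = cmod ((x - y) - (x - c) - (c - z) + (y - c') + (c' - w))" by simp
      also have "\<dots> \<le> cmod (x - y) + cmod (x - c) + cmod (c - z) + cmod (y - c') + cmod (c' - w)"
        by (intro order_trans[OF norm_triangle_ineq] order_trans[OF norm_triangle_ineq4] add_mono order_refl)
      finally show ?thesis .
    qed
    also have "\<dots> \<le> cmod (x - y) + 10 * r"
      using x y c by (simp add: dist_norm norm_minus_commute)
    finally have "cmod (z - w) - 10 * r \<le> cmod (x - y)" by simp
    moreover have "10 * r \<le> cmod (z - w) * (10 / M)" using False M by (simp add: field_simps)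
    ultimately show ?thesis by (simp add: t_def right_diff_distrib)
  qed
  then have "smeared_ker r c c' \<le> ennreal (- ln t + (sq_bound r z + sq_bound r w) / 2)"
    by (intro smeared_ker_far r t sq_bound_bound[OF r c(1)] sq_bound_bound[OF r c(2)])
  also have "ln t = ln (cmod (z - w)) + ln (1 - 10 / M)"
    unfolding t_def using d pos by (subst ln_mult) auto
  also have "- (ln (cmod (z - w)) + ln (1 - 10 / M)) + (sq_bound r z + sq_bound r w) / 2 = wker_real z w - ln (1 - 10 / M) + 15 * r * (2 + (cmod z)\<^sup>2 + (cmod w)\<^sup>2)"
    unfolding wker_real_def sq_bound_avg by linarith
  finally show ?thesis using False by simp
qed

section \<open>Smearing under the exterior ball condition\<close>

text \<open>If the disc around \<open>p\<close> meets \<open>U\<close>, a segment from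
  \<open>p\<close> crosses the boundary within distance \<open>r\<close>. Going from the crossing
  point a distance \<open>r\<close> towards the center of its exterior ball gives a disc of radius
  \<open>r\<close> inside that ball, tangent to it at the crossing point.\<close>

lemma exterior_ball_near:
  assumes U: "open U" and r: "0 < r" "r \<le> \<epsilon>"
    and ext: "\<And>z. z \<in> frontier U \<Longrightarrow> \<exists>\<eta>. ball \<eta> \<epsilon> \<subseteq> - U \<and> cmod (z - \<eta>) = \<epsilon>" and p: "p \<notin> U"
  shows "\<exists>c. cmod (c - p) \<le> 2 * r \<and> ball c r \<subseteq> - U"
proof (cases "ball p r \<subseteq> - U")
  case True
  then show ?thesis using r by (intro exI[of _ p]) auto
next
  case False
  then obtain u where u: "u \<in> ball p r" "u \<in> U" by auto
  have "closed_segment p u \<inter> frontier U \<noteq> {}"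
    by (rule connected_Int_frontier) (use u p in auto)
  then obtain z where z: "z \<in> closed_segment p u" "z \<in> frontier U" by auto
  have "cmod (z - p) \<le> cmod (u - p)" using segment_bound(1)[OF z(1)] .
  also have "\<dots> < r" using u by (simp add: dist_norm norm_minus_commute)
  finally have zp: "cmod (z - p) < r" .
  obtain \<eta> where \<eta>: "ball \<eta> \<epsilon> \<subseteq> - U" "cmod (z - \<eta>) = \<epsilon>" using ext[OF z(2)] by auto
  define c where "c = z + of_real (r / \<epsilon>) * (\<eta> - z)"
  have e: "\<epsilon> > 0" using r by simp
  have cz: "cmod (c - z) = r"
    using \<eta>(2) e r by (simp add: c_def norm_mult norm_divide norm_minus_commute)
  define k :: complex where "k = of_real (r / \<epsilon>)"
  have "c - \<eta> = (1 - k) * (z - \<eta>)" unfolding c_def k_def[symmetric] by (simp add: algebra_simps)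
  also have "1 - k = of_real (1 - r / \<epsilon>)" by (simp add: k_def)
  finally have "c - \<eta> = of_real (1 - r / \<epsilon>) * (z - \<eta>)" .
  then have "cmod (c - \<eta>) = \<bar>1 - r / \<epsilon>\<bar> * \<epsilon>" using \<eta>(2) by (simp only: norm_mult norm_of_real)
  also have "\<dots> = \<epsilon> - r" using r e by (simp add: field_simps)
  finally have "ball c r \<subseteq> ball \<eta> \<epsilon>" by (simp add: ball_subset_ball_iff dist_norm)
  moreover have "cmod (c - p) \<le> 2 * r"
    using norm_triangle_ineq[of "c - z" "z - p"] cz zp by simp
  ultimately show ?thesis using \<eta>(1) by blast
qed

text \<open>A measurable choice of centers is obtained by making \<open>T\<close> constant on the cells of a grid of mesh \<open>r\<close>.\<close>
lemma exterior_ball_map: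
  assumes U: "open U" and r: "0 < r" "r \<le> \<epsilon>"
    and ext: "\<And>z. z \<in> frontier U \<Longrightarrow> \<exists>\<eta>. ball \<eta> \<epsilon> \<subseteq> - U \<and> cmod (z - \<eta>) = \<epsilon>"
  obtains T where "T \<in> borel_measurable borel" "\<And>z. z \<notin> U \<Longrightarrow> cmod (T z - z) \<le> 4 * r" "\<And>z. z \<notin> U \<Longrightarrow> ball (T z) r \<subseteq> - U"
proof -
  define C where "C z = (\<lfloor>Re z / r\<rfloor>, \<lfloor>Im z / r\<rfloor>)" for z
  define P where "P q c \<longleftrightarrow> ball c r \<subseteq> - U \<and> (\<forall>z. z \<notin> U \<and> C z = q \<longrightarrow> cmod (c - z) \<le> 4 * r)" for q c
  have ex: "\<exists>c. P (C p) c" if p: "p \<notin> U" for p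
  proof -
    obtain c where c: "cmod (c - p) \<le> 2 * r" "ball c r \<subseteq> - U"
      using exterior_ball_near[OF U r ext p] by auto
    \<comment> \<open>Two points of one grid cell differ by at most \<open>r\<close> in each
      coordinate, hence by at most \<open>2 * r\<close>; this is added to the \<open>2 * r\<close>
      between \<open>p\<close> and its center.\<close>
    have "cmod (c - z) \<le> 4 * r" if "C z = C p" for z
    proof -
      have close: "\<bar>a - b\<bar> \<le> r" if "\<lfloor>a / r\<rfloor> = \<lfloor>b / r\<rfloor>" for a b
      proof -
        have "\<bar>a / r - b / r\<bar> \<le> 1" using that by linarith
        then have "\<bar>(a - b) / r\<bar> \<le> 1" by (simp add: diff_divide_distrib)
        then show ?thesis using r by (simp add: abs_divide)
      qed
      have "\<bar>Re z - Re p\<bar> \<le> r" "\<bar>Im z - Im p\<bar> \<le> r"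
        using that by (auto simp: C_def intro: close)
      then have "cmod (p - z) \<le> 2 * r"
        using cmod_le[of "p - z"] by (simp add: abs_minus_commute)
      then show ?thesis using norm_triangle_ineq[of "c - p" "p - z"] c(1) by simp
    qed
    then show ?thesis using c(2) by (auto simp: P_def)
  qed
  define t where "t q = (SOME c. P q c)" for q
  have t: "P (C p) (t (C p))" if "p \<notin> U" for p
    unfolding t_def using ex[OF that] by (rule someI_ex)
  show ?thesis
  proof (rule that[of "\<lambda>z. t (C z)"])
    have "(\<lambda>z. Re z / r) \<in> borel_measurable borel" "(\<lambda>z. Im z / r) \<in> borel_measurable borel"
      using r by (auto intro!: borel_measurable_continuous_onI continuous_intros)
    then have fl: "(\<lambda>z. \<lfloor>Re z / r\<rfloor>) \<in> measurable borel (count_space UNIV)" "(\<lambda>z. \<lfloor>Im z / r\<rfloor>) \<in> measurable borel (count_space UNIV)"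
      by (auto intro: measurable_compose[OF _ measurable_real_floor])
    have "(\<lambda>z. t (i, \<lfloor>Im z / r\<rfloor>)) \<in> borel_measurable borel" for i
      by (rule measurable_compose[OF fl(2)]) simp
    then show "(\<lambda>z. t (C z)) \<in> borel_measurable borel"
      unfolding C_def by (rule measurable_compose_countable) (rule fl(1))
  qed (use t in \<open>auto simp: P_def\<close>)
qed

section \<open>Smearing a measure over discs\<close>

definition sden :: "complex measure \<Rightarrow> (complex \<Rightarrow> complex) \<Rightarrow> real \<Rightarrow> complex \<Rightarrow> ennreal" where
  "sden \<mu> T r x = (\<integral>\<^sup>+z. indicator (ball (T z) r) x \<partial>\<mu>) / ennreal (pi * r\<^sup>2)"

text \<open>The mixture over \<open>\<mu>\<close> of the uniform distributions on the discs
  \<open>ball (T z) r\<close>. It is given by its density because the lower bound for the partition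
  function needs a density that is bounded and vanishes on \<open>U\<close>.\<close>

definition smear :: "complex measure \<Rightarrow> (complex \<Rightarrow> complex) \<Rightarrow> real \<Rightarrow> complex measure" where
  "smear \<mu> T r = density lborel (sden \<mu> T r)"

context
  fixes \<mu> :: "complex measure" and T :: "complex \<Rightarrow> complex" and r :: real
  assumes sets_mu: "sets \<mu> = sets borel" and mu: "prob_space \<mu>" and T [measurable]: "T \<in> borel_measurable borel" and r: "r > 0"
begin

interpretation prob_space \<mu> by (rule mu)

lemma Tmu: "T \<in> borel_measurable \<mu>"
  using T measurable_cong_sets[OF sets_mu refl] by blast

lemma measurable_ball_indicator:
  "(\<lambda>p. indicator (ball (T (fst p)) r) (snd p) :: ennreal) \<in> borel_measurable (\<mu> \<Otimes>\<^sub>M borel)"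
proof -
  note Tmu[measurable]
  have "(\<lambda>p. indicator (ball (T (fst p)) r) (snd p) :: ennreal) = (\<lambda>p. if cmod (T (fst p) - snd p) < r then 1 else 0)"
    by (auto simp: indicator_def dist_norm)
  then show ?thesis by simp
qed

lemma measurable_sden [measurable]: "sden \<mu> T r \<in> borel_measurable borel"
proof -
  have "(\<lambda>x. \<integral>\<^sup>+z. indicator (ball (T z) r) x \<partial>\<mu>) \<in> borel_measurable borel"
    by (rule borel_measurable_nn_integral)
       (use measurable_ball_indicator measurable_pair_swap in \<open>auto simp: case_prod_beta' dest: measurable_pair_swap\<close>)
  then show ?thesis unfolding sden_def[abs_def] by simp
qed

lemma nn_integral_smear:
  assumes [measurable]: "g \<in> borel_measurable borel"
  shows "(\<integral>\<^sup>+x. g x \<partial>smear \<mu> T r) = (\<integral>\<^sup>+z. avg r (T z) g \<partial>\<mu>)"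
proof -
  have g2: "(\<lambda>p. g (snd p)) \<in> borel_measurable (\<mu> \<Otimes>\<^sub>M borel)" by measurable
  have gi: "(\<lambda>p. indicator (ball (T (fst p)) r) (snd p) * g (snd p)) \<in> borel_measurable (\<mu> \<Otimes>\<^sub>M lborel)"
    using borel_measurable_times_ennreal[OF measurable_ball_indicator g2] by simp
  have "(\<lambda>p. (snd p, fst p)) \<in> measurable (lborel \<Otimes>\<^sub>M \<mu>) (\<mu> \<Otimes>\<^sub>M lborel)"
    by (intro measurable_Pair measurable_fst measurable_snd)
  from measurable_compose[OF this gi]
  have gi': "(\<lambda>(x, z). indicator (ball (T z) r) x * g x) \<in> borel_measurable (lborel \<Otimes>\<^sub>M \<mu>)"
    by (simp only: fst_conv snd_conv case_prod_beta')
  have sec: "(\<lambda>z. indicator (ball (T z) r) x :: ennreal) \<in> borel_measurable \<mu>" for x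
    using measurable_compose[OF measurable_Pair2'[of x borel \<mu>] measurable_ball_indicator] by simp
  have "(\<integral>\<^sup>+x. g x \<partial>smear \<mu> T r) = (\<integral>\<^sup>+x. sden \<mu> T r x * g x \<partial>lborel)"
    unfolding smear_def by (rule nn_integral_density) measurable
  also have "\<dots> = (\<integral>\<^sup>+x. (\<integral>\<^sup>+z. indicator (ball (T z) r) x * g x \<partial>\<mu>) / ennreal (pi * r\<^sup>2) \<partial>lborel)"
    unfolding sden_def nn_integral_multc[OF sec] divide_ennreal_def by (simp only: mult_ac)
  also have "\<dots> = (\<integral>\<^sup>+x. (\<integral>\<^sup>+z. indicator (ball (T z) r) x * g x \<partial>\<mu>) \<partial>lborel) / ennreal (pi * r\<^sup>2)"
    by (rule nn_integral_divide, rule borel_measurable_nn_integral, rule gi')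
  also have "(\<integral>\<^sup>+x. (\<integral>\<^sup>+z. indicator (ball (T z) r) x * g x \<partial>\<mu>) \<partial>lborel) = (\<integral>\<^sup>+z. (\<integral>\<^sup>+x. indicator (ball (T z) r) x * g x \<partial>lborel) \<partial>\<mu>)"
    by (rule nn_integral_swap[OF sigma_finite_lborel sigma_finite_measure_axioms gi'])
  also have "\<dots> / ennreal (pi * r\<^sup>2) = (\<integral>\<^sup>+z. (\<integral>\<^sup>+x. indicator (ball (T z) r) x * g x \<partial>lborel) / ennreal (pi * r\<^sup>2) \<partial>\<mu>)"
    by (rule nn_integral_divide[symmetric], rule lborel.borel_measurable_nn_integral)
       (use gi in \<open>simp only: case_prod_beta'\<close>)
  finally show ?thesis by (simp add: avg_def mult.commute)
qed

lemma sets_smear [simp]: "sets (smear \<mu> T r) = sets borel"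
  by (simp add: smear_def)

lemma space_smear [simp]: "space (smear \<mu> T r) = UNIV"
  by (simp add: smear_def)

lemma prob_space_smear: "prob_space (smear \<mu> T r)"
proof
  have "(\<integral>\<^sup>+x. 1 \<partial>smear \<mu> T r) = (\<integral>\<^sup>+z. avg r (T z) (\<lambda>_. 1) \<partial>\<mu>)"
    by (rule nn_integral_smear) simp
  then show "emeasure (smear \<mu> T r) (space (smear \<mu> T r)) = 1"
    using r by (simp add: avg_const emeasure_space_1)
qed

text \<open>\<open>nn_integral_smear\<close> in both variables, and one exchange of the average over
  the first disc with the integral over the second point. Most of the proof is joint
  measurability.\<close>

lemma wenergy_smear: "wenergy (smear \<mu> T r) = (\<integral>\<^sup>+z. \<integral>\<^sup>+w. smeared_ker r (T z) (T w) \<partial>\<mu> \<partial>\<mu>)"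
proof -
  interpret S: prob_space "smear \<mu> T r" by (rule prob_space_smear)
  have *: "(\<lambda>x. \<integral>\<^sup>+y. wker x y \<partial>smear \<mu> T r) \<in> borel_measurable borel"
    by (rule S.borel_measurable_nn_integral) (simp add: case_prod_beta' measurable_wker cong: measurable_cong_sets)
  have kp: "(\<lambda>p. wker (fst p) (snd p)) \<in> borel_measurable (borel \<Otimes>\<^sub>M borel)" by measurable
  have "wenergy (smear \<mu> T r) = (\<integral>\<^sup>+z. avg r (T z) (\<lambda>x. \<integral>\<^sup>+y. wker x y \<partial>smear \<mu> T r) \<partial>\<mu>)"
    unfolding wenergy_def by (rule nn_integral_smear[OF *])
  also have "\<dots> = (\<integral>\<^sup>+z. avg r (T z) (\<lambda>x. \<integral>\<^sup>+w. avg r (T w) (wker x) \<partial>\<mu>) \<partial>\<mu>)"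
    by (subst nn_integral_smear) auto
  also have "\<dots> = (\<integral>\<^sup>+z. \<integral>\<^sup>+w. smeared_ker r (T z) (T w) \<partial>\<mu> \<partial>\<mu>)"
  proof (rule nn_integral_cong)
    fix z
    have bi: "(\<lambda>q. indicator (ball (T (snd (fst q))) r) (snd q) :: ennreal) \<in> borel_measurable ((borel \<Otimes>\<^sub>M \<mu>) \<Otimes>\<^sub>M lborel)"
    proof -
      have "(\<lambda>q. (snd (fst q), snd q)) \<in> measurable ((borel \<Otimes>\<^sub>M \<mu>) \<Otimes>\<^sub>M lborel) (\<mu> \<Otimes>\<^sub>M borel)"
        by (intro measurable_Pair measurable_compose[OF measurable_fst measurable_snd]) simp
      from measurable_compose[OF this measurable_ball_indicator] show ?thesis by (simp only: fst_conv snd_conv)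
    qed
    have "(\<lambda>q. wker (fst (fst q)) (snd q) * indicator (ball (T (snd (fst q))) r) (snd q)) \<in> borel_measurable ((borel \<Otimes>\<^sub>M \<mu>) \<Otimes>\<^sub>M lborel)"
      using bi by (intro borel_measurable_times_ennreal measurable_wker) auto
    then have av: "(\<lambda>p. avg r (T (snd p)) (wker (fst p))) \<in> borel_measurable (borel \<Otimes>\<^sub>M \<mu>)"
      unfolding avg_def by (intro borel_measurable_divide_ennreal lborel.borel_measurable_nn_integral borel_measurable_const) (simp only: case_prod_beta')
    define bi0 :: "complex \<Rightarrow> ennreal" where "bi0 = indicator (ball (T z) r)"
    have [measurable]: "bi0 \<in> borel_measurable borel" unfolding bi0_def by (intro borel_measurable_indicator borel_open) auto
    have av1: "(\<lambda>w. avg r (T w) (wker x)) \<in> borel_measurable \<mu>" for x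
      using measurable_compose[OF measurable_Pair1'[of x borel \<mu>] av] by simp
    have "(\<lambda>p. bi0 (fst p)) \<in> borel_measurable (borel \<Otimes>\<^sub>M \<mu>)"
      by measurable
    from borel_measurable_times_ennreal[OF av this]
    have av2: "(\<lambda>(x, w). avg r (T w) (wker x) * bi0 x) \<in> borel_measurable (lborel \<Otimes>\<^sub>M \<mu>)"
      by (simp add: case_prod_beta' cong: measurable_cong_sets)
    have "(\<lambda>p. (snd p, fst p)) \<in> measurable (\<mu> \<Otimes>\<^sub>M lborel) (lborel \<Otimes>\<^sub>M \<mu>)"
      by (intro measurable_Pair measurable_fst measurable_snd)
    from measurable_compose[OF this av2]
    have av3: "(\<lambda>(w, x). avg r (T w) (wker x) * bi0 x) \<in> borel_measurable (\<mu> \<Otimes>\<^sub>M lborel)"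
      by (simp only: fst_conv snd_conv case_prod_beta')
    have "avg r (T z) (\<lambda>x. \<integral>\<^sup>+w. avg r (T w) (wker x) \<partial>\<mu>) = (\<integral>\<^sup>+x. (\<integral>\<^sup>+w. avg r (T w) (wker x) * bi0 x \<partial>\<mu>) \<partial>lborel) / ennreal (pi * r\<^sup>2)"
      unfolding avg_def[of r "T z"] bi0_def[symmetric] by (simp add: nn_integral_multc av1)
    also have "(\<integral>\<^sup>+x. (\<integral>\<^sup>+w. avg r (T w) (wker x) * bi0 x \<partial>\<mu>) \<partial>lborel) = (\<integral>\<^sup>+w. (\<integral>\<^sup>+x. avg r (T w) (wker x) * bi0 x \<partial>lborel) \<partial>\<mu>)"
      by (rule nn_integral_swap[OF sigma_finite_lborel sigma_finite_measure_axioms av2])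
    also have "\<dots> / ennreal (pi * r\<^sup>2) = (\<integral>\<^sup>+w. (\<integral>\<^sup>+x. avg r (T w) (wker x) * bi0 x \<partial>lborel) / ennreal (pi * r\<^sup>2) \<partial>\<mu>)"
      by (rule nn_integral_divide[symmetric], rule lborel.borel_measurable_nn_integral, rule av3)
    also have "\<dots> = (\<integral>\<^sup>+w. smeared_ker r (T z) (T w) \<partial>\<mu>)"
      unfolding smeared_ker_def avg_def[of r "T z"] bi0_def[symmetric] ..
    finally show "avg r (T z) (\<lambda>x. \<integral>\<^sup>+w. avg r (T w) (wker x) \<partial>\<mu>) = (\<integral>\<^sup>+w. smeared_ker r (T z) (T w) \<partial>\<mu>)" .
  qed
  finally show ?thesis .
qed

lemma sden_le: "sden \<mu> T r x \<le> ennreal (1 / (pi * r\<^sup>2))"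
proof -
  have "(\<integral>\<^sup>+z. indicator (ball (T z) r) x \<partial>\<mu>) \<le> (\<integral>\<^sup>+z. 1 \<partial>\<mu>)"
    by (intro nn_integral_mono) (auto simp: indicator_def)
  then have "sden \<mu> T r x \<le> 1 / ennreal (pi * r\<^sup>2)"
    unfolding sden_def by (intro divide_right_mono_ennreal) (simp add: emeasure_space_1)
  also have "\<dots> = ennreal (1 / (pi * r\<^sup>2))"
    using r divide_ennreal[of 1 "pi * r\<^sup>2"] by simp
  finally show ?thesis .
qed

lemma sden_zero:
  assumes "AE z in \<mu>. x \<notin> ball (T z) r"
  shows "sden \<mu> T r x = 0"
proof -
  have "(\<integral>\<^sup>+z. indicator (ball (T z) r) x \<partial>\<mu>) = (\<integral>\<^sup>+z. 0 \<partial>\<mu>)"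
    by (rule nn_integral_cong_AE) (use assms in \<open>auto elim!: eventually_mono simp: indicator_def\<close>)
  then show ?thesis by (simp add: sden_def)
qed

lemma smear_cprob:
  assumes U: "open U" and K: "AE z in \<mu>. z \<notin> U \<and> cmod z \<le> B"
    and TU: "\<And>z. z \<notin> U \<Longrightarrow> cmod (T z - z) \<le> 4 * r" "\<And>z. z \<notin> U \<Longrightarrow> ball (T z) r \<subseteq> - U"
  shows "smear \<mu> T r \<in> cprob_measures (- U)" "x \<in> U \<Longrightarrow> sden \<mu> T r x = 0"
proof -
  show 0: "sden \<mu> T r x = 0" if "x \<in> U" for x
  proof (rule sden_zero, use K in eventually_elim)
    fix z assume "z \<notin> U \<and> cmod z \<le> B"
    then show "x \<notin> ball (T z) r" using TU(2)[of z] that by blast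
  qed
  have 1: "sden \<mu> T r x = 0" if "cmod x > B + 5 * r" for x
  proof (rule sden_zero, use K in eventually_elim)
    fix z assume z: "z \<notin> U \<and> cmod z \<le> B"
    show "x \<notin> ball (T z) r"
    proof
      assume "x \<in> ball (T z) r"
      then have "cmod (x - T z) < r" by (simp add: dist_norm norm_minus_commute)
      then have "cmod x < B + 5 * r"
        using norm_triangle_ineq[of "x - T z" "T z"] norm_triangle_ineq[of "T z - z" z] TU(1)[of z] z by simp
      then show False using that by simp
    qed
  qed
  define L where "L = cball 0 (B + 5 * r) - U"
  have L: "compact L" unfolding L_def using U by (intro compact_diff) auto
  have [measurable]: "L \<in> sets borel" using L by (simp add: compact_imp_closed borel_closed)
  have "emeasure (smear \<mu> T r) (UNIV - L) = (\<integral>\<^sup>+x. sden \<mu> T r x * indicator (UNIV - L) x \<partial>lborel)"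
    unfolding smear_def by (rule emeasure_density) auto
  also have "\<dots> = (\<integral>\<^sup>+(x::complex). 0 \<partial>lborel)"
    by (intro nn_integral_cong) (auto simp: L_def indicator_def not_le 0 1)
  finally have "emeasure (smear \<mu> T r) (UNIV - L) = 0" by simp
  moreover have "L \<subseteq> - U" by (auto simp: L_def)
  ultimately show "smear \<mu> T r \<in> cprob_measures (- U)"
    unfolding cprob_measures_def using L prob_space_smear by auto
qed

end

text \<open>In \<open>smeared_ker_bound\<close> the loss \<open>ln M + 1 / 2\<close> for close
  points does not shrink with \<open>r\<close>. But close points have a kernel of at least
  \<open>- ln (M * r)\<close>, which is arbitrarily large, so the loss is absorbed into the factor
  \<open>1 + \<delta>\<close>. For equal points the right side is infinite.\<close>

lemma smearing_scale:
  assumes "\<epsilon> > 0" "\<delta> > 0"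
  obtains r where "0 < r" "r \<le> \<epsilon>" "r \<le> 1"
    "\<And>z w c c'. cmod (c - z) \<le> 4 * r \<Longrightarrow> cmod (c' - w) \<le> 4 * r \<Longrightarrow>
      smeared_ker r c c' \<le> ennreal (1 + \<delta>) * wker z w + ennreal (\<delta> * (3 + (cmod z)\<^sup>2 + (cmod w)\<^sup>2))"
proof -
  have "((\<lambda>M. - ln (1 - 10 / M)) \<longlongrightarrow> 0) (at_top :: real filter)" by real_asymp
  then have "eventually (\<lambda>M. - ln (1 - 10 / M) < \<delta>) at_top"
    using assms(2) by (rule order_tendstoD)
  then obtain M where M: "M > 10" "- ln (1 - 10 / M) < \<delta>"
    using eventually_happens[OF eventually_conj[OF eventually_gt_at_top[of "10::real"]]] by fastforce
  \<comment> \<open>\<open>M\<close> is fixed from here on, chosen for distant points; only then is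
    \<open>r\<close> made small for the close ones.\<close>
  have "((\<lambda>r. (ln M + 1 / 2) / (- ln (M * r))) \<longlongrightarrow> 0) (at_right 0)"
    using M(1) by real_asymp
  then have e1: "eventually (\<lambda>r. (ln M + 1 / 2) / (- ln (M * r)) < \<delta>) (at_right 0)"
    using assms(2) by (rule order_tendstoD)
  \<comment> \<open>The bound \<open>\<delta> / 15\<close> absorbs the error \<open>15 * r\<close>
    in the potential, and \<open>1 / M\<close> makes \<open>- ln (M * r)\<close> positive.\<close>
  have m: "min (min \<epsilon> 1) (min (\<delta> / 15) (1 / M)) > 0" using assms M by simp
  have "eventually (\<lambda>r. r \<in> {0<..<min (min \<epsilon> 1) (min (\<delta> / 15) (1 / M))}) (at_right 0)"
    using m by (rule eventually_at_right_real)
  then obtain r where r: "(ln M + 1 / 2) / (- ln (M * r)) < \<delta>" "r \<in> {0<..<min (min \<epsilon> 1) (min (\<delta> / 15) (1 / M))}"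
    using eventually_happens[OF eventually_conj[OF e1]] by fastforce
  then have r0: "0 < r" "r \<le> \<epsilon>" "r \<le> 1" "r \<le> \<delta> / 15" "M * r < 1"
    using M by (auto simp: field_simps)
  define \<Lambda> where "\<Lambda> = - ln (M * r)"
  have \<Lambda>: "\<Lambda> > 0" using r0 M by (simp add: \<Lambda>_def)
  have LM: "ln M + 1 / 2 \<le> \<delta> * \<Lambda>" using r(1) \<Lambda> by (simp add: \<Lambda>_def[symmetric] pos_divide_less_eq less_imp_le)
  show ?thesis
  proof (rule that[OF r0(1-3)])
    fix z w c c' assume c: "cmod (c - z) \<le> 4 * r" "cmod (c' - w) \<le> 4 * r"
    show "smeared_ker r c c' \<le> ennreal (1 + \<delta>) * wker z w + ennreal (\<delta> * (3 + (cmod z)\<^sup>2 + (cmod w)\<^sup>2))"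
    proof (cases "z = w")
      case True
      then show ?thesis using assms(2) by (simp add: wker_def ennreal_mult_top)
    next
      case False
      have k0: "wker_real z w \<ge> 0" by (rule wker_real_ge(2)[OF False])
      have near: "(if cmod (z - w) < M * r then ln M + 1 / 2 else 0) \<le> \<delta> * wker_real z w"
      proof (cases "cmod (z - w) < M * r")
        case True
        have "ln (cmod (z - w)) \<le> ln (M * r)" using True False M r0 by (subst ln_le_cancel_iff) auto
        then have "\<Lambda> \<le> wker_real z w" using wker_real_ge(3)[OF False] by (simp add: \<Lambda>_def)
        then have "\<delta> * \<Lambda> \<le> \<delta> * wker_real z w" using assms(2) by simp
        then show ?thesis using LM True by simp
      qed (use k0 assms(2) in simp)
      have "15 * r * (2 + (cmod z)\<^sup>2 + (cmod w)\<^sup>2) \<le> \<delta> * (2 + (cmod z)\<^sup>2 + (cmod w)\<^sup>2)"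
        using r0(4) by (intro mult_right_mono) auto
      then have "wker_real z w - ln (1 - 10 / M) + 15 * r * (2 + (cmod z)\<^sup>2 + (cmod w)\<^sup>2) + (if cmod (z - w) < M * r then ln M + 1 / 2 else 0)
         \<le> (1 + \<delta>) * wker_real z w + \<delta> * (3 + (cmod z)\<^sup>2 + (cmod w)\<^sup>2)"
        using near M(2) by (simp add: algebra_simps)
      then have "smeared_ker r c c' \<le> ennreal ((1 + \<delta>) * wker_real z w + \<delta> * (3 + (cmod z)\<^sup>2 + (cmod w)\<^sup>2))"
        by (rule order_trans[OF smeared_ker_bound[OF r0(1,3) c M(1) False] ennreal_leI])
      also have "\<dots> = ennreal ((1 + \<delta>) * wker_real z w) + ennreal (\<delta> * (3 + (cmod z)\<^sup>2 + (cmod w)\<^sup>2))"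
        using k0 assms(2) by (intro ennreal_plus) auto
      also have "ennreal ((1 + \<delta>) * wker_real z w) = ennreal (1 + \<delta>) * wker z w"
        using k0 assms(2) False by (simp add: wker_def ennreal_mult)
      finally show ?thesis .
    qed
  qed
qed

section \<open>Asymptotics of the partition function\<close>

definition pair_energy :: "nat \<Rightarrow> (nat \<Rightarrow> complex) \<Rightarrow> real" where
  "pair_energy n w = (\<Sum>i<n. \<Sum>j\<in>{..<n} - {i}. wker_real (w i) (w j))"

lemma wker_real_commute: "wker_real z w = wker_real w z"
  by (simp add: wker_real_def norm_minus_commute add.commute)

lemma sum_off_diagonal_Suc:
  fixes f :: "nat \<Rightarrow> nat \<Rightarrow> 'a::comm_monoid_add"
  shows "(\<Sum>i<Suc n. \<Sum>j\<in>{..<Suc n} - {i}. f i j) = (\<Sum>i<n. \<Sum>j\<in>{..<n} - {i}. f i j) + (\<Sum>j<n. f n j + f j n)"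
proof -
  have "{..<Suc n} - {i} = insert n ({..<n} - {i})" if "i < n" for i using that by auto
  moreover have "{..<Suc n} - {n} = {..<n}" by auto
  ultimately show ?thesis by (simp add: sum.distrib add_ac)
qed

text \<open>A point lies in \<open>n - 1\<close> unordered pairs, whose two ordered copies each
  carry half of its \<open>|w|^2\<close>, so the pair energy accounts for \<open>n - 1\<close> of
  the \<open>n\<close> copies of \<open>|w|^2\<close> in the exponent. The remaining Gaussian factor
  per point makes the upper bound integrable.\<close>

lemma exp_minus_pair_energy:
  assumes "inj_on w {..<n}"
  shows "exp (- pair_energy n w) * (\<Prod>i<n. exp (- (cmod (w i))\<^sup>2)) = (\<Prod>i<n. exp (- (real n * (cmod (w i))\<^sup>2))) * (\<Prod>i<n. \<Prod>j<i. (cmod (w i - w j))\<^sup>2)"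
  using assms
proof (induction n)
  case (Suc n)
  have inj: "inj_on w {..<n}" using Suc.prems by (rule inj_on_subset) auto
  have ne: "w n \<noteq> w j" if "j < n" for j using inj_onD[OF Suc.prems, of n j] that by auto
  define Q where "Q = (\<Sum>j<n. (cmod (w j))\<^sup>2)"
  have S: "pair_energy (Suc n) w = pair_energy n w + 2 * (\<Sum>j<n. wker_real (w n) (w j))"
  proof -
    have "wker_real (w n) (w j) + wker_real (w j) (w n) = 2 * wker_real (w n) (w j)" for j
      unfolding wker_real_commute[of "w j" "w n"] by (rule mult_2[symmetric])
    then show ?thesis
      unfolding pair_energy_def sum_off_diagonal_Suc sum_distrib_left by (simp only:)
  qed
  have "exp (- (2 * wker_real (w n) (w j))) = (cmod (w n - w j))\<^sup>2 * (exp (- (cmod (w n))\<^sup>2) * exp (- (cmod (w j))\<^sup>2))" if "j < n" for j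
  proof -
    have "exp (- (2 * wker_real (w n) (w j))) = exp (ln (cmod (w n - w j)) + ln (cmod (w n - w j)) + (- (cmod (w n))\<^sup>2 + - (cmod (w j))\<^sup>2))"
      by (intro arg_cong[where f=exp]) (simp add: wker_real_def field_simps)
    also have "\<dots> = exp (ln (cmod (w n - w j))) * exp (ln (cmod (w n - w j))) * (exp (- (cmod (w n))\<^sup>2) * exp (- (cmod (w j))\<^sup>2))"
      by (simp only: exp_add)
    also have "exp (ln (cmod (w n - w j))) = cmod (w n - w j)" using ne[OF that] by simp
    finally show ?thesis by (simp only: power2_eq_square)
  qed
  then have "exp (- (2 * (\<Sum>j<n. wker_real (w n) (w j)))) = (\<Prod>j<n. (cmod (w n - w j))\<^sup>2 * (exp (- (cmod (w n))\<^sup>2) * exp (- (cmod (w j))\<^sup>2)))"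
    by (simp add: sum_distrib_left sum_negf[symmetric] exp_sum)
  also have "\<dots> = (\<Prod>j<n. (cmod (w n - w j))\<^sup>2) * (exp (- (real n * (cmod (w n))\<^sup>2)) * (\<Prod>j<n. exp (- (cmod (w j))\<^sup>2)))"
    by (simp add: prod.distrib exp_of_nat_mult[symmetric])
  finally have E: "exp (- (2 * (\<Sum>j<n. wker_real (w n) (w j)))) = (\<Prod>j<n. (cmod (w n - w j))\<^sup>2) * (exp (- (real n * (cmod (w n))\<^sup>2)) * (\<Prod>j<n. exp (- (cmod (w j))\<^sup>2)))" .
  have P: "(\<Prod>i<n. exp (- (real (Suc n) * (cmod (w i))\<^sup>2))) = (\<Prod>i<n. exp (- (real n * (cmod (w i))\<^sup>2))) * (\<Prod>i<n. exp (- (cmod (w i))\<^sup>2))"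
    by (simp add: prod.distrib[symmetric] exp_add[symmetric] algebra_simps)
  have n1: "exp (- (real (Suc n) * (cmod (w n))\<^sup>2)) = exp (- (real n * (cmod (w n))\<^sup>2)) * exp (- (cmod (w n))\<^sup>2)"
    by (simp add: exp_add[symmetric] algebra_simps)
  have "exp (- pair_energy (Suc n) w) * (\<Prod>i<Suc n. exp (- (cmod (w i))\<^sup>2))
      = (exp (- pair_energy n w) * (\<Prod>i<n. exp (- (cmod (w i))\<^sup>2))) * exp (- (2 * (\<Sum>j<n. wker_real (w n) (w j)))) * exp (- (cmod (w n))\<^sup>2)"
    unfolding S by (simp add: exp_add[symmetric])
  also have "\<dots> = ((\<Prod>i<n. exp (- (real n * (cmod (w i))\<^sup>2))) * (\<Prod>i<n. \<Prod>j<i. (cmod (w i - w j))\<^sup>2))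
      * ((\<Prod>j<n. (cmod (w n - w j))\<^sup>2) * (exp (- (real n * (cmod (w n))\<^sup>2)) * (\<Prod>j<n. exp (- (cmod (w j))\<^sup>2)))) * exp (- (cmod (w n))\<^sup>2)"
    unfolding E Suc.IH[OF inj] ..
  also have "\<dots> = (\<Prod>i<Suc n. exp (- (real (Suc n) * (cmod (w i))\<^sup>2))) * (\<Prod>i<Suc n. \<Prod>j<i. (cmod (w i - w j))\<^sup>2)"
    unfolding prod.lessThan_Suc P n1 by (simp only: mult_ac)
  finally show ?case .
qed (simp add: pair_energy_def)

lemma partition_fun_integrand:
  assumes "inj_on w {..<n}"
  shows "(\<Prod>i<n. indicator (- U) (w i) * ennreal (exp (- (real n * (cmod (w i))\<^sup>2)))) * (\<Prod>i<n. \<Prod>j<i. ennreal ((cmod (w i - w j))\<^sup>2))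
    = (\<Prod>i<n. indicator (- U) (w i)) * ennreal (exp (- pair_energy n w)) * (\<Prod>i<n. ennreal (exp (- (cmod (w i))\<^sup>2)))"
proof -
  have "(\<Prod>i<n. ennreal (exp (- (real n * (cmod (w i))\<^sup>2)))) * (\<Prod>i<n. \<Prod>j<i. ennreal ((cmod (w i - w j))\<^sup>2))
     = ennreal ((\<Prod>i<n. exp (- (real n * (cmod (w i))\<^sup>2))) * (\<Prod>i<n. \<Prod>j<i. (cmod (w i - w j))\<^sup>2))"
    by (simp add: prod_ennreal prod_nonneg ennreal_mult)
  also have "\<dots> = ennreal (exp (- pair_energy n w)) * (\<Prod>i<n. ennreal (exp (- (cmod (w i))\<^sup>2)))"
    unfolding exp_minus_pair_energy[OF assms, symmetric] by (simp add: prod_ennreal prod_nonneg ennreal_mult)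
  finally show ?thesis by (simp add: prod.distrib mult.assoc)
qed

lemma partition_fun_integrand_zero:
  assumes "\<not> inj_on w {..<n::nat}"
  shows "(\<Prod>i<n. \<Prod>j<i. ennreal ((cmod (w i - w j))\<^sup>2)) = 0"
proof -
  obtain a b where "a < n" "b < n" "w a = w b" "a \<noteq> b"
    using assms by (auto simp: inj_on_def)
  then have "b < n \<and> a < b \<and> w b = w a \<or> a < n \<and> b < a \<and> w a = w b" by auto
  then have "\<exists>i j. i < n \<and> j < i \<and> w i = w j" by blast
  then obtain i j where "i < n" "j < i" "w i = w j" by blast
  then have "\<exists>i\<in>{..<n}. (\<Prod>j<i. ennreal ((cmod (w i - w j))\<^sup>2)) = 0"
    by (intro bexI[of _ i]) (auto intro!: bexI[of _ j])
  then show ?thesis by (intro prod_zero) auto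
qed

section \<open>Finiteness of the infimum and the upper bound for the partition function\<close>

locale exterior_ball_set =
  fixes U :: "complex set" and \<epsilon> :: real
  assumes U: "open U" "U \<subseteq> ball 0 1" and eps: "\<epsilon> > 0"
    and ext: "\<And>z. z \<in> frontier U \<Longrightarrow> \<exists>\<eta>. ball \<eta> \<epsilon> \<subseteq> - U \<and> cmod (z - \<eta>) = \<epsilon>"
begin

lemma R_U_le: "\<mu> \<in> cprob_measures (- U) \<Longrightarrow> R_U U \<le> enn2ereal (wenergy \<mu>)"
  unfolding R_U_def by (metis INF_lower energy_eq_wenergy)

lemma R_U_finite: obtains \<rho> where "R_U U = ereal \<rho>" "\<rho> \<ge> 0"
proof -
  \<comment> \<open>A unit mass at 3, smeared with radius 1, is a competitor of finite energy: its
    disc keeps distance at least 2 from the origin.\<close>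
  define \<mu> :: "complex measure" where "\<mu> = return borel 3"
  have \<mu>: "sets \<mu> = sets borel" "prob_space \<mu>" by (auto simp: \<mu>_def prob_space_return)
  interpret prob_space \<mu> by (rule \<mu>(2))
  have "sden \<mu> (\<lambda>_. 3) 1 x = 0" if "x \<notin> ball 3 1" for x
    by (rule sden_zero[OF \<mu>]) (use that in auto)
  then have "emeasure (smear \<mu> (\<lambda>_. 3) 1) (UNIV - cball 3 1) = (\<integral>\<^sup>+(x::complex). 0 \<partial>lborel)"
  proof -
    have "sden \<mu> (\<lambda>_. 3) 1 x * indicator (UNIV - cball 3 1) x = 0" for x :: complex
      using \<open>\<And>x. x \<notin> ball 3 1 \<Longrightarrow> sden \<mu> (\<lambda>_. 3) 1 x = 0\<close>[of x] by (cases "x \<in> cball 3 1") auto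
    then have eq: "(\<lambda>x. sden \<mu> (\<lambda>_. 3) 1 x * indicator (UNIV - cball 3 1) x) = (\<lambda>x::complex. 0)" unfolding fun_eq_iff by blast
    have "sden \<mu> (\<lambda>_. 3) 1 \<in> borel_measurable lborel" using measurable_sden[OF \<mu>, of "\<lambda>_. 3" 1] by simp
    then have "emeasure (smear \<mu> (\<lambda>_. 3) 1) (UNIV - cball 3 1) = (\<integral>\<^sup>+x. sden \<mu> (\<lambda>_. 3) 1 x * indicator (UNIV - cball 3 1) x \<partial>lborel)"
      unfolding smear_def by (rule emeasure_density) simp
    then show ?thesis by (simp only: eq)
  qed
  moreover have "cball (3::complex) 1 \<subseteq> - U"
  proof
    fix x assume "x \<in> cball (3::complex) 1"
    then have "cmod (3 - x) \<le> 1" by (simp add: dist_norm)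
    then have "cmod x \<ge> 2" using norm_triangle_ineq[of "3 - x" x] by simp
    then show "x \<in> - U" using U(2) by (auto simp: dist_norm)
  qed
  ultimately have "smear \<mu> (\<lambda>_. 3) 1 \<in> cprob_measures (- U)"
    unfolding cprob_measures_def using prob_space_smear[OF \<mu>, of "\<lambda>_. 3" 1] by (auto intro!: exI[of _ "cball 3 1"] simp: smear_def)
  then have "R_U U \<le> enn2ereal (wenergy (smear \<mu> (\<lambda>_. 3) 1))" by (rule R_U_le)
  also have "wenergy (smear \<mu> (\<lambda>_. 3) 1) = (\<integral>\<^sup>+z. \<integral>\<^sup>+w. smeared_ker 1 3 3 \<partial>\<mu> \<partial>\<mu>)"
    by (rule wenergy_smear[OF \<mu>]) auto
  also have "\<dots> = smeared_ker 1 3 3" by (simp add: emeasure_space_1)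
  also have "smeared_ker 1 3 3 \<le> ennreal (- ln 1 + 1 / 2 + (sq_bound 1 3 + sq_bound 1 3) / 2)"
    by (rule smeared_ker_bound_near) auto
  finally have "R_U U \<le> enn2ereal (ennreal (- ln 1 + 1 / 2 + (sq_bound 1 3 + sq_bound 1 3) / 2))" by (simp add: less_eq_ennreal.rep_eq)
  also have "\<dots> < \<infinity>" by (simp add: less_top[symmetric])
  finally have "R_U U < \<infinity>" .
  moreover have "R_U U \<ge> 0"
    unfolding R_U_def by (intro INF_greatest) (simp add: energy_eq_wenergy enn2ereal_nonneg)
  ultimately show ?thesis using that by (cases "R_U U") auto
qed

text \<open>Smearing the empirical measure of \<open>w\<close> gives a competitor in the infimum defining \<open>R_U U\<close>.\<close>
lemma empirical_energy:
  assumes n: "n > 0" and w: "\<And>i. i < n \<Longrightarrow> w i \<notin> U" "inj_on w {..<n}" and d: "\<delta> > 0" and \<rho>: "R_U U = ereal \<rho>"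
    and r: "0 < r" "r \<le> \<epsilon>" "r \<le> 1"
    and smeared_ker: "\<And>z w c c'. cmod (c - z) \<le> 4 * r \<Longrightarrow> cmod (c' - w) \<le> 4 * r \<Longrightarrow>
      smeared_ker r c c' \<le> ennreal (1 + \<delta>) * wker z w + ennreal (\<delta> * (3 + (cmod z)\<^sup>2 + (cmod w)\<^sup>2))"
  shows "(real n)\<^sup>2 * \<rho> \<le> (1 + \<delta>) * pair_energy n w + \<delta> * (3 * (real n)\<^sup>2 + 2 * real n * nsq n w)
    + real n * (- ln r + 1 / 2) + (nsq n w + 30 * r * (real n + nsq n w))"
proof -
  obtain T where T: "T \<in> borel_measurable borel" "\<And>z. z \<notin> U \<Longrightarrow> cmod (T z - z) \<le> 4 * r" "\<And>z. z \<notin> U \<Longrightarrow> ball (T z) r \<subseteq> - U"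
    using exterior_ball_map[OF U(1) r(1,2) ext] by metis
  define \<mu> where "\<mu> = distr (measure_pmf (pmf_of_set {..<n})) borel w"
  have \<mu>: "sets \<mu> = sets borel" "prob_space \<mu>"
    unfolding \<mu>_def by (auto intro!: prob_space.prob_space_distr prob_space_measure_pmf)
  have int: "(\<integral>\<^sup>+z. g z \<partial>\<mu>) = (\<Sum>i<n. g (w i)) / of_nat n" if "g \<in> borel_measurable borel" for g
  proof -
    have "(\<integral>\<^sup>+z. g z \<partial>\<mu>) = (\<integral>\<^sup>+i. g (w i) \<partial>measure_pmf (pmf_of_set {..<n}))"
      unfolding \<mu>_def using that by (subst nn_integral_distr) auto
    also have "\<dots> = (\<Sum>i<n. g (w i)) / of_nat (card {..<n})"
      using n by (intro nn_integral_pmf_of_set) auto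
    finally show ?thesis by simp
  qed
  have AE: "AE z in \<mu>. P z" if "\<And>i. i < n \<Longrightarrow> P (w i)" "Measurable.pred borel P" for P
  proof -
    have "set_pmf (pmf_of_set {..<n}) = {..<n}" using n by (intro set_pmf_of_set) auto
    then show ?thesis
      unfolding \<mu>_def using that by (subst AE_distr_iff) (auto simp: AE_measure_pmf_iff pred_def)
  qed
  have [measurable]: "U \<in> sets borel" using U(1) by (rule borel_open)
  have Um: "Measurable.pred borel (\<lambda>z. z \<notin> U)" by measurable
  have "finite (cmod ` w ` {..<n})" by simp
  then obtain B where B: "\<And>i. i < n \<Longrightarrow> cmod (w i) \<le> B"
    by (metis (no_types, lifting) Max_ge imageI lessThan_iff)
  have "AE z in \<mu>. z \<notin> U \<and> cmod z \<le> B"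
    using Um by (intro AE) (auto simp: w B)
  then have "smear \<mu> T r \<in> cprob_measures (- U)"
    by (rule smear_cprob[OF \<mu> T(1) r(1) U(1) _ T(2,3)])
  then have "ereal \<rho> \<le> enn2ereal (wenergy (smear \<mu> T r))" using R_U_le \<rho> by simp
  also have "wenergy (smear \<mu> T r) = (\<integral>\<^sup>+z. \<integral>\<^sup>+w. smeared_ker r (T z) (T w) \<partial>\<mu> \<partial>\<mu>)"
    by (rule wenergy_smear[OF \<mu> T(1) r(1)])
  finally have le: "ereal \<rho> \<le> enn2ereal (\<integral>\<^sup>+z. \<integral>\<^sup>+w. smeared_ker r (T z) (T w) \<partial>\<mu> \<partial>\<mu>)" .
  \<comment> \<open>Bounds the diagonal terms, where \<open>wker\<close> is infinite, by the
    self-energy of one smeared disc. There are only \<open>n\<close> of them, so even with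
    \<open>- ln r\<close> they are of lower order than \<open>n\<^sup>2\<close>.\<close>
  define nb where "nb z = - ln r + 1 / 2 + sq_bound r z" for z
  define fb where "fb z w = \<delta> * (3 + (cmod z)\<^sup>2 + (cmod w)\<^sup>2)" for z w
  define g where "g z w = (if z = w then ennreal (nb z) else ennreal (1 + \<delta>) * wker z w + ennreal (fb z w))" for z w
  have lnr: "0 \<le> - ln r" using r by simp
  have nb0: "nb z \<ge> 0" for z
  proof -
    have "0 \<le> sq_bound r z" using r by (simp add: sq_bound_def)
    then show ?thesis unfolding nb_def by (intro add_nonneg_nonneg lnr) auto
  qed
  have fb0: "fb z w \<ge> 0" for z w
    using d by (simp add: fb_def)
  have gm: "(\<lambda>z. g z b) \<in> borel_measurable borel" "(\<lambda>z. g b z) \<in> borel_measurable borel" for b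
    unfolding g_def nb_def fb_def sq_bound_def by measurable
  have JJg: "smeared_ker r (T z) (T w) \<le> g z w" if "z \<notin> U" "w \<notin> U" for z w
  proof (cases "z = w")
    case True
    then show ?thesis
      using smeared_ker_bound_near[OF r(1,3) T(2)[OF that(1)] T(2)[OF that(1)]] by (simp add: g_def nb_def)
  next
    case False
    then show ?thesis using smeared_ker[OF T(2)[OF that(1)] T(2)[OF that(2)]] by (simp add: g_def fb_def)
  qed
  have AEU: "AE z in \<mu>. z \<notin> U" by (rule AE[OF w(1) Um])
  have "(\<integral>\<^sup>+z. \<integral>\<^sup>+w. smeared_ker r (T z) (T w) \<partial>\<mu> \<partial>\<mu>) \<le> (\<integral>\<^sup>+z. \<integral>\<^sup>+w. g z w \<partial>\<mu> \<partial>\<mu>)"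
    by (rule nn_integral_mono_AE, use AEU in eventually_elim, rule nn_integral_mono_AE, use AEU in eventually_elim) (rule JJg)
  also have "\<dots> = (\<Sum>i<n. (\<Sum>j<n. g (w i) (w j)) / of_nat n) / of_nat n"
    unfolding int[OF gm(2)] by (rule int) (use gm(1) in measurable)
  also have "\<dots> = ennreal (\<Sum>i<n. (\<Sum>j<n. gr i j)) / of_nat n / of_nat n" if hg: "\<And>i j. i < n \<Longrightarrow> j < n \<Longrightarrow> g (w i) (w j) = ennreal (gr i j) \<and> gr i j \<ge> 0" for gr
  proof -
    have "(\<Sum>j<n. g (w i) (w j)) / of_nat n = ennreal (\<Sum>j<n. gr i j) / of_nat n" if i: "i < n" for i
    proof -
      have "(\<Sum>j<n. g (w i) (w j)) = (\<Sum>j<n. ennreal (gr i j))"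
        using hg[OF i] by (intro sum.cong) auto
      also have "\<dots> = ennreal (\<Sum>j<n. gr i j)" using hg[OF i] by (intro sum_ennreal) auto
      finally show ?thesis by simp
    qed
    then have "(\<Sum>i<n. (\<Sum>j<n. g (w i) (w j)) / of_nat n) = (\<Sum>i<n. ennreal (\<Sum>j<n. gr i j) * inverse (of_nat n))"
      by (intro sum.cong) (auto simp: divide_ennreal_def)
    also have "\<dots> = (\<Sum>i<n. ennreal (\<Sum>j<n. gr i j)) * inverse (of_nat n)"
      by (rule sum_distrib_right[symmetric])
    also have "(\<Sum>i<n. ennreal (\<Sum>j<n. gr i j)) = ennreal (\<Sum>i<n. \<Sum>j<n. gr i j)"
      using hg by (intro sum_ennreal sum_nonneg) auto
    finally show ?thesis by (simp add: divide_ennreal_def)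
  qed
  finally have *: "(\<integral>\<^sup>+z. \<integral>\<^sup>+w. smeared_ker r (T z) (T w) \<partial>\<mu> \<partial>\<mu>) \<le> ennreal (\<Sum>i<n. (\<Sum>j<n. gr i j)) / of_nat n / of_nat n"
    if "\<And>i j. i < n \<Longrightarrow> j < n \<Longrightarrow> g (w i) (w j) = ennreal (gr i j) \<and> gr i j \<ge> 0" for gr
    using that by blast
  define gr where "gr i j = (if i = j then nb (w i) else (1 + \<delta>) * wker_real (w i) (w j) + fb (w i) (w j))" for i j
  have gr: "g (w i) (w j) = ennreal (gr i j) \<and> gr i j \<ge> 0" if "i < n" "j < n" for i j
  proof (cases "i = j")
    case False
    then have ne: "w i \<noteq> w j" using inj_onD[OF w(2), of i j] that by auto
    then show ?thesis
      using False wker_real_ge(2)[OF ne] fb0 d by (simp add: g_def gr_def wker_def ennreal_mult)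
  qed (simp add: g_def gr_def nb0)
  have sum_nn: "0 \<le> (\<Sum>i<n. \<Sum>j<n. gr i j)" using gr by (intro sum_nonneg) auto
  have "ennreal (\<Sum>i<n. (\<Sum>j<n. gr i j)) / of_nat n / of_nat n = ennreal ((\<Sum>i<n. \<Sum>j<n. gr i j) / real n / real n)"
    using n sum_nn by (simp add: ennreal_of_nat_eq_real_of_nat divide_ennreal)
  with *[OF gr] have "(\<integral>\<^sup>+z. \<integral>\<^sup>+w. smeared_ker r (T z) (T w) \<partial>\<mu> \<partial>\<mu>) \<le> ennreal ((\<Sum>i<n. \<Sum>j<n. gr i j) / real n / real n)" by simp
  with le have "ereal \<rho> \<le> enn2ereal (ennreal ((\<Sum>i<n. \<Sum>j<n. gr i j) / real n / real n))"
    by (meson less_eq_ennreal.rep_eq order_trans)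
  then have "\<rho> \<le> (\<Sum>i<n. \<Sum>j<n. gr i j) / real n / real n"
    using sum_nn by (simp add: enn2ereal_ennreal)
  then have 1: "(real n)\<^sup>2 * \<rho> \<le> (\<Sum>i<n. \<Sum>j<n. gr i j)"
    using n by (simp add: field_simps power2_eq_square)
  also have "\<dots> = (\<Sum>i<n. nb (w i) + (\<Sum>j\<in>{..<n} - {i}. (1 + \<delta>) * wker_real (w i) (w j) + fb (w i) (w j)))"
  proof (rule sum.cong[OF refl])
    fix i assume "i \<in> {..<n}"
    then have "(\<Sum>j<n. gr i j) = gr i i + (\<Sum>j\<in>{..<n} - {i}. gr i j)" by (intro sum.remove) auto
    also have "(\<Sum>j\<in>{..<n} - {i}. gr i j) = (\<Sum>j\<in>{..<n} - {i}. (1 + \<delta>) * wker_real (w i) (w j) + fb (w i) (w j))"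
      by (intro sum.cong) (auto simp: gr_def)
    finally show "(\<Sum>j<n. gr i j) = nb (w i) + (\<Sum>j\<in>{..<n} - {i}. (1 + \<delta>) * wker_real (w i) (w j) + fb (w i) (w j))"
      by (simp add: gr_def)
  qed
  also have "\<dots> = (\<Sum>i<n. nb (w i)) + (1 + \<delta>) * pair_energy n w + (\<Sum>i<n. \<Sum>j\<in>{..<n} - {i}. fb (w i) (w j))"
    by (simp add: pair_energy_def sum.distrib sum_distrib_left)
  also have "(\<Sum>i<n. \<Sum>j\<in>{..<n} - {i}. fb (w i) (w j)) \<le> (\<Sum>i<n. \<Sum>j<n. fb (w i) (w j))"
    using fb0 by (intro sum_mono sum_mono2) auto
  also have "(\<Sum>i<n. \<Sum>j<n. fb (w i) (w j)) = \<delta> * (3 * (real n)\<^sup>2 + 2 * real n * nsq n w)"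
    by (simp add: fb_def nsq_def sum.distrib sum_distrib_left[symmetric] power2_eq_square algebra_simps)
  also have "(\<Sum>i<n. nb (w i)) = real n * (- ln r + 1 / 2) + (nsq n w + 30 * r * (real n + nsq n w))"
  proof -
    have "nb z = (- ln r + 1 / 2 + 30 * r) + (1 + 30 * r) * (cmod z)\<^sup>2" for z
      by (simp add: nb_def sq_bound_def algebra_simps)
    then have "(\<Sum>i<n. nb (w i)) = real n * (- ln r + 1 / 2 + 30 * r) + (1 + 30 * r) * nsq n w"
      by (simp only: sum.distrib sum_constant sum_distrib_left[symmetric] nsq_def card_lessThan distrib_left)
    then show ?thesis by (simp add: algebra_simps)
  qed
  finally show ?thesis by simp
qed

text \<open>The growth of \<open>wker_real\<close>, summed over pairs. It bounds the second moment
  of a configuration by its energy, which is needed because the smearing errors grow with the second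
  moment.\<close>

lemma pair_energy_nsq:
  assumes "inj_on w {..<n}"
  shows "pair_energy n w \<ge> (real n - 1) * nsq n w / 2 - real n * (real n - 1) / 2" "pair_energy n w \<ge> 0"
proof -
  have ne: "w i \<noteq> w j" if "i < n" "j \<in> {..<n} - {i}" for i j
    using inj_onD[OF assms, of i j] that by auto
  show "pair_energy n w \<ge> 0"
    unfolding pair_energy_def using ne by (intro sum_nonneg wker_real_ge(2)) auto
  have "(\<Sum>i<n. \<Sum>j\<in>{..<n} - {i}. ((cmod (w i))\<^sup>2 + (cmod (w j))\<^sup>2) / 4 - 1 / 2) \<le> pair_energy n w"
    unfolding pair_energy_def using ne by (intro sum_mono wker_real_ge(1)) auto
  moreover have "(\<Sum>i<n. \<Sum>j\<in>{..<n} - {i}. ((cmod (w i))\<^sup>2 + (cmod (w j))\<^sup>2) / 4 - 1 / 2) = (real n - 1) * nsq n w / 2 - real n * (real n - 1) / 2"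
  proof (induction n)
    case (Suc n)
    show ?case
      unfolding sum_off_diagonal_Suc Suc.IH
      by (simp add: nsq_def sum.distrib sum_subtractf sum_divide_distrib[symmetric] sum_distrib_left[symmetric] field_simps)
  qed (simp add: nsq_def)
  ultimately show "pair_energy n w \<ge> (real n - 1) * nsq n w / 2 - real n * (real n - 1) / 2" by simp
qed

text \<open>A configuration with energy at least \<open>\<rho>\<close> times
  \<open>n\<^sup>2\<close> needs no argument. For any other, \<open>pair_energy_nsq\<close> bounds
  the second moment by a multiple of \<open>n\<close>, and then the errors in
  \<open>empirical_energy\<close> are uniformly small.\<close>

lemma pair_energy_lower_bound:
  assumes \<rho>: "R_U U = ereal \<rho>" "\<rho> \<ge> 0" and d: "\<delta> > 0"
  obtains C where "\<And>n w. n \<ge> 2 \<Longrightarrow> (\<And>i. i < n \<Longrightarrow> w i \<notin> U) \<Longrightarrow> inj_on w {..<n} \<Longrightarrow> pair_energy n w \<ge> (real n)\<^sup>2 * (\<rho> - \<delta>) - C * real n"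
proof -
  \<comment> \<open>\<open>9 * \<rho> + 5\<close> collects the coefficients of
    \<open>\<delta>'\<close> times \<open>n\<^sup>2\<close>: \<open>\<rho>\<close> from the energy
    itself and \<open>3 + 2 * (4 * \<rho> + 1)\<close> from the moments.\<close>
  define \<delta>' where "\<delta>' = \<delta> / (9 * \<rho> + 5)"
  have d': "\<delta>' > 0" "\<delta>' * (9 * \<rho> + 5) = \<delta>" using d \<rho>(2) by (auto simp: \<delta>'_def add_nonneg_pos)
  obtain r where r: "0 < r" "r \<le> \<epsilon>" "r \<le> 1"
    "\<And>z w c c'. cmod (c - z) \<le> 4 * r \<Longrightarrow> cmod (c' - w) \<le> 4 * r \<Longrightarrow>
      smeared_ker r c c' \<le> ennreal (1 + \<delta>') * wker z w + ennreal (\<delta>' * (3 + (cmod z)\<^sup>2 + (cmod w)\<^sup>2))"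
    using smearing_scale[OF eps d'(1)] by metis
  \<comment> \<open>The terms linear in \<open>n\<close>, coming from the diagonal: \<open>r\<close>
    is raised to 1 outside the logarithm, and the second moment to
    \<open>(4 * \<rho> + 1) * n\<close>.\<close>
  define C where "C = - ln r + 1 / 2 + 31 * (4 * \<rho> + 1) + 30"
  have "0 \<le> - ln r" using r by simp
  then have C0: "C \<ge> 0" unfolding C_def using \<rho>(2) by (intro add_nonneg_nonneg mult_nonneg_nonneg) auto
  show ?thesis
  proof (rule that[of C])
    fix n :: nat and w
    assume n: "n \<ge> 2" and w: "\<And>i. i < n \<Longrightarrow> w i \<notin> U" "inj_on w {..<n}"
    define S where "S = pair_energy n w"
    define Q where "Q = nsq n w"
    have rn: "real n \<ge> 2" using n by simp
    have S0: "S \<ge> 0" unfolding S_def by (rule pair_energy_nsq[OF w(2)])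
    have Q0: "Q \<ge> 0" by (simp add: Q_def)
    show "pair_energy n w \<ge> (real n)\<^sup>2 * (\<rho> - \<delta>) - C * real n"
    proof (cases "S \<ge> (real n)\<^sup>2 * \<rho>")
      case True
      moreover have "(real n)\<^sup>2 * (\<rho> - \<delta>) \<le> (real n)\<^sup>2 * \<rho>" using d by (intro mult_left_mono) auto
      moreover have "0 \<le> C * real n" using C0 by simp
      ultimately show ?thesis by (simp add: S_def)
    next
      case False
      then have SA: "S \<le> (real n)\<^sup>2 * \<rho>" by simp
      have "(real n - 1) * Q / 2 - real n * (real n - 1) / 2 \<le> S"
        unfolding S_def Q_def by (rule pair_energy_nsq[OF w(2)])
      then have "(real n - 1) * Q \<le> 2 * S + real n * (real n - 1)" by (simp add: field_simps)
      also have "\<dots> \<le> 2 * ((real n)\<^sup>2 * \<rho>) + real n * (real n - 1)" using SA by simp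
      also have "\<dots> \<le> (real n - 1) * ((4 * \<rho> + 1) * real n)"
      proof -
        have "2 * ((real n)\<^sup>2 * \<rho>) \<le> (2 * (real n - 1)) * (2 * (real n * \<rho>))"
        proof -
          have "real n * (2 * (real n * \<rho>)) \<le> (2 * (real n - 1)) * (2 * (real n * \<rho>))"
            using rn \<rho>(2) by (intro mult_right_mono) auto
          then show ?thesis by (simp only: power2_eq_square mult_ac)
        qed
        then show ?thesis by (simp add: algebra_simps)
      qed
      finally have Q: "Q \<le> (4 * \<rho> + 1) * real n" using rn by simp
      have "(real n)\<^sup>2 * \<rho> \<le> (1 + \<delta>') * S + \<delta>' * (3 * (real n)\<^sup>2 + 2 * real n * Q) + real n * (- ln r + 1 / 2) + (Q + 30 * r * (real n + Q))"
        unfolding S_def Q_def using n by (intro empirical_energy[OF _ w d'(1) \<rho>(1) r]) auto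
      also have "(1 + \<delta>') * S \<le> S + \<delta>' * ((real n)\<^sup>2 * \<rho>)"
        using mult_left_mono[OF SA, of \<delta>'] d' by (simp add: algebra_simps)
      also have "\<delta>' * (3 * (real n)\<^sup>2 + 2 * real n * Q) \<le> \<delta>' * (3 * (real n)\<^sup>2 + 2 * real n * ((4 * \<rho> + 1) * real n))"
        using Q d' by (intro mult_left_mono add_left_mono) auto
      also have "Q + 30 * r * (real n + Q) \<le> Q + 30 * 1 * (real n + Q)"
        using r Q0 by (intro add_left_mono mult_right_mono mult_left_mono) auto
      also have "\<dots> \<le> 31 * ((4 * \<rho> + 1) * real n) + 30 * real n" using Q by simp
      finally have "(real n)\<^sup>2 * \<rho> \<le> S + (real n)\<^sup>2 * (\<delta>' * (9 * \<rho> + 5)) + C * real n"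
        by (simp add: C_def algebra_simps power2_eq_square)
      then show ?thesis unfolding d' S_def by (simp add: algebra_simps)
    qed
  qed
qed

text \<open>The energy factor is bounded uniformly over configurations outside \<open>U\<close>; the
  Gaussian factors left over by \<open>exp_minus_pair_energy\<close> integrate to
  \<open>pi ^ n\<close>.\<close>

lemma partition_fun_upper:
  assumes \<rho>: "R_U U = ereal \<rho>" "\<rho> \<ge> 0" and d: "\<delta> > 0"
  obtains C where "\<And>n. n \<ge> 2 \<Longrightarrow> partition_fun n U \<le> ennreal (exp (- ((real n)\<^sup>2 * (\<rho> - \<delta>)) + C * real n))"
proof -
  obtain C where C: "\<And>n w. n \<ge> 2 \<Longrightarrow> (\<And>i. i < n \<Longrightarrow> w i \<notin> U) \<Longrightarrow> inj_on w {..<n} \<Longrightarrow> pair_energy n w \<ge> (real n)\<^sup>2 * (\<rho> - \<delta>) - C * real n"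
    by (rule pair_energy_lower_bound[OF \<rho> d]) blast
  show ?thesis
  proof (rule that[of "C + ln pi"])
    fix n :: nat assume n: "n \<ge> 2"
    define E where "E = exp (- ((real n)\<^sup>2 * (\<rho> - \<delta>) - C * real n))"
    have "partition_fun n U \<le> (\<integral>\<^sup>+w. ennreal E * (\<Prod>i<n. ennreal (exp (- (cmod (w i))\<^sup>2))) \<partial>LV n)"
      unfolding partition_fun_def
    proof (rule nn_integral_mono)
      fix w :: "nat \<Rightarrow> complex"
      show "(\<Prod>i<n. indicator (- U) (w i) * ennreal (exp (- (real n * (cmod (w i))\<^sup>2)))) * (\<Prod>i<n. \<Prod>j<i. ennreal ((cmod (w i - w j))\<^sup>2))
         \<le> ennreal E * (\<Prod>i<n. ennreal (exp (- (cmod (w i))\<^sup>2)))"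
      proof (cases "inj_on w {..<n} \<and> (\<forall>i<n. w i \<notin> U)")
        case True
        then have "pair_energy n w \<ge> (real n)\<^sup>2 * (\<rho> - \<delta>) - C * real n" using C[OF n] by auto
        then have "ennreal (exp (- pair_energy n w)) \<le> ennreal E" unfolding E_def by (intro ennreal_leI) simp
        moreover have "(\<Prod>i<n. indicator (- U) (w i)) = (1::ennreal)"
          using True by (intro prod.neutral) auto
        ultimately show ?thesis
          using True by (simp only: partition_fun_integrand mult_1) (rule mult_right_mono, auto)
      next
        case False
        then consider "\<not> inj_on w {..<n}" | i where "i < n" "w i \<in> U" by auto
        then show ?thesis
        proof cases
          case 1
          then show ?thesis by (simp add: partition_fun_integrand_zero)
        next
          case 2
          then have "(\<Prod>i<n. indicator (- U) (w i) * ennreal (exp (- (real n * (cmod (w i))\<^sup>2)))) = 0"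
            by (intro prod_zero) (auto intro!: bexI[of _ i])
          then show ?thesis by (simp only: mult_zero_left zero_le)
        qed
      qed
    qed
    also have "\<dots> = ennreal E * (\<integral>\<^sup>+w. (\<Prod>i<n. ennreal (exp (- (cmod (w i))\<^sup>2))) \<partial>LV n)"
      by (rule nn_integral_cmult) measurable
    also have "(\<integral>\<^sup>+w. (\<Prod>i<n. ennreal (exp (- (cmod (w i))\<^sup>2))) \<partial>LV n) = (\<Prod>i<n. ennreal pi)"
      by (subst lborelC.product_nn_integral_prod) (auto simp: nn_integral_gaussian)
    also have "ennreal E * (\<Prod>i<n. ennreal pi) = ennreal (E * pi ^ n)"
      by (simp add: ennreal_mult ennreal_power E_def)
    also have "pi ^ n = exp (ln pi * real n)"
      by (simp add: exp_of_nat2_mult)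
    also have "E * exp (ln pi * real n) = exp (- ((real n)\<^sup>2 * (\<rho> - \<delta>)) + (C + ln pi) * real n)"
      unfolding E_def exp_add[symmetric] by (intro arg_cong[where f=exp]) (simp add: algebra_simps)
    finally show "partition_fun n U \<le> ennreal (exp (- ((real n)\<^sup>2 * (\<rho> - \<delta>)) + (C + ln pi) * real n))" .
  qed
qed

end

section \<open>The lower bound for the partition function\<close>

lemma nn_integral_PiM_component:
  assumes N: "prob_space N" and "finite I" "i \<in> I" and f: "f \<in> borel_measurable N"
  shows "(\<integral>\<^sup>+w. f (w i) \<partial>PiM I (\<lambda>_. N)) = (\<integral>\<^sup>+x. f x \<partial>N)"
proof -
  interpret prob_space N by fact
  interpret P: product_sigma_finite "\<lambda>_. N" by (simp add: product_sigma_finite_def sigma_finite_measure_axioms)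
  have I: "insert i (I - {i}) = I" using assms(3) by auto
  have "prob_space (PiM (I - {i}) (\<lambda>_. N))" by (intro prob_space_PiM N)
  then interpret Q: prob_space "PiM (I - {i}) (\<lambda>_. N)" .
  have "(\<integral>\<^sup>+w. f (w i) \<partial>PiM (insert i (I - {i})) (\<lambda>_. N)) = (\<integral>\<^sup>+w. \<integral>\<^sup>+y. f ((w(i := y)) i) \<partial>N \<partial>PiM (I - {i}) (\<lambda>_. N))"
    using assms(2) f by (intro P.product_nn_integral_insert) (auto intro: measurable_compose[OF measurable_component_singleton])
  then show ?thesis unfolding I by (simp add: Q.emeasure_space_1)
qed

lemma nn_integral_PiM_pair:
  assumes N: "prob_space N" and fin: "finite I" and ij: "i \<in> I" "j \<in> I" "i \<noteq> j" and f: "case_prod f \<in> borel_measurable (N \<Otimes>\<^sub>M N)"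
  shows "(\<integral>\<^sup>+w. f (w i) (w j) \<partial>PiM I (\<lambda>_. N)) = (\<integral>\<^sup>+x. \<integral>\<^sup>+y. f y x \<partial>N \<partial>N)"
proof -
  interpret prob_space N by fact
  interpret P: product_sigma_finite "\<lambda>_. N" by (simp add: product_sigma_finite_def sigma_finite_measure_axioms)
  have I: "insert i (I - {i}) = I" using ij by auto
  have fm: "(\<lambda>w. f (w i) (w j)) \<in> borel_measurable (PiM (insert i (I - {i})) (\<lambda>_. N))"
  proof -
    have "(\<lambda>w. (w i, w j)) \<in> measurable (PiM (insert i (I - {i})) (\<lambda>_. N)) (N \<Otimes>\<^sub>M N)"
      using ij by (intro measurable_Pair measurable_component_singleton) auto
    from measurable_compose[OF this f] show ?thesis by simp
  qed
  have "(\<lambda>p. (snd p, fst p)) \<in> measurable (N \<Otimes>\<^sub>M N) (N \<Otimes>\<^sub>M N)" by measurable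
  from measurable_compose[OF this f] have f': "(\<lambda>(x, y). f y x) \<in> borel_measurable (N \<Otimes>\<^sub>M N)" by (simp add: case_prod_beta')
  have "(\<integral>\<^sup>+w. f (w i) (w j) \<partial>PiM (insert i (I - {i})) (\<lambda>_. N)) = (\<integral>\<^sup>+w. \<integral>\<^sup>+y. f ((w(i := y)) i) ((w(i := y)) j) \<partial>N \<partial>PiM (I - {i}) (\<lambda>_. N))"
    using fin by (intro P.product_nn_integral_insert fm) auto
  also have "\<dots> = (\<integral>\<^sup>+w. (\<lambda>x. \<integral>\<^sup>+y. f y x \<partial>N) (w j) \<partial>PiM (I - {i}) (\<lambda>_. N))"
    using ij by simp
  also have "\<dots> = (\<integral>\<^sup>+x. \<integral>\<^sup>+y. f y x \<partial>N \<partial>N)"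
    using ij fin by (intro nn_integral_PiM_component N borel_measurable_nn_integral f') auto
  finally show ?thesis unfolding I .
qed

context exterior_ball_set
begin

text \<open>Jensen's inequality for \<open>exp\<close> under the \<open>n\<close>-fold product of \<open>\<nu>\<close>, in the form
  \<open>exp (- m) (1 + m - x) \<le> exp (- x)\<close>.\<close>
lemma partition_fun_jensen:
  assumes f[measurable]: "f \<in> borel_measurable borel" and f0: "\<And>x. x \<in> U \<Longrightarrow> f x = 0" and fk: "\<And>x. f x \<le> ennreal k" and k: "k > 0"
    and \<nu>: "\<nu> = density lborel f" "prob_space \<nu>"
    and a: "wenergy \<nu> \<le> ennreal a" "a \<ge> 0" and q: "(\<integral>\<^sup>+x. ennreal ((cmod x)\<^sup>2) \<partial>\<nu>) \<le> ennreal q" "q \<ge> 0"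
  shows "ennreal (exp (- ((real n)\<^sup>2 * a + real n * q))) \<le> ennreal (k ^ n) * partition_fun n U"
proof -
  define P where "P = PiM {..<n} (\<lambda>_. \<nu>)"
  define F where "F w = (\<Prod>i<n. f (w i))" for w
  \<comment> \<open>An upper bound for the mean of \<open>X\<close> under the product measure, with
    the \<open>n (n - 1)\<close> ordered pairs rounded up to \<open>n\<^sup>2\<close>.\<close>
  define m where "m = (real n)\<^sup>2 * a + real n * q"
  have m0: "m \<ge> 0" using a q by (simp add: m_def)
  have [measurable_cong]: "sets \<nu> = sets borel" by (simp add: \<nu>)
  interpret \<nu>: prob_space \<nu> by (rule \<nu>(2))
  have "prob_space P" unfolding P_def by (intro prob_space_PiM \<nu>(2))
  then interpret P: prob_space P .
  have Pd: "P = density (LV n) F"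
    unfolding P_def F_def \<nu>(1) by (rule PiM_density) (use \<nu>.sigma_finite_measure_axioms \<nu>(1) in \<open>auto intro: sigma_finite_lborel\<close>)
  have comp: "(\<lambda>w. w i) \<in> borel_measurable (LV n)" if "i < n" for i using that by (rule LV_components)
  have Fm[measurable]: "F \<in> borel_measurable (LV n)"
    unfolding F_def[abs_def] by (intro borel_measurable_prod_ennreal measurable_compose[OF comp f]) auto
  define X where "X w = (\<Sum>i<n. \<Sum>j\<in>{..<n} - {i}. wker (w i) (w j)) + (\<Sum>i<n. ennreal ((cmod (w i))\<^sup>2))" for w
  have Xm[measurable]: "X \<in> borel_measurable (LV n)"
    unfolding X_def[abs_def]
    by (intro borel_measurable_add borel_measurable_sum measurable_wker comp measurable_compose[OF _ measurable_ennreal] borel_measurable_power borel_measurable_norm) auto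
  have kp: "case_prod wker \<in> borel_measurable (\<nu> \<Otimes>\<^sub>M \<nu>)"
    unfolding case_prod_beta' by measurable
  have XP: "(\<integral>\<^sup>+w. X w \<partial>P) \<le> ennreal m"
  proof -
    have mP: "sets P = sets (LV n)" by (simp add: Pd)
    have kP: "(\<lambda>w. wker (w i) (w j)) \<in> borel_measurable P" if "i < n" "j < n" for i j
      unfolding measurable_cong_sets[OF mP refl] using that by (intro measurable_wker comp)
    have qP: "(\<lambda>w. ennreal ((cmod (w i))\<^sup>2)) \<in> borel_measurable P" if "i < n" for i
      unfolding measurable_cong_sets[OF mP refl] using comp[OF that] by measurable
    have kI: "(\<integral>\<^sup>+w. wker (w i) (w j) \<partial>P) = wenergy \<nu>" if "i < n" "j < n" "i \<noteq> j" for i j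
    proof -
      have "(\<integral>\<^sup>+w. wker (w i) (w j) \<partial>P) = (\<integral>\<^sup>+x. \<integral>\<^sup>+y. wker y x \<partial>\<nu> \<partial>\<nu>)"
        unfolding P_def using that by (intro nn_integral_PiM_pair \<nu>(2) kp) auto
      moreover have "wker y x = wker x y" for x y by (auto simp: wker_def wker_real_commute)
      ultimately show ?thesis by (simp add: wenergy_def)
    qed
    have qI: "(\<integral>\<^sup>+w. ennreal ((cmod (w i))\<^sup>2) \<partial>P) = (\<integral>\<^sup>+x. ennreal ((cmod x)\<^sup>2) \<partial>\<nu>)" if "i < n" for i
      unfolding P_def using that nn_integral_PiM_component[OF \<nu>(2), of "{..<n}" i "\<lambda>x. ennreal ((cmod x)\<^sup>2)"] by simp
    have "(\<integral>\<^sup>+w. X w \<partial>P) = (\<Sum>i<n. \<Sum>j\<in>{..<n} - {i}. wenergy \<nu>) + (\<Sum>i<n. \<integral>\<^sup>+x. ennreal ((cmod x)\<^sup>2) \<partial>\<nu>)"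
    proof -
      have "(\<integral>\<^sup>+w. X w \<partial>P) = (\<integral>\<^sup>+w. (\<Sum>i<n. \<Sum>j\<in>{..<n} - {i}. wker (w i) (w j)) \<partial>P) + (\<integral>\<^sup>+w. (\<Sum>i<n. ennreal ((cmod (w i))\<^sup>2)) \<partial>P)"
        unfolding X_def using kP qP by (intro nn_integral_add borel_measurable_sum) auto
      also have "(\<integral>\<^sup>+w. (\<Sum>i<n. ennreal ((cmod (w i))\<^sup>2)) \<partial>P) = (\<Sum>i<n. \<integral>\<^sup>+w. ennreal ((cmod (w i))\<^sup>2) \<partial>P)"
        using qP by (intro nn_integral_sum) auto
      also have "\<dots> = (\<Sum>i<n. \<integral>\<^sup>+x. ennreal ((cmod x)\<^sup>2) \<partial>\<nu>)" by (intro sum.cong refl qI) auto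
      also have "(\<integral>\<^sup>+w. (\<Sum>i<n. \<Sum>j\<in>{..<n} - {i}. wker (w i) (w j)) \<partial>P) = (\<Sum>i<n. \<integral>\<^sup>+w. (\<Sum>j\<in>{..<n} - {i}. wker (w i) (w j)) \<partial>P)"
        using kP by (intro nn_integral_sum borel_measurable_sum) auto
      also have "\<dots> = (\<Sum>i<n. \<Sum>j\<in>{..<n} - {i}. \<integral>\<^sup>+w. wker (w i) (w j) \<partial>P)"
        using kP by (intro sum.cong refl nn_integral_sum) auto
      also have "\<dots> = (\<Sum>i<n. \<Sum>j\<in>{..<n} - {i}. wenergy \<nu>)" using kI by (intro sum.cong refl) auto
      finally show ?thesis .
    qed
    also have "\<dots> \<le> (\<Sum>i<n. \<Sum>j<n. ennreal a) + (\<Sum>i<n. ennreal q)"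
      using a q by (intro add_mono sum_mono order_trans[OF sum_mono sum_mono2]) auto
    also have "\<dots> = ennreal m"
      using a q by (simp add: m_def power2_eq_square ennreal_mult ennreal_of_nat_eq_real_of_nat mult.assoc)
    finally show ?thesis .
  qed
  define H where "H w = (\<Prod>i<n. indicator (- U) (w i) * ennreal (exp (- (real n * (cmod (w i))\<^sup>2)))) * (\<Prod>i<n. \<Prod>j<i. ennreal ((cmod (w i - w j))\<^sup>2))" for w :: "nat \<Rightarrow> complex"
  have Um[measurable]: "indicator (- U) \<in> borel_measurable borel"
    using U(1) by (intro borel_measurable_indicator) auto
  have Hm[measurable]: "H \<in> borel_measurable (LV n)"
    unfolding H_def[abs_def]
    by (intro borel_measurable_times_ennreal borel_measurable_prod_ennreal measurable_compose[OF comp Um] measurable_compose[OF _ measurable_ennreal]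
        borel_measurable_power borel_measurable_norm borel_measurable_diff borel_measurable_exp borel_measurable_uminus borel_measurable_times)
       (auto intro: comp)
  \<comment> \<open>A point in \<open>U\<close> makes \<open>F w\<close> vanish, and an infinite
    \<open>X w\<close> makes the right side infinite unless \<open>F w = 0\<close>, when the left
    side is 0. In the remaining case finiteness of \<open>X w\<close> forces the points to be
    distinct, so that \<open>H w\<close> is \<open>exp (- x)\<close>.\<close>
  have pt: "ennreal (exp (- m) * (1 + m)) * F w \<le> ennreal (k ^ n) * H w + ennreal (exp (- m)) * (F w * X w)" for w
  proof -
    consider i where "i < n" "w i \<in> U" | "X w = \<infinity>" "F w \<noteq> 0" | "\<forall>i<n. w i \<notin> U" "X w \<noteq> \<infinity>"
      | "F w = 0" by blast
    then show ?thesis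
    proof cases
      case 1
      then have "F w = 0" unfolding F_def using f0 by (intro prod_zero) auto
      then show ?thesis by simp
    next
      case 2
      then show ?thesis by (simp add: ennreal_mult_top ennreal_top_mult)
    next
      case 3
      have inj: "inj_on w {..<n}"
      proof (rule inj_onI, rule ccontr)
        fix i j assume ij: "i \<in> {..<n}" "j \<in> {..<n}" "w i = w j" "i \<noteq> j"
        then have "wker (w i) (w j) = \<infinity>" by (simp add: wker_def)
        moreover have "\<forall>i\<in>{..<n}. \<forall>j\<in>{..<n} - {i}. wker (w i) (w j) \<noteq> \<infinity>"
          using 3(2) by (simp add: X_def)
        ultimately show False using ij by blast
      qed
      have kr: "wker (w i) (w j) = ennreal (wker_real (w i) (w j))" "wker_real (w i) (w j) \<ge> 0" if "i < n" "j \<in> {..<n} - {i}" for i j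
        using inj_onD[OF inj, of i j] wker_real_ge(2)[of "w i" "w j"] that by (auto simp: wker_def)
      define x where "x = pair_energy n w + (\<Sum>i<n. (cmod (w i))\<^sup>2)"
      have SS0: "pair_energy n w \<ge> 0" by (rule pair_energy_nsq[OF inj])
      have Xx: "X w = ennreal x"
      proof -
        have "(\<Sum>i<n. \<Sum>j\<in>{..<n} - {i}. wker (w i) (w j)) = (\<Sum>i<n. ennreal (\<Sum>j\<in>{..<n} - {i}. wker_real (w i) (w j)))"
        proof (rule sum.cong[OF refl])
          fix i assume "i \<in> {..<n}"
          then show "(\<Sum>j\<in>{..<n} - {i}. wker (w i) (w j)) = ennreal (\<Sum>j\<in>{..<n} - {i}. wker_real (w i) (w j))"
            using kr by (subst sum_ennreal[symmetric]) (auto intro!: sum.cong)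
        qed
        also have "\<dots> = ennreal (pair_energy n w)"
          unfolding pair_energy_def using kr by (intro sum_ennreal sum_nonneg) auto
        finally show ?thesis
          unfolding X_def x_def using SS0 by (simp add: sum_ennreal sum_nonneg ennreal_plus)
      qed
      have Hx: "H w = ennreal (exp (- x))"
      proof -
        have "(\<Prod>i<n. indicator (- U) (w i)) = (1::ennreal)" using 3 by (intro prod.neutral) auto
        then have "H w = ennreal (exp (- pair_energy n w)) * (\<Prod>i<n. ennreal (exp (- (cmod (w i))\<^sup>2)))"
          unfolding H_def partition_fun_integrand[OF inj] by simp
        also have "(\<Prod>i<n. ennreal (exp (- (cmod (w i))\<^sup>2))) = ennreal (exp (- (\<Sum>i<n. (cmod (w i))\<^sup>2)))"
          by (simp add: prod_ennreal exp_sum sum_negf[symmetric])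
        finally show ?thesis
          by (simp add: x_def ennreal_mult[symmetric] exp_add[symmetric])
      qed
      have "F w \<le> (\<Prod>i<n. ennreal k)" unfolding F_def  by (intro prod_mono_ennreal fk)
      then have Fk: "F w \<le> ennreal (k ^ n)" using k by (simp add: ennreal_power)
      have "exp (- m) * (1 + (m - x)) \<le> exp (- m) * exp (m - x)"
        by (intro mult_left_mono exp_ge_add_one_self) auto
      also have "\<dots> = exp (- x)" by (simp add: exp_add[symmetric])
      finally have "exp (- m) * (1 + m) \<le> exp (- x) + exp (- m) * x" by (simp add: algebra_simps)
      then have "ennreal (exp (- m) * (1 + m)) \<le> ennreal (exp (- x) + exp (- m) * x)" by (rule ennreal_leI)
      also have "\<dots> = H w + ennreal (exp (- m)) * X w"
        unfolding Hx Xx using SS0 by (simp add: x_def sum_nonneg ennreal_mult)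
      finally have "ennreal (exp (- m) * (1 + m)) * F w \<le> (H w + ennreal (exp (- m)) * X w) * F w"
        by (rule mult_right_mono) simp
      also have "\<dots> = F w * H w + ennreal (exp (- m)) * (F w * X w)"
        by (simp only: distrib_left distrib_right mult_ac)
      also have "\<dots> \<le> ennreal (k ^ n) * H w + ennreal (exp (- m)) * (F w * X w)"
        using Fk by (intro add_right_mono mult_right_mono) auto
      finally show ?thesis .
    next
      case 4
      then show ?thesis by simp
    qed
  qed
  have F1: "(\<integral>\<^sup>+w. F w \<partial>LV n) = 1"
  proof -
    have "(\<integral>\<^sup>+w. F w \<partial>LV n) = (\<integral>\<^sup>+w. F w * indicator (space (LV n)) w \<partial>LV n)"
      by (intro nn_integral_cong) simp
    also have "\<dots> = emeasure P (space (LV n))" unfolding Pd by (rule emeasure_density[symmetric]) auto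
    also have "\<dots> = 1" using P.emeasure_space_1 by (simp add: Pd)
    finally show ?thesis .
  qed
  have "ennreal (exp (- m) * (1 + m)) = (\<integral>\<^sup>+w. ennreal (exp (- m) * (1 + m)) * F w \<partial>LV n)"
    by (subst nn_integral_cmult) (auto simp: F1)
  also have "\<dots> \<le> (\<integral>\<^sup>+w. ennreal (k ^ n) * H w + ennreal (exp (- m)) * (F w * X w) \<partial>LV n)"
    by (intro nn_integral_mono pt)
  also have "\<dots> = ennreal (k ^ n) * partition_fun n U + ennreal (exp (- m)) * (\<integral>\<^sup>+w. F w * X w \<partial>LV n)"
    unfolding partition_fun_def H_def[symmetric] by (simp add: nn_integral_add nn_integral_cmult)
  also have "(\<integral>\<^sup>+w. F w * X w \<partial>LV n) = (\<integral>\<^sup>+w. X w \<partial>P)"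
    unfolding Pd by (rule nn_integral_density[symmetric]) measurable
  also have "ennreal (k ^ n) * partition_fun n U + ennreal (exp (- m)) * (\<integral>\<^sup>+w. X w \<partial>P) \<le> ennreal (k ^ n) * partition_fun n U + ennreal (exp (- m)) * ennreal m"
    by (intro add_left_mono mult_left_mono XP) auto
  finally have "ennreal (exp (- m) * (1 + m)) \<le> ennreal (k ^ n) * partition_fun n U + ennreal (exp (- m) * m)"
    using m0 by (simp add: ennreal_mult)
  moreover have "ennreal (exp (- m) * (1 + m)) = ennreal (exp (- m)) + ennreal (exp (- m) * m)"
    using m0 by (simp add: distrib_left)
  ultimately show ?thesis
    unfolding m_def[symmetric] by (simp add: ennreal_add_left_cancel_le add.commute)
qed

lemma partition_fun_lower:
  assumes \<rho>: "R_U U = ereal \<rho>" "\<rho> \<ge> 0" and d: "\<delta> > 0"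
  obtains C where "\<And>n. partition_fun n U \<ge> ennreal (exp (- ((real n)\<^sup>2 * (\<rho> + \<delta>)) - C * real n))"
proof -
  have "R_U U < ereal (\<rho> + \<delta>)" using \<rho> d by simp
  then obtain \<mu> where \<mu>: "\<mu> \<in> cprob_measures (- U)" "energy \<mu> < ereal (\<rho> + \<delta>)"
    unfolding R_U_def INF_less_iff by blast
  have sets: "sets \<mu> = sets borel" and ps: "prob_space \<mu>" using \<mu>(1) by (auto simp: cprob_measures_def)
  interpret prob_space \<mu> by (rule ps)
  obtain K where K: "compact K" "K \<subseteq> - U" "emeasure \<mu> (UNIV - K) = 0"
    using \<mu>(1) by (auto simp: cprob_measures_def)
  obtain B where B: "\<And>z. z \<in> K \<Longrightarrow> cmod z \<le> B" "B > 0"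
    using compact_imp_bounded[OF K(1)] unfolding bounded_pos by auto
  have "UNIV - K \<in> null_sets \<mu>"
    using K by (auto simp: null_sets_def sets compact_imp_closed borel_closed borel_open)
  then have "AE z in \<mu>. z \<notin> UNIV - K" by (rule AE_not_in)
  then have AEK: "AE z in \<mu>. z \<notin> U \<and> cmod z \<le> B"
    by eventually_elim (use K(2) B in auto)
  have "enn2ereal (wenergy \<mu>) < ereal (\<rho> + \<delta>)" using \<mu> energy_eq_wenergy by metis
  then obtain A where A: "wenergy \<mu> = ennreal A" "A \<ge> 0" "A < \<rho> + \<delta>"
    by (cases "wenergy \<mu>") (auto simp: enn2ereal_ennreal)
  \<comment> \<open>Chosen so that the total smearing error, \<open>\<delta>'\<close> times
    \<open>A + 3 + 2 B^2\<close>, exactly fills the gap between \<open>A\<close> and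
    \<open>\<rho> + \<delta>\<close>.\<close>
  define \<delta>' where "\<delta>' = (\<rho> + \<delta> - A) / (A + (3 + B\<^sup>2 + B\<^sup>2))"
  have den: "A + (3 + B\<^sup>2 + B\<^sup>2) > 0" using A by (intro add_nonneg_pos add_pos_nonneg) auto
  have d': "\<delta>' > 0" "\<delta>' * (A + (3 + B\<^sup>2 + B\<^sup>2)) = \<rho> + \<delta> - A" using A den by (auto simp: \<delta>'_def)
  obtain r where r: "0 < r" "r \<le> \<epsilon>" "r \<le> 1"
    "\<And>z w c c'. cmod (c - z) \<le> 4 * r \<Longrightarrow> cmod (c' - w) \<le> 4 * r \<Longrightarrow>
      smeared_ker r c c' \<le> ennreal (1 + \<delta>') * wker z w + ennreal (\<delta>' * (3 + (cmod z)\<^sup>2 + (cmod w)\<^sup>2))"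
    using smearing_scale[OF eps d'(1)] by metis
  obtain T where T: "T \<in> borel_measurable borel" "\<And>z. z \<notin> U \<Longrightarrow> cmod (T z - z) \<le> 4 * r" "\<And>z. z \<notin> U \<Longrightarrow> ball (T z) r \<subseteq> - U"
    using exterior_ball_map[OF U(1) r(1,2) ext] by metis
  define \<nu> where "\<nu> = smear \<mu> T r"
  note ctx = sets ps T(1) r(1)
  have wenergy: "wenergy \<nu> \<le> ennreal (\<rho> + \<delta>)"
  proof -
    have km: "(\<lambda>w. wker z w) \<in> borel_measurable \<mu>" for z
      unfolding measurable_cong_sets[OF sets refl] by measurable
    have km2: "(\<lambda>z. \<integral>\<^sup>+w. wker z w \<partial>\<mu>) \<in> borel_measurable \<mu>"
      by (rule borel_measurable_nn_integral)
         (simp add: case_prod_beta' measurable_cong_sets[OF sets_pair_measure_cong[OF sets sets] refl])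
    have "wenergy \<nu> = (\<integral>\<^sup>+z. \<integral>\<^sup>+w. smeared_ker r (T z) (T w) \<partial>\<mu> \<partial>\<mu>)"
      unfolding \<nu>_def by (rule wenergy_smear[OF ctx])
    also have "\<dots> \<le> (\<integral>\<^sup>+z. \<integral>\<^sup>+w. ennreal (1 + \<delta>') * wker z w + ennreal (\<delta>' * (3 + B\<^sup>2 + B\<^sup>2)) \<partial>\<mu> \<partial>\<mu>)"
    proof (rule nn_integral_mono_AE, use AEK in eventually_elim, rule nn_integral_mono_AE, use AEK in eventually_elim)
      fix z w assume zw: "z \<notin> U \<and> cmod z \<le> B" "w \<notin> U \<and> cmod w \<le> B"
      have "(cmod z)\<^sup>2 \<le> B\<^sup>2" "(cmod w)\<^sup>2 \<le> B\<^sup>2" using zw by (auto intro!: power_mono)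
      then have "ennreal (\<delta>' * (3 + (cmod z)\<^sup>2 + (cmod w)\<^sup>2)) \<le> ennreal (\<delta>' * (3 + B\<^sup>2 + B\<^sup>2))"
        using d' by (intro ennreal_leI mult_left_mono) auto
      then show "smeared_ker r (T z) (T w) \<le> ennreal (1 + \<delta>') * wker z w + ennreal (\<delta>' * (3 + B\<^sup>2 + B\<^sup>2))"
        using r(4)[OF T(2) T(2), of z w] zw by (auto intro: order_trans add_left_mono)
    qed
    also have "\<dots> = (\<integral>\<^sup>+z. ennreal (1 + \<delta>') * (\<integral>\<^sup>+w. wker z w \<partial>\<mu>) + ennreal (\<delta>' * (3 + B\<^sup>2 + B\<^sup>2)) \<partial>\<mu>)"
      using km by (simp add: nn_integral_add nn_integral_cmult emeasure_space_1)
    also have "\<dots> = ennreal (1 + \<delta>') * wenergy \<mu> + ennreal (\<delta>' * (3 + B\<^sup>2 + B\<^sup>2))"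
      unfolding wenergy_def using km2 by (simp add: nn_integral_add nn_integral_cmult emeasure_space_1)
    also have "\<dots> = ennreal ((1 + \<delta>') * A + \<delta>' * (3 + B\<^sup>2 + B\<^sup>2))"
      unfolding A(1) using A(2) d' by (subst ennreal_plus) (auto simp: ennreal_mult)
    also have "(1 + \<delta>') * A + \<delta>' * (3 + B\<^sup>2 + B\<^sup>2) = A + \<delta>' * (A + (3 + B\<^sup>2 + B\<^sup>2))" by (simp add: algebra_simps)
    also have "\<dots> = \<rho> + \<delta>" unfolding d' by simp
    finally show ?thesis .
  qed
  \<comment> \<open>The bound \<open>sq_bound r z\<close> with \<open>r\<close> raised to 1 outside
    and \<open>|z|\<close> to \<open>B\<close>; it serves as second moment of the smeared
    measure.\<close>
  define q where "q = B\<^sup>2 + 30 * 1 * (1 + B\<^sup>2)"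
  have Q: "(\<integral>\<^sup>+x. ennreal ((cmod x)\<^sup>2) \<partial>\<nu>) \<le> ennreal q"
  proof -
    have "(\<integral>\<^sup>+x. ennreal ((cmod x)\<^sup>2) \<partial>\<nu>) = (\<integral>\<^sup>+z. avg r (T z) (\<lambda>x. ennreal ((cmod x)\<^sup>2)) \<partial>\<mu>)"
      unfolding \<nu>_def by (rule nn_integral_smear[OF ctx]) measurable
    also have "\<dots> \<le> (\<integral>\<^sup>+z. ennreal q \<partial>\<mu>)"
    proof (rule nn_integral_mono_AE, use AEK in eventually_elim)
      fix z assume z: "z \<notin> U \<and> cmod z \<le> B"
      have zB: "(cmod z)\<^sup>2 \<le> B\<^sup>2" using z by (auto intro!: power_mono)
      have "(cmod x)\<^sup>2 \<le> q" if "x \<in> ball (T z) r" for x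
      proof -
        have "(cmod x)\<^sup>2 \<le> sq_bound r z" using sq_bound_bound[OF r(1,3) T(2) that] z by simp
        also have "\<dots> \<le> q" unfolding sq_bound_def q_def using zB r
          by (intro add_mono mult_mono) auto
        finally show ?thesis .
      qed
      then have "avg r (T z) (\<lambda>x. ennreal ((cmod x)\<^sup>2)) \<le> avg r (T z) (\<lambda>_. ennreal q)"
        by (intro avg_mono_AE) (auto intro!: ennreal_leI)
      then show "avg r (T z) (\<lambda>x. ennreal ((cmod x)\<^sup>2)) \<le> ennreal q" by (simp add: avg_const[OF r(1)])
    qed
    also have "\<dots> = ennreal q" by (simp add: emeasure_space_1)
    finally show ?thesis .
  qed
  have q0: "q \<ge> 0" by (simp add: q_def)
  define k where "k = 1 / (pi * r\<^sup>2)"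
  have k: "k > 0" using r by (simp add: k_def)
  show ?thesis
  \<comment> \<open>\<open>q\<close> is the cost of the leftover Gaussian factors, and
    \<open>ln k\<close> that of moving \<open>k ^ n\<close> to the other side.\<close>
  proof (rule that[of "q + ln k"])
    fix n
    have "ennreal (exp (- ((real n)\<^sup>2 * (\<rho> + \<delta>) + real n * q))) \<le> ennreal (k ^ n) * partition_fun n U"
    proof (rule partition_fun_jensen[where f="sden \<mu> T r" and \<nu>=\<nu>])
      show "sden \<mu> T r \<in> borel_measurable borel" by (rule measurable_sden[OF ctx])
      show "sden \<mu> T r x = 0" if "x \<in> U" for x by (rule smear_cprob(2)[OF ctx U(1) AEK T(2,3) that])
      show "sden \<mu> T r x \<le> ennreal k" for x unfolding k_def by (rule sden_le[OF ctx])
      show "\<nu> = density lborel (sden \<mu> T r)" by (simp add: \<nu>_def smear_def)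
      show "prob_space \<nu>" unfolding \<nu>_def by (rule prob_space_smear[OF ctx])
      show "0 \<le> \<rho> + \<delta>" using \<rho> d by simp
    qed (use k wenergy Q q0 in auto)
    then have "ennreal (inverse (k ^ n)) * ennreal (exp (- ((real n)\<^sup>2 * (\<rho> + \<delta>) + real n * q))) \<le> ennreal (inverse (k ^ n)) * (ennreal (k ^ n) * partition_fun n U)"
      by (rule mult_left_mono) simp
    also have "\<dots> = partition_fun n U"
      using k by (simp add: mult.assoc[symmetric] ennreal_mult[symmetric])
    finally have "ennreal (inverse (k ^ n) * exp (- ((real n)\<^sup>2 * (\<rho> + \<delta>) + real n * q))) \<le> partition_fun n U"
      using k by (simp add: ennreal_mult)
    moreover have "k ^ n = exp (ln k * real n)" using k by (simp add: exp_of_nat2_mult)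
    then have "inverse (k ^ n) * exp (- ((real n)\<^sup>2 * (\<rho> + \<delta>) + real n * q)) = exp (- ((real n)\<^sup>2 * (\<rho> + \<delta>)) - (q + ln k) * real n)"
      unfolding \<open>k ^ n = _\<close> exp_minus[symmetric] exp_add[symmetric] by (intro arg_cong[where f=exp]) (simp add: algebra_simps)
    ultimately show "partition_fun n U \<ge> ennreal (exp (- ((real n)\<^sup>2 * (\<rho> + \<delta>)) - (q + ln k) * real n))" by simp
  qed
qed

section \<open>The limit\<close>

lemma partition_fun_pos_finite:
  assumes "n \<ge> 2"
  shows "0 < partition_fun n U" "partition_fun n U < \<infinity>"
proof -
  obtain \<rho> where \<rho>: "R_U U = ereal \<rho>" "\<rho> \<ge> 0" by (rule R_U_finite)
  obtain C1 where "partition_fun n U \<ge> ennreal (exp (- ((real n)\<^sup>2 * (\<rho> + 1)) - C1 * real n))" by (rule partition_fun_lower[OF \<rho>, of 1]) auto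
  then show "0 < partition_fun n U" by (rule less_le_trans[rotated]) simp
  obtain C2 where "partition_fun n U \<le> ennreal (exp (- ((real n)\<^sup>2 * (\<rho> - 1)) + C2 * real n))" by (rule partition_fun_upper[OF \<rho>, of 1]) (use assms in auto)
  then show "partition_fun n U < \<infinity>" by (rule le_less_trans) simp
qed

lemma partition_fun_limit:
  assumes \<rho>: "R_U U = ereal \<rho>" "\<rho> \<ge> 0"
  shows "(\<lambda>n. ln (enn2real (partition_fun n U)) / (real n)\<^sup>2) \<longlonglongrightarrow> - \<rho>"
proof (rule LIMSEQ_I)
  fix e :: real assume e: "e > 0"
  \<comment> \<open>Half of \<open>e\<close> pays for the energy error, the other half for the
    linear terms, which become at most \<open>C / n\<close>.\<close>
  define \<delta> where "\<delta> = e / 2"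
  have d: "\<delta> > 0" using e by (simp add: \<delta>_def)
  obtain C1 where C1: "\<And>n. partition_fun n U \<ge> ennreal (exp (- ((real n)\<^sup>2 * (\<rho> + \<delta>)) - C1 * real n))"
    by (rule partition_fun_lower[OF \<rho> d]) blast
  obtain C2 where C2: "\<And>n. n \<ge> 2 \<Longrightarrow> partition_fun n U \<le> ennreal (exp (- ((real n)\<^sup>2 * (\<rho> - \<delta>)) + C2 * real n))"
    by (rule partition_fun_upper[OF \<rho> d]) blast
  define C where "C = max \<bar>C1\<bar> \<bar>C2\<bar>"
  obtain N :: nat where N: "C / \<delta> < real N" using reals_Archimedean2 by blast
  show "\<exists>no. \<forall>n\<ge>no. norm (ln (enn2real (partition_fun n U)) / (real n)\<^sup>2 - - \<rho>) < e"
  proof (intro exI allI impI)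
    fix n assume n: "n \<ge> max 2 N"
    then have n2: "n \<ge> 2" and n0: "real n > 0" by auto
    define x where "x = enn2real (partition_fun n U)"
    have X: "partition_fun n U = ennreal x" and x0: "x > 0"
      using partition_fun_pos_finite[OF n2] by (auto simp: x_def enn2real_positive_iff)
    have l1: "exp (- ((real n)\<^sup>2 * (\<rho> + \<delta>)) - C1 * real n) \<le> x"
      using C1[of n] x0 by (simp add: X)
    have l2: "x \<le> exp (- ((real n)\<^sup>2 * (\<rho> - \<delta>)) + C2 * real n)"
      using C2[OF n2] x0 by (simp add: X)
    have "- ((real n)\<^sup>2 * (\<rho> + \<delta>)) - C1 * real n \<le> ln x"
      using l1 x0 by (simp add: ln_ge_iff)
    moreover have "ln x \<le> - ((real n)\<^sup>2 * (\<rho> - \<delta>)) + C2 * real n"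
      using l2 x0 by (metis exp_gt_zero ln_exp ln_le_cancel_iff)
    moreover have "C1 * real n \<le> C * real n" "C2 * real n \<le> C * real n"
      using n0 by (auto intro!: mult_right_mono simp: C_def)
    moreover have "C * real n < \<delta> * (real n)\<^sup>2"
    proof -
      have "C < \<delta> * real N" using N d by (simp add: field_simps)
      also have "\<dots> \<le> \<delta> * real n" using n d by (intro mult_left_mono) auto
      finally show ?thesis using n0 by (simp add: power2_eq_square)
    qed
    ultimately have b: "\<bar>ln x + \<rho> * (real n)\<^sup>2\<bar> < e * (real n)\<^sup>2"
      unfolding \<delta>_def by (simp add: abs_less_iff algebra_simps)
    have "ln x / (real n)\<^sup>2 - - \<rho> = (ln x + \<rho> * (real n)\<^sup>2) / (real n)\<^sup>2"
      using n0 by (simp add: field_simps)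
    then show "norm (ln (enn2real (partition_fun n U)) / (real n)\<^sup>2 - - \<rho>) < e"
      using b n0 unfolding x_def[symmetric] by (simp add: abs_divide divide_less_eq)
  qed
qed

end

lemma ln_fact_le: "ln (fact n) \<le> real n * ln (real n)"
proof (cases "n = 0")
  case False
  have "fact n \<le> real n ^ n" using fact_le_power[of n, where 'a=real] by simp
  then have "ln (fact n) \<le> ln (real n ^ n)" using False by (subst ln_le_cancel_iff) auto
  then show ?thesis using False by (simp add: ln_realpow)
qed simp

theorem theorem1p5:
  fixes U :: "complex set"
  assumes "open U" and "U \<subseteq> ball 0 1"
    and "\<exists>\<epsilon>>0. \<forall>z \<in> frontier U. \<exists>\<eta>. \<eta> \<notin> U \<and> ball \<eta> \<epsilon> \<subseteq> - U \<and> cmod (z - \<eta>) = \<epsilon>"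
  shows "(\<lambda>n. ereal (ln (hole_prob n U) / (real n)\<^sup>2)) \<longlonglongrightarrow> R_empty - R_U U"
proof -
  obtain \<epsilon> where \<epsilon>: "\<epsilon> > 0" "\<And>z. z \<in> frontier U \<Longrightarrow> \<exists>\<eta>. ball \<eta> \<epsilon> \<subseteq> - U \<and> cmod (z - \<eta>) = \<epsilon>"
    using assms(3) by blast
  interpret V: exterior_ball_set U \<epsilon> by standard (use assms(1,2) \<epsilon> in auto)
  \<comment> \<open>The empty hole is an instance with empty frontier. It supplies the
    normalisation, and \<open>R_U {}\<close> is \<open>R_empty\<close> because its competitors may
    live anywhere in the plane.\<close>
  interpret E: exterior_ball_set "{}" 1 by standard auto
  obtain \<rho> where \<rho>: "R_U U = ereal \<rho>" "\<rho> \<ge> 0" by (rule V.R_U_finite)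
  obtain \<sigma> where \<sigma>: "R_U {} = ereal \<sigma>" "\<sigma> \<ge> 0" by (rule E.R_U_finite)
  have R: "R_empty - R_U U = ereal (\<sigma> - \<rho>)" using \<rho>(1) \<sigma>(1) by (simp add: R_empty_def R_U_def)
  define x where "x n = enn2real (partition_fun n U)" for n
  define y where "y n = enn2real (partition_fun n {})" for n
  have lim: "(\<lambda>n. ln (x n) / (real n)\<^sup>2) \<longlonglongrightarrow> - \<rho>" "(\<lambda>n. ln (y n) / (real n)\<^sup>2) \<longlonglongrightarrow> - \<sigma>"
    unfolding x_def y_def by (rule V.partition_fun_limit[OF \<rho>], rule E.partition_fun_limit[OF \<sigma>])
  have bound: "\<bar>ln (hole_prob n U) - (ln (x n) - ln (y n))\<bar> \<le> real n * ln (real n)" if n: "n \<ge> 2" for n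
  proof -
    define h where "h = hole_prob n U"
    have h0: "h \<ge> 0" by (simp add: h_def hole_prob_def)
    have X: "partition_fun n U = ennreal (x n)" "x n > 0" and Y: "partition_fun n {} = ennreal (y n)" "y n > 0"
      using V.partition_fun_pos_finite[OF n] E.partition_fun_pos_finite[OF n] by (auto simp: x_def y_def enn2real_positive_iff)
    note * = hole_prob_partition_fun[OF assms(1) _ E.partition_fun_pos_finite[OF n], unfolded X Y h_def[symmetric]]
    have f: "(fact n :: ennreal) = ennreal (fact n)" by (metis ennreal_of_nat_eq_real_of_nat of_nat_fact)
    have "ennreal (h * y n) \<le> ennreal (fact n * x n)"
      using *(1) n h0 X(2) Y(2) by (simp add: f ennreal_mult)
    then have 1: "h * y n \<le> fact n * x n" using X(2) by simp
    have "ennreal (x n) \<le> ennreal (fact n * h * y n)"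
      using *(2) n h0 X(2) Y(2) by (simp add: f ennreal_mult)
    then have 2: "x n \<le> fact n * h * y n" using h0 Y(2) by simp
    have hp: "h > 0" using 2 X(2) Y(2) h0 by (cases "h = 0") auto
    have "ln (h * y n) \<le> ln (fact n * x n)" using 1 hp X(2) Y(2) by (subst ln_le_cancel_iff) auto
    moreover have "ln (x n) \<le> ln (fact n * h * y n)" using 2 hp X(2) Y(2) by (subst ln_le_cancel_iff) auto
    ultimately have "\<bar>ln h - (ln (x n) - ln (y n))\<bar> \<le> ln (fact n)"
      using hp X(2) Y(2) by (simp add: ln_mult abs_le_iff)
    with ln_fact_le[of n] show ?thesis by (simp add: h_def)
  qed
  have "(\<lambda>n. ln (hole_prob n U) / (real n)\<^sup>2 - (ln (x n) / (real n)\<^sup>2 - ln (y n) / (real n)\<^sup>2)) \<longlonglongrightarrow> 0"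
  proof (rule Lim_null_comparison)
    show "\<forall>\<^sub>F n in sequentially. norm (ln (hole_prob n U) / (real n)\<^sup>2 - (ln (x n) / (real n)\<^sup>2 - ln (y n) / (real n)\<^sup>2))
        \<le> ln (real n) / real n"
      using eventually_ge_at_top[of 2]
    proof eventually_elim
      case (elim n)
      have "norm (ln (hole_prob n U) / (real n)\<^sup>2 - (ln (x n) / (real n)\<^sup>2 - ln (y n) / (real n)\<^sup>2))
          = \<bar>ln (hole_prob n U) - (ln (x n) - ln (y n))\<bar> / (real n)\<^sup>2"
        by (simp add: diff_divide_distrib[symmetric] abs_divide)
      also have "\<dots> \<le> (real n * ln (real n)) / (real n)\<^sup>2"
        by (intro divide_right_mono bound elim) simp
      finally show ?case using elim by (simp add: power2_eq_square)
    qed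
    show "(\<lambda>n. ln (real n) / real n) \<longlonglongrightarrow> 0" by real_asymp
  qed
  from tendsto_add[OF this tendsto_diff[OF lim]]
  have "(\<lambda>n. ln (hole_prob n U) / (real n)\<^sup>2) \<longlonglongrightarrow> \<sigma> - \<rho>" by simp
  then show ?thesis unfolding R by (rule tendsto_ereal)
qed

end
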